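(* Let $d\ge1$, $\beta>0$ and $\varepsilon>0$. For the Gaussian $\delta$-pinning model, the thermodynamic limit $$\mu^{*,\varepsilon}:=\lim_{\Lambda\nearrow\mathbb{Z}^d}\mu_\Lambda^{*,\varepsilon}$$ exists and is translation invariant, where the limit is understood in the sense of convergence of the integrals of bounded local functions.
   Context: $p:\mathbb{Z}^d\to[0,1]$ satisfies $p(x)=p(-x)$, $\sum_x p(x)=1$, is irreducible (for every $x$ there is a path $0=x_0,x_1,\dots,x_n=x$ with $p(x_k-x_{k-1})>0$ for all $k$), and $\sum_x p(x)|x|^{2+\delta}<\infty$ for some $\delta>0$. For finite $\Lambda\subset\mathbb{Z}^d$, the Gaussian $\delta$-pinning measure (interaction $V(x)=\tfrac12x^2$) is the probability measure on $\mathbb{R}^{\mathbb{Z}^d}$ $$\mu_\Lambda^{*,\varepsilon}(\mathrm d\phi)=\frac{1}{Z_\Lambda^{\varepsilon}}\exp\Big[-\frac\beta2\sum_{x,y}p(x-y)\tfrac12(\phi_x-\phi_y)^2\Big]\prod_{x\in\Lambda}(\mathrm d\phi_x+\varepsilon\delta_0(\mathrm d\phi_x))\prod_{x\notin\Lambda}\delta_0(\mathrm d\phi_x),$$ the sum being over all ordered pairs $(x,y)\in\mathbb{Z}^d\times\mathbb{Z}^d$. A function on $\mathbb{R}^{\mathbb{Z}^d}$ is local if it depends only on finitely many coordinates. $\Lambda\nearrow\mathbb{Z}^d$ means along finite subsets ordered by inclusion. *)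

theory Defs
  imports "HOL-Probability.Probability"
begin

text \<open>
  The lattice is \<^typ>\<open>int ^ 'd\<close>, with dimension \<open>CARD('d) \<ge> 1\<close>; a field configuration is a function
  from the lattice to the reals.
\<close>

definition lattice_norm :: "int ^ 'd \<Rightarrow> real" where
  "lattice_norm x = norm (\<chi> i. real_of_int (x $ i))"

definition irreducible_kernel :: "(int ^ 'd \<Rightarrow> real) \<Rightarrow> bool" where
  "irreducible_kernel p \<longleftrightarrow>
     (\<forall>x. \<exists>n (w :: nat \<Rightarrow> int ^ 'd). w 0 = 0 \<and> w n = x \<and> (\<forall>k\<in>{1..n}. p (w k - w (k - 1)) > 0))"

definition config_space :: "((int ^ 'd) \<Rightarrow> real) measure" where
  "config_space = PiM UNIV (\<lambda>_. borel)"

text \<open>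
  The sum runs over all ordered pairs. It converges whenever \<open>p\<close> is summable and \<open>\<phi>\<close> has finite
  support, hence almost everywhere for the reference measures below; the default value 0 of
  \<^const>\<open>infsum\<close> on divergent sums therefore plays no role.
\<close>

definition energy :: "(int ^ 'd \<Rightarrow> real) \<Rightarrow> (int ^ 'd \<Rightarrow> real) \<Rightarrow> real" where
  "energy p \<phi> = (\<Sum>\<^sub>\<infinity>(x, y)\<in>UNIV. p (x - y) * ((1 / 2) * (\<phi> x - \<phi> y)\<^sup>2))"

definition site_measure :: "real \<Rightarrow> real measure" where
  "site_measure \<epsilon> =
     measure_of UNIV (sets borel)
       (\<lambda>A. emeasure lborel A + ennreal \<epsilon> * emeasure (return borel 0) A)"

lemma space_site_measure [simp]: "space (site_measure \<epsilon>) = UNIV"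
  by (simp add: site_measure_def)

lemma sets_site_measure [measurable_cong, simp]: "sets (site_measure \<epsilon>) = sets borel"
  unfolding site_measure_def
  by (metis sets.sigma_sets_eq sets_measure_of space_borel subset_UNIV Pow_UNIV)

lemma emeasure_site_measure:
  assumes "A \<in> sets borel"
  shows "emeasure (site_measure \<epsilon>) A = emeasure lborel A + ennreal \<epsilon> * indicator A 0"
proof -
  have "countably_additive (sets (site_measure \<epsilon>))
          (\<lambda>A. emeasure lborel A + ennreal \<epsilon> * emeasure (return borel (0::real)) A)"
  proof (rule countably_additiveI)
    fix B :: "nat \<Rightarrow> real set"
    assume B: "range B \<subseteq> sets (site_measure \<epsilon>)" "disjoint_family B"
    show "(\<Sum>i. emeasure lborel (B i) + ennreal \<epsilon> * emeasure (return borel 0) (B i)) =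
        emeasure lborel (\<Union> (range B)) + ennreal \<epsilon> * emeasure (return borel 0) (\<Union> (range B))"
      using B by (subst suminf_add[symmetric])
        (auto simp: suminf_emeasure simp del: emeasure_return)
  qed
  then have "emeasure (site_measure \<epsilon>) A =
      emeasure lborel A + ennreal \<epsilon> * emeasure (return borel 0) A"
    using assms
    by (intro emeasure_measure_of[OF site_measure_def]) (auto simp: positive_def)
  then show ?thesis
    using assms by simp
qed

text \<open>
  For finite \<open>\<Lambda>\<close>, the product of \<^term>\<open>site_measure \<epsilon>\<close> over \<open>\<Lambda>\<close> with Dirac masses at 0 outside \<open>\<Lambda>\<close>
  is obtained as the image of the finite product measure under extension by 0. (\<^const>\<open>PiM\<close> over an
  infinite index set is the product measure only for probability measures.)
\<close>

definition reference_measure ::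
    "real \<Rightarrow> (int ^ 'd) set \<Rightarrow> ((int ^ 'd) \<Rightarrow> real) measure" where
  "reference_measure \<epsilon> \<Lambda> =
     distr (PiM \<Lambda> (\<lambda>_. site_measure \<epsilon>)) config_space (\<lambda>\<phi> x. if x \<in> \<Lambda> then \<phi> x else 0)"

definition boltzmann_measure ::
    "(int ^ 'd \<Rightarrow> real) \<Rightarrow> real \<Rightarrow> real \<Rightarrow> (int ^ 'd) set \<Rightarrow> ((int ^ 'd) \<Rightarrow> real) measure" where
  "boltzmann_measure p \<beta> \<epsilon> \<Lambda> =
     density (reference_measure \<epsilon> \<Lambda>) (\<lambda>\<phi>. ennreal (exp (- (\<beta> / 2) * energy p \<phi>)))"

definition partition_function ::
    "(int ^ 'd \<Rightarrow> real) \<Rightarrow> real \<Rightarrow> real \<Rightarrow> (int ^ 'd) set \<Rightarrow> ennreal" where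
  "partition_function p \<beta> \<epsilon> \<Lambda> = emeasure (boltzmann_measure p \<beta> \<epsilon> \<Lambda>) UNIV"

definition pinning_measure ::
    "(int ^ 'd \<Rightarrow> real) \<Rightarrow> real \<Rightarrow> real \<Rightarrow> (int ^ 'd) set \<Rightarrow> ((int ^ 'd) \<Rightarrow> real) measure" where
  "pinning_measure p \<beta> \<epsilon> \<Lambda> =
     scale_measure (1 / partition_function p \<beta> \<epsilon> \<Lambda>) (boltzmann_measure p \<beta> \<epsilon> \<Lambda>)"

definition local_function :: "((int ^ 'd \<Rightarrow> real) \<Rightarrow> real) \<Rightarrow> bool" where
  "local_function f \<longleftrightarrow>
     (\<exists>S. finite S \<and> (\<forall>\<phi> \<psi>. (\<forall>x\<in>S. \<phi> x = \<psi> x) \<longrightarrow> f \<phi> = f \<psi>))"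

text \<open>The filter \<^term>\<open>finite_subsets_at_top UNIV\<close> is the net of finite sets ordered by inclusion.\<close>

definition thermodynamic_limit ::
    "((int ^ 'd) set \<Rightarrow> ((int ^ 'd) \<Rightarrow> real) measure) \<Rightarrow> ((int ^ 'd) \<Rightarrow> real) measure \<Rightarrow> bool" where
  "thermodynamic_limit \<mu>\<Lambda> \<mu> \<longleftrightarrow>
     prob_space \<mu> \<and> sets \<mu> = sets config_space \<and>
     (\<forall>f \<in> borel_measurable config_space. local_function f \<and> bounded (range f) \<longrightarrow>
        ((\<lambda>\<Lambda>. \<integral>\<phi>. f \<phi> \<partial>\<mu>\<Lambda> \<Lambda>) \<longlongrightarrow> (\<integral>\<phi>. f \<phi> \<partial>\<mu>)) (finite_subsets_at_top UNIV))"

definition translation_invariant :: "((int ^ 'd) \<Rightarrow> real) measure \<Rightarrow> bool" where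
  "translation_invariant \<mu> \<longleftrightarrow> (\<forall>a. distr \<mu> config_space (\<lambda>\<phi> x. \<phi> (x + a)) = \<mu>)"

end

theory Submission
  imports Defs "HOL-Real_Asymp.Real_Asymp"
begin

text \<open>
  Expanding the product of \<open>d\<phi> + \<epsilon> \<delta>\<^sub>0\<close> writes the pinning measure as a mixture of centred Gaussian
  laws \<open>\<gamma>\<^sub>A\<close>, where the random set \<open>A\<close> of unpinned sites has weight \<open>Z(A) / \<epsilon>\<^bsup>card A\<^esup>\<close>. Inserting a site
  \<open>x\<close> into \<open>A\<close> adds an independent Gaussian multiple of the function \<open>h\<close> that is harmonic in \<open>A\<close> with
  \<open>h x = 1\<close>; the inverse variance \<open>\<beta> energy h\<close> is a minimal energy, hence decreases in \<open>A\<close>. This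
  has three consequences. The weights satisfy the FKG lattice condition, so expectations of increasing
  functions of \<open>A\<close> increase with the volume. The Green function \<open>G\<^sub>A(y,y)\<close> increases in \<open>A\<close>. For a
  function \<open>f\<close> with values in \<open>[0,1]\<close> that depends on the sites of \<open>S\<close>, averaging over the sign of the
  Gaussian multiple shows that \<open>\<gamma>\<^sub>A(f)\<close> changes by at most \<open>\<beta>\<close> times the increment of \<open>\<Sum>\<^sub>y\<^sub>\<in>\<^sub>S G\<^sub>A(y,y)\<close>;
  hence \<open>\<gamma>\<^sub>A(f)\<close> is a difference of increasing functions of \<open>A\<close>, and its expectations converge as
  soon as those of \<open>G\<^sub>A(y,y)\<close> stay bounded. That bound holds because \<open>G\<^sub>A(y,y) \<le> C k\<close> if \<open>y + k e\<close> is
  pinned, whereas leaving \<open>y, y + e, \<dots>, y + (k - 1) e\<close> unpinned has probability at most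
  \<open>(1 + a / \<surd>k)\<^bsup>-k\<^esup>\<close>. The error bound is uniform in \<open>f\<close>, so the limits of the marginals are
  measures and Kolmogorov's extension theorem applies.
\<close>

section \<open>The FKG inequality\<close>

text \<open>FKG settles only expectations of increasing functions of \<open>A\<close>, and
  \<open>\<gamma>\<^sub>A(f)\<close> is in general not monotone in \<open>A\<close>. The remedy is a
  corrector that depends on \<open>S\<close> but not on \<open>f\<close>. Besides the Green sum it
  contains \<open>card (A \<inter> S)\<close>: when the inserted site lies in \<open>S\<close>, an
  atom at 0 turns into a density, no shift argument is available, and the trivial change of at most
  1 has to be paid for. Being blind to \<open>f\<close>, the corrector serves an event and its
  complement alike and controls all events on \<open>S\<close> at once. The Green bound must hold in
  every dimension, although without pinning the variance of a recurrent walk diverges with the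
  volume. So everything is compared with one half line: its edges alone bound the inverse variance
  below by \<open>\<beta> p(e) / (2 k)\<close> if the site \<open>k\<close> steps away is pinned.
  Pinning one more site of the run then costs at worst a factor
  \<open>\<epsilon> sqrt (\<beta> p(e) / (4 pi k)) = a / sqrt k\<close>. This is small, but any
  subset of the \<open>k\<close> sites may be pinned, and the resulting
  \<open>(1 + a / sqrt k)^k\<close> grows like \<open>exp (a sqrt k)\<close>, which beats the linear
  growth of the Green function.\<close>

lemma sum_Pow_insert:
  assumes "finite U" "x \<notin> U"
  shows "sum f (Pow (insert x U)) = sum f (Pow U) + sum (\<lambda>A. f (insert x A)) (Pow U)"
proof -
  have "inj_on (insert x) (Pow U)"
    using assms(2) by (auto simp: inj_on_def insert_ident)
  moreover have "Pow U \<inter> insert x ` Pow U = {}"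
    using assms(2) by auto
  ultimately show ?thesis
    using assms(1) by (simp add: Pow_insert sum.union_disjoint sum.reindex)
qed

text \<open>For positive \<open>w\<close> this is the one-site form of the FKG lattice condition
  \<open>w A * w B \<le> w (A \<union> B) * w (A \<inter> B)\<close>, with denominators cleared.
  Single insertions are exactly what the Gaussian computation provides.\<close>

definition increasing_ratios :: "'v set \<Rightarrow> ('v set \<Rightarrow> real) \<Rightarrow> bool" where
  "increasing_ratios U w \<longleftrightarrow> (\<forall>A\<subseteq>U. 0 < w A) \<and>
     (\<forall>x A B. A \<subseteq> B \<longrightarrow> insert x B \<subseteq> U \<longrightarrow> x \<notin> B \<longrightarrow> w (insert x A) * w B \<le> w (insert x B) * w A)"

lemma increasing_ratiosD:
  assumes "increasing_ratios U w"
  shows "A \<subseteq> U \<Longrightarrow> 0 < w A"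
    and "A \<subseteq> B \<Longrightarrow> insert x B \<subseteq> U \<Longrightarrow> x \<notin> B \<Longrightarrow> w (insert x A) * w B \<le> w (insert x B) * w A"
  using assms unfolding increasing_ratios_def by blast+

lemma increasing_ratios_subset:
  "increasing_ratios U w \<Longrightarrow> U' \<subseteq> U \<Longrightarrow> increasing_ratios U' w"
  unfolding increasing_ratios_def by (meson order_trans)

lemma increasing_ratios_insert:
  assumes "increasing_ratios (insert x U) w" "x \<notin> U"
  shows "increasing_ratios U (\<lambda>A. w (insert x A))"
  unfolding increasing_ratios_def
proof (intro conjI allI impI)
  fix y A B assume A: "A \<subseteq> B" "insert y B \<subseteq> U" "y \<notin> B"
  have "w (insert y (insert x A)) * w (insert x B) \<le> w (insert y (insert x B)) * w (insert x A)"
    using A assms(2) by (intro increasing_ratiosD(2)[OF assms(1)]) auto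
  then show "w (insert x (insert y A)) * w (insert x B) \<le> w (insert x (insert y B)) * w (insert x A)"
    by (simp add: insert_commute)
next
  fix A assume "A \<subseteq> U"
  then show "0 < w (insert x A)"
    by (intro increasing_ratiosD(1)[OF assms(1)]) auto
qed

lemma mono_on_insert:
  "mono_on (Pow (insert x U)) f \<Longrightarrow> mono_on (Pow U) (\<lambda>A. f (insert x A))"
  by (rule mono_onI, rule mono_onD[of "Pow (insert x U)" f]) auto

text \<open>The law of total covariance with denominators cleared. Index 0 or 1 says whether a given
  site is absent or present, \<open>a\<close> is the mass, and \<open>F\<close>, \<open>G\<close>,
  \<open>H\<close> are the sums of \<open>f\<close>, \<open>g\<close>, \<open>f * g\<close>. The
  hypotheses say that both conditional covariances are nonnegative and that both conditional means
  increase from 0 to 1.\<close>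

lemma two_point_correlation:
  fixes a0 a1 F0 F1 G0 G1 H0 H1 :: real
  assumes pos: "a0 > 0" "a1 > 0" and "F0 * G0 \<le> a0 * H0" "F1 * G1 \<le> a1 * H1"
    and "F0 * a1 \<le> a0 * F1" "G0 * a1 \<le> a0 * G1"
  shows "(F0 + F1) * (G0 + G1) \<le> (a0 + a1) * (H0 + H1)"
proof -
  have "0 \<le> (a0 * F1 - a1 * F0) * (a0 * G1 - a1 * G0)"
    using assms by (intro mult_nonneg_nonneg) (auto simp: mult.commute)
  moreover have "a0 * a1 * ((F0 + F1) * (G0 + G1)) + (a0 * F1 - a1 * F0) * (a0 * G1 - a1 * G0)
      = (a0 + a1) * (a1 * (F0 * G0) + a0 * (F1 * G1))"
    by (simp add: algebra_simps)
  moreover have "(a0 + a1) * (a1 * (F0 * G0) + a0 * (F1 * G1)) \<le> (a0 + a1) * (a1 * (a0 * H0) + a0 * (a1 * H1))"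
    using assms by (intro mult_left_mono add_mono) auto
  ultimately have "a0 * a1 * ((F0 + F1) * (G0 + G1)) \<le> a0 * a1 * ((a0 + a1) * (H0 + H1))"
    by (simp add: algebra_simps)
  then show ?thesis
    using pos by simp
qed

text \<open>Induction over sites, conditioning on whether \<open>x\<close> belongs to the set. The
  induction hypothesis is applied to the weights of either half, and also to a pair that contains
  the weight ratio, hence the generalisation over \<open>w\<close>, \<open>f\<close> and
  \<open>g\<close>.\<close>

lemma FKG_inequality:
  assumes "finite U" "increasing_ratios U w" "mono_on (Pow U) f" "mono_on (Pow U) g"
  shows "(\<Sum>A\<in>Pow U. w A * f A) * (\<Sum>A\<in>Pow U. w A * g A)
       \<le> (\<Sum>A\<in>Pow U. w A) * (\<Sum>A\<in>Pow U. w A * (f A * g A))"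
  using assms
proof (induction U arbitrary: w f g rule: finite_induct)
  case empty
  then show ?case by simp
next
  case (insert x U)
  have w: "increasing_ratios U w"
    using insert.prems(1) by (rule increasing_ratios_subset) auto
  have pos: "0 < w A" "0 < w (insert x A)" if "A \<subseteq> U" for A
    using that by (auto intro!: increasing_ratiosD(1)[OF insert.prems(1)])
  have tot: "0 < (\<Sum>A\<in>Pow U. w A)" "0 < (\<Sum>A\<in>Pow U. w (insert x A))"
    using \<open>finite U\<close> pos by (auto intro!: sum_pos)
  \<comment> \<open>The density of the sets with \<open>x\<close> relative to the sets without
    \<open>x\<close>. It is increasing by the lattice condition, so it may be used as one of the two
    functions in the induction hypothesis.\<close>
  define r where "r A = w (insert x A) / w A" for A
  have r: "mono_on (Pow U) r"
  proof (rule mono_onI)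
    fix A B assume "A \<in> Pow U" "B \<in> Pow U" "A \<subseteq> B"
    moreover from this have "w (insert x A) * w B \<le> w (insert x B) * w A"
      using insert.hyps(2) by (intro increasing_ratiosD(2)[OF insert.prems(1)]) auto
    ultimately show "r A \<le> r B"
      using pos(1)[of A] pos(1)[of B] by (simp add: r_def field_simps)
  qed
  \<comment> \<open>The conditional mean of \<open>f\<close> increases with the presence of
    \<open>x\<close>: inserting \<open>x\<close> raises \<open>f\<close> itself, and correlation
    with \<open>r\<close> raises the mean further when \<open>w\<close> is replaced by
    \<open>w * r\<close>.\<close>
  have shift: "(\<Sum>A\<in>Pow U. w A * f A) * (\<Sum>A\<in>Pow U. w (insert x A))
      \<le> (\<Sum>A\<in>Pow U. w A) * (\<Sum>A\<in>Pow U. w (insert x A) * f (insert x A))"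
    if f: "mono_on (Pow (insert x U)) f" for f
  proof -
    have wr: "w A * r A = w (insert x A)" if "A \<in> Pow U" for A
      using pos(1)[of A] that by (simp add: r_def)
    have "(\<Sum>A\<in>Pow U. w A * f A) \<le> (\<Sum>A\<in>Pow U. w A * f (insert x A))"
      using pos by (intro sum_mono mult_left_mono mono_onD[OF f]) (auto intro: less_imp_le)
    then have "(\<Sum>A\<in>Pow U. w A * f A) * (\<Sum>A\<in>Pow U. w (insert x A))
        \<le> (\<Sum>A\<in>Pow U. w A * f (insert x A)) * (\<Sum>A\<in>Pow U. w A * r A)"
      using tot(2) by (simp add: wr mult_right_mono)
    also have "\<dots> \<le> (\<Sum>A\<in>Pow U. w A) * (\<Sum>A\<in>Pow U. w A * (f (insert x A) * r A))"
      by (rule insert.IH[OF w mono_on_insert[OF f] r])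
    also have "(\<Sum>A\<in>Pow U. w A * (f (insert x A) * r A)) = (\<Sum>A\<in>Pow U. w (insert x A) * f (insert x A))"
      by (intro sum.cong refl) (metis wr mult.assoc mult.commute)
    finally show ?thesis .
  qed
  have f: "mono_on (Pow U) f" and g: "mono_on (Pow U) g"
    using insert.prems(2,3) by (auto intro: mono_on_subset)
  have w1: "increasing_ratios U (\<lambda>A. w (insert x A))"
    by (rule increasing_ratios_insert[OF insert.prems(1) insert.hyps(2)])
  show ?case
    unfolding sum_Pow_insert[OF insert.hyps]
    using tot insert.IH[OF w f g] shift[OF insert.prems(2)] shift[OF insert.prems(3)]
      insert.IH[OF w1 mono_on_insert[OF insert.prems(2)] mono_on_insert[OF insert.prems(3)]]
    by (intro two_point_correlation)
qed

definition weighted_average :: "('v set \<Rightarrow> real) \<Rightarrow> ('v set \<Rightarrow> real) \<Rightarrow> 'v set \<Rightarrow> real" where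
  "weighted_average w f U = (\<Sum>A\<in>Pow U. w A * f A) / (\<Sum>A\<in>Pow U. w A)"

text \<open>The average over \<open>U\<close> is the average over \<open>insert x U\<close>
  conditioned on the absence of \<open>x\<close>. Presence of \<open>x\<close> is an increasing
  event, so FKG says that this conditioning can only lower the mean of \<open>f\<close>.\<close>

lemma weighted_average_insert_mono:
  assumes "finite U" "x \<notin> U" "increasing_ratios (insert x U) w" "mono_on (Pow (insert x U)) f"
  shows "weighted_average w f U \<le> weighted_average w f (insert x U)"
proof -
  define g where "g A = (if x \<in> A then 1 else 0 :: real)" for A
  let ?a0 = "\<Sum>A\<in>Pow U. w A" and ?a1 = "\<Sum>A\<in>Pow U. w (insert x A)"
  let ?F0 = "\<Sum>A\<in>Pow U. w A * f A" and ?F1 = "\<Sum>A\<in>Pow U. w (insert x A) * f (insert x A)"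
  have g: "g A = 0" if "A \<in> Pow U" for A
    using that assms(2) by (auto simp: g_def)
  have "mono_on (Pow (insert x U)) g"
    by (rule mono_onI) (auto simp: g_def)
  from FKG_inequality[OF _ assms(3,4) this] assms(1)
  have "(?F0 + ?F1) * ?a1 \<le> (?a0 + ?a1) * ?F1"
    unfolding sum_Pow_insert[OF assms(1,2)] by (simp add: g) (simp add: g_def)
  then have "?F0 * (?a0 + ?a1) \<le> (?F0 + ?F1) * ?a0"
    by (simp add: algebra_simps)
  moreover have "0 < ?a0" "0 < ?a1"
    using assms(1) by (auto intro!: sum_pos increasing_ratiosD(1)[OF assms(3)])
  ultimately show ?thesis
    unfolding weighted_average_def sum_Pow_insert[OF assms(1,2)]
    by (simp add: field_simps)
qed

lemma weighted_average_mono: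
  assumes "finite U'" "U \<subseteq> U'" "increasing_ratios U' w" "mono_on (Pow U') f"
  shows "weighted_average w f U \<le> weighted_average w f U'"
proof -
  have "weighted_average w f U \<le> weighted_average w f (U \<union> D)"
    if "finite D" "U \<union> D \<subseteq> U'" for D
    using that
  proof (induction D rule: finite_induct)
    case (insert x D)
    have "weighted_average w f (U \<union> D) \<le> weighted_average w f (insert x (U \<union> D))"
    proof (cases "x \<in> U \<union> D")
      case False
      then show ?thesis
        using insert.prems insert.hyps finite_subset[OF assms(2,1)] assms(3,4)
        by (intro weighted_average_insert_mono)
          (auto intro: increasing_ratios_subset[OF assms(3)] mono_on_subset[OF assms(4)])
    qed (simp add: insert_absorb)
    then show ?case
      using insert by simp
  qed simp
  from this[of "U' - U"] show ?thesis
    using assms(1,2) by (simp add: Un_absorb1)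
qed

lemma sum_power_card_Pow:
  fixes r :: real
  assumes "finite L"
  shows "(\<Sum>C\<in>Pow L. r ^ card C) = (1 + r) ^ card L"
  using assms
proof (induction rule: finite_induct)
  case (insert x L)
  have "card (insert x C) = Suc (card C)" if "C \<in> Pow L" for C
    using that insert.hyps finite_subset by (subst card_insert_disjoint) auto
  then have "(\<Sum>C\<in>Pow L. r ^ card (insert x C)) = r * (\<Sum>C\<in>Pow L. r ^ card C)"
    unfolding sum_distrib_left by (intro sum.cong) auto
  then show ?case
    using insert by (simp add: sum_Pow_insert algebra_simps)
qed simp

text \<open>Sets containing \<open>L\<close> are unlikely if removing any subset of \<open>L\<close> from them is cheap: the map
  \<open>(A, C) \<mapsto> A - C\<close> is injective.\<close>

lemma removal_bound:
  fixes w :: "'v set \<Rightarrow> real"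
  assumes "finite U" "finite L" "\<And>A. A \<subseteq> U \<Longrightarrow> 0 \<le> w A"
    and T: "\<And>A. A \<in> T \<Longrightarrow> L \<subseteq> A \<and> A \<subseteq> U"
    and removal: "\<And>A C. A \<in> T \<Longrightarrow> C \<subseteq> L \<Longrightarrow> r ^ card C * w A \<le> w (A - C)"
  shows "(\<Sum>A\<in>T. w A) * (1 + r) ^ card L \<le> (\<Sum>A\<in>Pow U. w A)"
proof -
  have "(\<Sum>A\<in>T. w A) * (1 + r) ^ card L = (\<Sum>(A, C)\<in>T \<times> Pow L. r ^ card C * w A)"
    unfolding sum_power_card_Pow[OF assms(2), symmetric] sum_product sum.cartesian_product
    by (simp add: mult.commute)
  also have "\<dots> \<le> (\<Sum>(A, C)\<in>T \<times> Pow L. w (A - C))"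
    using removal by (intro sum_mono) auto
  also have "\<dots> = sum w ((\<lambda>(A, C). A - C) ` (T \<times> Pow L))"
  proof (subst sum.reindex)
    show "inj_on (\<lambda>(A, C). A - C) (T \<times> Pow L)"
      using T by (auto simp: inj_on_def) blast+
  qed (simp add: case_prod_unfold)
  also have "\<dots> \<le> sum w (Pow U)"
    using assms by (intro sum_mono2) auto
  finally show ?thesis .
qed

section \<open>The Dirichlet form\<close>

lemma has_sum_sum:
  fixes f :: "'i \<Rightarrow> 'a \<Rightarrow> 'b::topological_comm_monoid_add"
  assumes "\<And>i. i \<in> I \<Longrightarrow> (f i has_sum s i) A"
  shows "((\<lambda>x. \<Sum>i\<in>I. f i x) has_sum (\<Sum>i\<in>I. s i)) A"
  using assms by (induction I rule: infinite_finite_induct) (auto intro: has_sum_add)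

locale random_walk_kernel =
  fixes p :: "int ^ 'd \<Rightarrow> real"
  assumes kernel_nonneg: "0 \<le> p x"
    and kernel_sym: "p (- x) = p x"
    and kernel_sum: "(p has_sum 1) UNIV"
begin

text \<open>The form \<open>\<langle>\<phi>, (1 - P) \<psi>\<rangle>\<close>, where \<open>P\<close>
  is the transition operator with kernel \<open>p (x - y)\<close>. For functions supported in
  \<open>U\<close> the value does not depend on \<open>U\<close>; restricting to finite sums makes
  bilinearity free of summability conditions.\<close>

definition dirichlet :: "(int ^ 'd) set \<Rightarrow> (int ^ 'd \<Rightarrow> real) \<Rightarrow> (int ^ 'd \<Rightarrow> real) \<Rightarrow> real" where
  "dirichlet U \<phi> \<psi> = (\<Sum>x\<in>U. \<phi> x * \<psi> x) - (\<Sum>x\<in>U. \<Sum>y\<in>U. p (x - y) * (\<phi> x * \<psi> y))"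

lemma kernel_swap: "p (x - y) = p (y - x)"
  using kernel_sym[of "x - y"] by simp

lemma has_sum_row:
  assumes "finite U" "\<And>x. x \<notin> U \<Longrightarrow> f x = 0"
  shows "((\<lambda>(x, y). p (x - y) * f x) has_sum (\<Sum>x\<in>U. f x)) UNIV"
proof -
  have one: "((\<lambda>z. if fst z = u then p (u - snd z) * f u else 0) has_sum f u) UNIV" for u
  proof -
    have bij: "bij_betw (\<lambda>y. u - y) UNIV (UNIV :: (int ^ 'd) set)"
      by (rule bij_betwI[where g = "\<lambda>y. u - y"]) auto
    have "((\<lambda>y. p (u - y)) has_sum 1) UNIV"
      using has_sum_reindex_bij_betw[OF bij, of p 1] kernel_sum by simp
    from has_sum_cmult_right[OF this, of "f u"]
    have "((\<lambda>z. if fst z = u then p (u - snd z) * f u else 0) \<circ> Pair u has_sum f u) UNIV"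
      by (simp add: o_def mult.commute)
    then have "((\<lambda>z. if fst z = u then p (u - snd z) * f u else 0) has_sum f u) (range (Pair u))"
      by (subst has_sum_reindex) (auto simp: inj_on_def)
    then show ?thesis
      by (subst (asm) has_sum_cong_neutral[where T = UNIV]) (auto simp: image_iff)
  qed
  have "((\<lambda>z. \<Sum>u\<in>U. if fst z = u then p (u - snd z) * f u else 0) has_sum (\<Sum>x\<in>U. f x)) UNIV"
    by (intro has_sum_sum one)
  also have "(\<lambda>z. \<Sum>u\<in>U. if fst z = u then p (u - snd z) * f u else 0) = (\<lambda>(x, y). p (x - y) * f x)"
    using assms by (auto simp: fun_eq_iff)
  finally show ?thesis .
qed

text \<open>Expanding the square gives half a row sum, half a column sum and a cross term that lives
  on \<open>U \<times> U\<close>. Rows and columns of the kernel sum to 1, so ordered pairs together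
  with the factor 1/2 produce \<open>1 - P\<close> with no further constant.\<close>

lemma has_sum_energy:
  assumes "finite U" "\<And>x. x \<notin> U \<Longrightarrow> \<phi> x = 0"
  shows "((\<lambda>(x, y). p (x - y) * ((1 / 2) * (\<phi> x - \<phi> y)\<^sup>2)) has_sum dirichlet U \<phi> \<phi>) UNIV"
proof -
  let ?s = "\<Sum>x\<in>U. (\<phi> x)\<^sup>2"
  have row: "((\<lambda>(x, y). p (x - y) * (\<phi> x)\<^sup>2) has_sum ?s) UNIV"
    using assms by (intro has_sum_row) auto
  have bij: "bij_betw prod.swap UNIV (UNIV :: ((int ^ 'd) \<times> (int ^ 'd)) set)"
    by (rule bij_betwI[where g = prod.swap]) auto
  have col: "((\<lambda>(x, y). p (x - y) * (\<phi> y)\<^sup>2) has_sum ?s) UNIV"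
    using row has_sum_reindex_bij_betw[OF bij, of "\<lambda>(x, y). p (x - y) * (\<phi> x)\<^sup>2" ?s]
    by (simp add: case_prod_unfold kernel_swap)
  have "((\<lambda>(x, y). p (x - y) * (\<phi> x * \<phi> y)) has_sum
      (\<Sum>(x, y)\<in>U \<times> U. p (x - y) * (\<phi> x * \<phi> y))) (U \<times> U)"
    using assms(1) by (intro has_sum_finite) auto
  then have cross: "((\<lambda>(x, y). p (x - y) * (\<phi> x * \<phi> y)) has_sum
      (\<Sum>(x, y)\<in>U \<times> U. p (x - y) * (\<phi> x * \<phi> y))) UNIV"
    using assms(2) by (subst (asm) has_sum_cong_neutral[where T = UNIV]) (auto, metis+)
  have "((\<lambda>z. (1 / 2) * (case z of (x, y) \<Rightarrow> p (x - y) * (\<phi> x)\<^sup>2) +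
        ((1 / 2) * (case z of (x, y) \<Rightarrow> p (x - y) * (\<phi> y)\<^sup>2) +
        (- 1) * (case z of (x, y) \<Rightarrow> p (x - y) * (\<phi> x * \<phi> y)))) has_sum
      ((1 / 2) * ?s + ((1 / 2) * ?s + (- 1) * (\<Sum>(x, y)\<in>U \<times> U. p (x - y) * (\<phi> x * \<phi> y))))) UNIV"
    by (intro has_sum_add has_sum_cmult_right row col cross)
  moreover have "(\<lambda>z. (1 / 2) * (case z of (x, y) \<Rightarrow> p (x - y) * (\<phi> x)\<^sup>2) +
        ((1 / 2) * (case z of (x, y) \<Rightarrow> p (x - y) * (\<phi> y)\<^sup>2) +
        (- 1) * (case z of (x, y) \<Rightarrow> p (x - y) * (\<phi> x * \<phi> y))))
      = (\<lambda>(x, y). p (x - y) * ((1 / 2) * (\<phi> x - \<phi> y)\<^sup>2))"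
    by (auto simp: fun_eq_iff power2_eq_square algebra_simps)
  ultimately show ?thesis
    by (simp add: dirichlet_def sum.cartesian_product power2_eq_square)
qed

lemma energy_eq_dirichlet:
  "finite U \<Longrightarrow> (\<And>x. x \<notin> U \<Longrightarrow> \<phi> x = 0) \<Longrightarrow> energy p \<phi> = dirichlet U \<phi> \<phi>"
  unfolding energy_def by (intro infsumI has_sum_energy)

lemma dirichlet_sym: "dirichlet U \<phi> \<psi> = dirichlet U \<psi> \<phi>"
proof -
  have "(\<Sum>x\<in>U. \<Sum>y\<in>U. p (x - y) * (\<phi> x * \<psi> y)) = (\<Sum>x\<in>U. \<Sum>y\<in>U. p (x - y) * (\<psi> x * \<phi> y))"
    by (subst sum.swap) (simp add: kernel_swap mult.commute[of "\<phi> _"])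
  then show ?thesis
    by (simp add: dirichlet_def mult.commute)
qed

lemma dirichlet_add: "dirichlet U (\<lambda>x. \<phi> x + c * \<phi>' x) \<psi> = dirichlet U \<phi> \<psi> + c * dirichlet U \<phi>' \<psi>"
  by (simp add: dirichlet_def algebra_simps sum.distrib sum_distrib_left)

lemma dirichlet_add_right: "dirichlet U \<psi> (\<lambda>x. \<phi> x + c * \<phi>' x) = dirichlet U \<psi> \<phi> + c * dirichlet U \<psi> \<phi>'"
  using dirichlet_add[of U \<phi> c \<phi>' \<psi>] by (simp add: dirichlet_sym)

lemma dirichlet_square_add:
  "dirichlet U (\<lambda>x. \<phi> x + c * \<psi> x) (\<lambda>x. \<phi> x + c * \<psi> x)
    = dirichlet U \<phi> \<phi> + 2 * c * dirichlet U \<phi> \<psi> + c\<^sup>2 * dirichlet U \<psi> \<psi>"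
  by (simp add: dirichlet_add dirichlet_add_right dirichlet_sym[of U \<psi> \<phi>] power2_eq_square algebra_simps)

lemma energy_nonneg: "0 \<le> energy p \<phi>"
  unfolding energy_def by (intro infsum_nonneg) (auto simp: kernel_nonneg)

lemma energy_parallelogram:
  assumes "finite U" "\<And>x. x \<notin> U \<Longrightarrow> \<phi> x = 0" "\<And>x. x \<notin> U \<Longrightarrow> \<psi> x = 0"
  shows "energy p (\<lambda>x. \<phi> x + c * \<psi> x) + energy p (\<lambda>x. \<phi> x + (- c) * \<psi> x)
    = 2 * energy p \<phi> + 2 * c\<^sup>2 * energy p \<psi>"
  using assms dirichlet_square_add[of U \<phi> c \<psi>] dirichlet_square_add[of U \<phi> "- c" \<psi>]
  by (simp add: energy_eq_dirichlet[of U])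

text \<open>This is \<open>1 - P \<le> 2\<close>. Nonnegativity of the energy of the absolute value
  of \<open>\<phi>\<close> bounds the cross term with absolute values by the diagonal, and this
  controls the signed cross term from below.\<close>

lemma energy_le_sum_squares:
  assumes "finite U" "\<And>x. x \<notin> U \<Longrightarrow> \<phi> x = 0"
  shows "energy p \<phi> \<le> 2 * (\<Sum>x\<in>U. (\<phi> x)\<^sup>2)"
proof -
  have "0 \<le> energy p (\<lambda>x. \<bar>\<phi> x\<bar>)"
    by (rule energy_nonneg)
  also have "\<dots> = dirichlet U (\<lambda>x. \<bar>\<phi> x\<bar>) (\<lambda>x. \<bar>\<phi> x\<bar>)"
    using assms by (intro energy_eq_dirichlet) auto
  finally have "(\<Sum>x\<in>U. \<Sum>y\<in>U. p (x - y) * (\<bar>\<phi> x\<bar> * \<bar>\<phi> y\<bar>)) \<le> (\<Sum>x\<in>U. (\<phi> x)\<^sup>2)"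
    by (simp add: dirichlet_def power2_eq_square flip: abs_mult)
  moreover have "- (\<Sum>x\<in>U. \<Sum>y\<in>U. p (x - y) * (\<phi> x * \<phi> y)) \<le> (\<Sum>x\<in>U. \<Sum>y\<in>U. p (x - y) * (\<bar>\<phi> x\<bar> * \<bar>\<phi> y\<bar>))"
    unfolding sum_negf[symmetric]
  proof (intro sum_mono)
    fix x y
    have "- (\<phi> x * \<phi> y) \<le> \<bar>\<phi> x\<bar> * \<bar>\<phi> y\<bar>"
      by (simp flip: abs_mult)
    then show "- (p (x - y) * (\<phi> x * \<phi> y)) \<le> p (x - y) * (\<bar>\<phi> x\<bar> * \<bar>\<phi> y\<bar>)"
      using mult_left_mono[OF _ kernel_nonneg[of "x - y"]] by fastforce
  qed
  moreover have "energy p \<phi> = dirichlet U \<phi> \<phi>"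
    using assms by (intro energy_eq_dirichlet)
  ultimately show ?thesis
    by (simp add: dirichlet_def power2_eq_square)
qed

lemma energy_shift: "energy p (\<lambda>x. \<phi> (x + a)) = energy p \<phi>"
proof -
  have "bij_betw (\<lambda>(x, y). (x + a, y + a)) UNIV (UNIV :: ((int ^ 'd) \<times> (int ^ 'd)) set)"
    by (rule bij_betwI[where g = "\<lambda>(x, y). (x - a, y - a)"]) auto
  from infsum_reindex_bij_betw[OF this, of "\<lambda>(x, y). p (x - y) * ((1 / 2) * (\<phi> x - \<phi> y)\<^sup>2)"]
  show ?thesis
    by (simp add: energy_def case_prod_unfold)
qed

end

section \<open>Energy bounds along a half line\<close>

definition multiple :: "nat \<Rightarrow> int ^ 'd \<Rightarrow> int ^ 'd" where
  "multiple k e = (\<chi> i. int k * e $ i)"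

lemma multiple_0 [simp]: "multiple 0 e = 0"
  and multiple_Suc: "multiple (Suc k) e = multiple k e + e"
  and multiple_add: "multiple (j + k) e = multiple j e + multiple k e"
  by (simp_all add: multiple_def vec_eq_iff algebra_simps)

lemma multiple_eq_iff:
  assumes "e \<noteq> 0"
  shows "multiple j e = multiple k e \<longleftrightarrow> j = k"
proof -
  obtain i where "e $ i \<noteq> 0"
    using assms by (auto simp: vec_eq_iff)
  then show ?thesis
    by (auto simp: multiple_def vec_eq_iff)
qed

locale lattice_walk = random_walk_kernel p for p :: "int ^ 'd \<Rightarrow> real" +
  fixes e :: "int ^ 'd"
  assumes step_nonzero: "e \<noteq> 0" and step_pos: "0 < p e"
begin

text \<open>Telescope from \<open>y\<close> to the zero at \<open>y + multiple k e\<close> and apply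
  Cauchy-Schwarz; in network terms this bounds the resistance between the two sites by that of the
  path. Each edge is counted in one of its two orientations only, hence the factor 2.\<close>

lemma path_bound:
  assumes "finite U" "\<And>x. x \<notin> U \<Longrightarrow> \<phi> x = 0" "\<phi> (y + multiple k e) = 0"
  shows "(\<phi> y)\<^sup>2 \<le> 2 * real k / p e * energy p \<phi>"
proof -
  let ?d = "\<lambda>j. \<phi> (y + multiple j e) - \<phi> (y + multiple (Suc j) e)"
  let ?e = "\<lambda>(x, y). p (x - y) * ((1 / 2) * (\<phi> x - \<phi> y)\<^sup>2)"
  let ?g = "\<lambda>j. (y + multiple j e, y + multiple (Suc j) e)"
  have inj: "inj_on ?g {..<k}"
    by (auto simp: inj_on_def multiple_eq_iff step_nonzero)
  have "p e * (1 / 2) * (\<Sum>j<k. (?d j)\<^sup>2) = (\<Sum>j<k. ?e (?g j))"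
    using kernel_sym[of e] by (simp add: multiple_Suc sum_distrib_left algebra_simps)
  also have "\<dots> = sum ?e (?g ` {..<k})"
    by (subst sum.reindex[OF inj]) (simp only: o_def)
  also have "\<dots> \<le> energy p \<phi>"
    unfolding energy_def
  proof (rule finite_sum_le_infsum)
    show "?e summable_on UNIV"
      using has_sum_energy[OF assms(1,2)] by (rule has_sum_imp_summable)
  qed (auto simp: kernel_nonneg)
  finally have *: "(\<Sum>j<k. (?d j)\<^sup>2) \<le> 2 / p e * energy p \<phi>"
    using step_pos by (simp add: field_simps)
  have "\<phi> y = (\<Sum>j<k. ?d j)"
    using assms(3) by (subst sum_lessThan_telescope') simp
  then have "(\<phi> y)\<^sup>2 = (\<Sum>j<k. ?d j)\<^sup>2"
    by simp
  also have "\<dots> \<le> (\<Sum>j<k. (?d j)\<^sup>2) * (\<Sum>j<k. 1\<^sup>2)"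
    using Cauchy_Schwarz_ineq_sum[of ?d "\<lambda>_. 1" "{..<k}"] by simp
  also have "\<dots> \<le> 2 / p e * energy p \<phi> * real k"
    using mult_right_mono[OF *, of "real k"] by simp
  finally show ?thesis
    by (simp add: mult.commute mult.left_commute)
qed

lemma ex_multiple_notin:
  assumes "finite U"
  shows "\<exists>k. y + multiple k e \<notin> U"
proof (rule ccontr)
  assume "\<nexists>k. y + multiple k e \<notin> U"
  then have "finite (range (\<lambda>k. y + multiple k e))"
    by (intro finite_subset[OF _ assms]) auto
  moreover have "inj (\<lambda>k. y + multiple k e)"
    by (auto simp: inj_def multiple_eq_iff step_nonzero)
  ultimately show False
    using finite_imageD by blast
qed

text \<open>The zero boundary condition is what excludes nonzero functions of zero energy: the half
  line from \<open>y\<close> leaves the finite set \<open>U\<close>, so \<open>path_bound\<close>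
  applies.\<close>

lemma energy_pos:
  assumes "finite U" "\<And>x. x \<notin> U \<Longrightarrow> \<phi> x = 0" "\<phi> y \<noteq> 0"
  shows "0 < energy p \<phi>"
proof -
  obtain k where "y + multiple k e \<notin> U"
    using ex_multiple_notin[OF assms(1)] by blast
  then have "(\<phi> y)\<^sup>2 \<le> 2 * real k / p e * energy p \<phi>"
    using assms by (intro path_bound) auto
  moreover have "0 < (\<phi> y)\<^sup>2"
    using assms(3) by simp
  ultimately have "energy p \<phi> \<noteq> 0"
    by auto
  then show ?thesis
    using energy_nonneg[of \<phi>] by simp
qed

section \<open>Harmonic functions and their energies\<close>

text \<open>Gram-Schmidt for \<open>dirichlet V\<close>, one site at a time. Here
  \<open>\<phi>\<close> is general because the induction hypothesis is needed both for it and for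
  the point mass at the new site.\<close>

lemma orthogonal_projection:
  assumes "finite V" "A \<subseteq> V"
  shows "\<exists>u. (\<forall>x. x \<notin> A \<longrightarrow> u x = 0) \<and>
    (\<forall>\<psi>. (\<forall>x. x \<notin> A \<longrightarrow> \<psi> x = 0) \<longrightarrow> dirichlet V (\<lambda>x. \<phi> x - u x) \<psi> = 0)"
proof -
  have "finite A"
    using assms by (rule rev_finite_subset)
  then show ?thesis
    using \<open>A \<subseteq> V\<close>
  proof (induction A arbitrary: \<phi> rule: finite_induct)
    case empty
    show ?case
      by (rule exI[of _ "\<lambda>_. 0"]) (auto simp: dirichlet_def)
  next
    case (insert a A)
    define \<delta> where "\<delta> x = (if x = a then 1 else 0 :: real)" for x
    obtain v where v: "\<And>x. x \<notin> A \<Longrightarrow> v x = 0"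
      "\<And>\<psi>. (\<forall>x. x \<notin> A \<longrightarrow> \<psi> x = 0) \<Longrightarrow> dirichlet V (\<lambda>x. \<delta> x - v x) \<psi> = 0"
      using insert.IH[of \<delta>] insert.prems by auto
    obtain u where u: "\<And>x. x \<notin> A \<Longrightarrow> u x = 0"
      "\<And>\<psi>. (\<forall>x. x \<notin> A \<longrightarrow> \<psi> x = 0) \<Longrightarrow> dirichlet V (\<lambda>x. \<phi> x - u x) \<psi> = 0"
      using insert.IH[of \<phi>] insert.prems by auto
    \<comment> \<open>The new basis vector: the component of the point mass at \<open>a\<close> that
      is orthogonal to all functions on \<open>A\<close>. It equals 1 at \<open>a\<close>, hence has
      positive energy, and \<open>c\<close> below is the coefficient along it.\<close>
    define g where "g x = \<delta> x - v x" for x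
    have g: "g x = 0" if "x \<notin> insert a A" for x
      using that v(1) by (auto simp: g_def \<delta>_def)
    have ga: "g a = 1"
      using v(1) insert.hyps by (simp add: g_def \<delta>_def)
    have "energy p g = dirichlet V g g"
      using insert.prems g by (intro energy_eq_dirichlet[OF assms(1)]) (meson subsetD)
    then have pos: "0 < dirichlet V g g"
      using energy_pos[of "insert a A" g a] insert.hyps g ga by simp
    define c where "c = dirichlet V (\<lambda>x. \<phi> x - u x) g / dirichlet V g g"
    show ?case
    proof (intro exI[of _ "\<lambda>x. u x + c * g x"] conjI allI impI)
      fix x assume "x \<notin> insert a A"
      then show "u x + c * g x = 0"
        using u(1) g by auto
    next
      fix \<psi> :: "int ^ 'd \<Rightarrow> real" assume \<psi>: "\<forall>x. x \<notin> insert a A \<longrightarrow> \<psi> x = 0"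
      \<comment> \<open>Since \<open>g a = 1\<close>, this splits a test function on
        \<open>insert a A\<close> into one on \<open>A\<close> and a multiple of
        \<open>g\<close>.\<close>
      define \<psi>' where "\<psi>' x = \<psi> x - \<psi> a * g x" for x
      have \<psi>': "\<forall>x. x \<notin> A \<longrightarrow> \<psi>' x = 0"
        using \<psi> g ga unfolding \<psi>'_def by (metis diff_self insertE mult_1_right mult_zero_right)
      have eq: "\<psi> = (\<lambda>x. \<psi>' x + \<psi> a * g x)"
        by (simp add: \<psi>'_def)
      have "dirichlet V (\<lambda>x. \<phi> x - (u x + c * g x)) \<psi>
          = dirichlet V (\<lambda>x. \<phi> x - u x) \<psi> - c * dirichlet V g \<psi>"
        using dirichlet_add[of V "\<lambda>x. \<phi> x - u x" "- c" g \<psi>] by (simp add: algebra_simps)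
      also have "dirichlet V (\<lambda>x. \<phi> x - u x) \<psi> = \<psi> a * dirichlet V (\<lambda>x. \<phi> x - u x) g"
        by (subst eq, subst dirichlet_add_right) (simp add: u(2)[OF \<psi>'])
      also have "dirichlet V g \<psi> = \<psi> a * dirichlet V g g"
        using v(2)[OF \<psi>'] by (subst eq, subst dirichlet_add_right) (simp flip: g_def)
      finally show "dirichlet V (\<lambda>x. \<phi> x - (u x + c * g x)) \<psi> = 0"
        using pos by (simp add: c_def)
    qed
  qed
qed

text \<open>For \<open>x\<close> outside the finite set \<open>A\<close>, \<open>h y\<close> is the
  probability that the walk from \<open>y\<close> in \<open>A\<close> meets \<open>x\<close> before
  any other site outside \<open>A\<close>. Harmonicity is stated as a Pythagoras identity for the
  energy, the form in which the Gaussian integrals and the minimality argument use it.\<close>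

definition harmonic_at :: "(int ^ 'd) set \<Rightarrow> int ^ 'd \<Rightarrow> (int ^ 'd \<Rightarrow> real) \<Rightarrow> bool" where
  "harmonic_at A x h \<longleftrightarrow> h x = 1 \<and> (\<forall>y. y \<notin> insert x A \<longrightarrow> h y = 0) \<and>
     (\<forall>\<phi> z. (\<forall>y. y \<notin> A \<longrightarrow> \<phi> y = 0) \<longrightarrow>
       energy p (\<lambda>y. \<phi> y + z * h y) = energy p \<phi> + z\<^sup>2 * energy p h)"

text \<open>\<open>h\<close> is the point mass at \<open>x\<close> minus its projection to the
  functions on \<open>A\<close>.\<close>

lemma ex_harmonic:
  assumes "finite A" "x \<notin> A"
  shows "\<exists>h. harmonic_at A x h"
proof -
  let ?V = "insert x A"
  define \<delta> where "\<delta> y = (if y = x then 1 else 0 :: real)" for y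
  obtain u where u: "\<And>y. y \<notin> A \<Longrightarrow> u y = 0"
    "\<And>\<psi>. (\<forall>y. y \<notin> A \<longrightarrow> \<psi> y = 0) \<Longrightarrow> dirichlet ?V (\<lambda>y. \<delta> y - u y) \<psi> = 0"
    using orthogonal_projection[of ?V A \<delta>] assms(1) by auto
  define h where "h y = \<delta> y - u y" for y
  have h: "h x = 1" "\<And>y. y \<notin> ?V \<Longrightarrow> h y = 0"
    using u(1) assms(2) by (auto simp: h_def \<delta>_def)
  moreover have "energy p (\<lambda>y. \<phi> y + z * h y) = energy p \<phi> + z\<^sup>2 * energy p h"
    if \<phi>: "\<forall>y. y \<notin> A \<longrightarrow> \<phi> y = 0" for \<phi> z
  proof -
    have "dirichlet ?V \<phi> h = 0"
      using u(2)[OF \<phi>] by (simp add: dirichlet_sym h_def[abs_def])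
    moreover have "energy p \<phi> = dirichlet ?V \<phi> \<phi>" "energy p h = dirichlet ?V h h"
      "energy p (\<lambda>y. \<phi> y + z * h y) = dirichlet ?V (\<lambda>y. \<phi> y + z * h y) (\<lambda>y. \<phi> y + z * h y)"
      using assms h \<phi> by (intro energy_eq_dirichlet; auto)+
    ultimately show ?thesis
      by (simp add: dirichlet_square_add)
  qed
  ultimately have "harmonic_at A x h"
    by (simp add: harmonic_at_def)
  then show ?thesis
    by blast
qed

lemma harmonic_atD:
  assumes "harmonic_at A x h"
  shows "h x = 1" "y \<notin> insert x A \<Longrightarrow> h y = 0"
    "(\<And>y. y \<notin> A \<Longrightarrow> \<phi> y = 0) \<Longrightarrow> energy p (\<lambda>y. \<phi> y + z * h y) = energy p \<phi> + z\<^sup>2 * energy p h"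
  using assms unfolding harmonic_at_def by blast+

lemma harmonic_energy_pos:
  assumes "finite A" "harmonic_at A x h"
  shows "0 < energy p h"
  using assms harmonic_atD[OF assms(2)] by (intro energy_pos[of "insert x A" h x]) auto

text \<open>The difference \<open>h - h'\<close> vanishes outside \<open>B\<close>, also at
  \<open>x\<close>, where both functions are 1. Pythagoras for \<open>h'\<close> then gives the
  energy of \<open>h\<close> as that of \<open>h'\<close> plus that of the difference.\<close>

lemma harmonic_energy_antimono:
  assumes "A \<subseteq> B" "x \<notin> B" "harmonic_at A x h" "harmonic_at B x h'"
  shows "energy p h' \<le> energy p h"
proof -
  have "energy p (\<lambda>y. (h y - h' y) + 1 * h' y) = energy p (\<lambda>y. h y - h' y) + 1\<^sup>2 * energy p h'"
  proof (rule harmonic_atD(3)[OF assms(4)])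
    fix y assume "y \<notin> B"
    then show "h y - h' y = 0"
      using harmonic_atD(1,2)[OF assms(3)] harmonic_atD(1,2)[OF assms(4)] assms(1)
      by (cases "y = x") auto
  qed
  then show ?thesis
    using energy_nonneg[of "\<lambda>y. h y - h' y"] by simp
qed

lemma harmonic_energy_lower_bound:
  assumes "finite A" "harmonic_at A x h" "x + multiple k e \<notin> insert x A"
  shows "p e / (2 * real k) \<le> energy p h"
proof -
  have "(h x)\<^sup>2 \<le> 2 * real k / p e * energy p h"
    using assms harmonic_atD[OF assms(2)] by (intro path_bound[of "insert x A"]) auto
  then have "1 \<le> 2 * real k / p e * energy p h"
    using harmonic_atD(1)[OF assms(2)] by simp
  moreover from this have "k \<noteq> 0"
    by (rule_tac notI) simp
  ultimately show ?thesis
    using step_pos by (simp add: field_simps)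
qed

end

text \<open>If 0 were the only possible step, no path could leave the origin; but one leads to the
  vector with all entries 1.\<close>

lemma irreducible_kernel_step:
  fixes p :: "int ^ 'd \<Rightarrow> real"
  assumes "irreducible_kernel p"
  shows "\<exists>e. e \<noteq> 0 \<and> 0 < p e"
proof (rule ccontr)
  assume none: "\<nexists>e. e \<noteq> 0 \<and> 0 < p e"
  obtain n and w :: "nat \<Rightarrow> int ^ 'd" where w: "w 0 = 0" "w n = 1" "\<forall>k\<in>{1..n}. p (w k - w (k - 1)) > 0"
    using assms[unfolded irreducible_kernel_def, rule_format, of 1] by blast
  have "w k = 0" if "k \<le> n" for k
    using that
  proof (induction k)
    case (Suc k)
    then have "p (w (Suc k) - w k) > 0"
      using w(3) Suc.prems by (auto dest: bspec[of _ _ "Suc k"])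
    then show ?case
      using none Suc by auto
  qed (simp add: w)
  then show False
    using w(2) by (simp add: vec_eq_iff)
qed

text \<open>Both sides have the value 0 when the sum diverges, so no summability is assumed. The
  integral form gives measurability of \<open>energy\<close> on the whole configuration
  space.\<close>

lemma infsum_real_eq_integral_count_space:
  fixes f :: "'a \<Rightarrow> real"
  shows "infsum f A = (\<integral>x. f x \<partial>count_space A)"
proof (cases "integrable (count_space A) f")
  case True
  then show ?thesis
    by (metis abs_summable_on_def infsetsum_def infsetsum_infsum)
next
  case False
  then have "\<not> f summable_on A"
    by (metis abs_summable_equivalent abs_summable_on_def summable_on_iff_abs_summable_on_real)
  then show ?thesis
    using False by (simp add: infsum_not_exists not_integrable_integral_eq)
qed

lemma measurable_energy [measurable]: "energy p \<in> borel_measurable config_space"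
proof -
  let ?f = "\<lambda>\<phi> z. p (fst z - snd z) * ((1 / 2) * (\<phi> (fst z) - \<phi> (snd z))\<^sup>2)"
  have "(\<lambda>(z, \<phi>). ?f \<phi> z) \<in> borel_measurable (count_space UNIV \<Otimes>\<^sub>M config_space)"
    by (rule measurable_pair_measure_countable1) (auto simp: config_space_def)
  then have "(\<lambda>(\<phi>, z). ?f \<phi> z) \<in> borel_measurable (config_space \<Otimes>\<^sub>M count_space UNIV)"
    by (subst measurable_pair_swap_iff) (simp add: case_prod_unfold)
  then have "(\<lambda>\<phi>. \<integral>z. ?f \<phi> z \<partial>count_space UNIV) \<in> borel_measurable config_space"
    by (intro sigma_finite_measure.borel_measurable_lebesgue_integral sigma_finite_measure_count_space)
  then show ?thesis
    by (simp add: energy_def[abs_def] infsum_real_eq_integral_count_space case_prod_unfold)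
qed

section \<open>Gaussian laws with zero boundary condition\<close>

lemma measurable_config_spaceI:
  assumes "\<And>x. (\<lambda>\<omega>. f \<omega> x) \<in> borel_measurable N"
  shows "f \<in> measurable N config_space"
  unfolding config_space_def using assms by (intro measurable_PiM_single') auto

lemma measurable_config_component [measurable]: "(\<lambda>\<phi>. \<phi> x) \<in> borel_measurable config_space"
  unfolding config_space_def by simp

lemma space_config_space [simp]: "space config_space = UNIV"
  by (simp add: config_space_def space_PiM)

lemma measurable_config_add_scaled [measurable]:
  "(\<lambda>(z, \<phi>) y. \<phi> y + z * h y) \<in> measurable (borel \<Otimes>\<^sub>M config_space) config_space"
  by (rule measurable_config_spaceI) (simp add: case_prod_unfold)

lemma measurable_config_update [measurable]:
  "(\<lambda>(z, \<phi>). \<phi>(x := z)) \<in> measurable (borel \<Otimes>\<^sub>M config_space) config_space"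
  by (rule measurable_config_spaceI) (simp add: case_prod_unfold)

lemma measurable_config_update' [measurable]:
  "(\<lambda>\<phi>. \<phi>(x := z)) \<in> measurable config_space config_space"
  by (rule measurable_config_spaceI) simp

lemma measurable_config_add [measurable]:
  "(\<lambda>\<phi> y. \<phi> y + h y) \<in> measurable config_space config_space"
  by (rule measurable_config_spaceI) simp

text \<open>The single-site measure is a parameter so that \<open>lborel\<close> and
  \<open>site_measure \<epsilon>\<close> share one theory; the latter choice is
  \<open>reference_measure\<close>.\<close>

definition zero_extension :: "real measure \<Rightarrow> (int ^ 'd) set \<Rightarrow> (int ^ 'd \<Rightarrow> real) measure" where
  "zero_extension M A = distr (PiM A (\<lambda>_. M)) config_space (\<lambda>\<phi> x. if x \<in> A then \<phi> x else 0)"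

lemma sets_zero_extension [measurable_cong, simp]: "sets (zero_extension M A) = sets config_space"
  by (simp add: zero_extension_def)

lemma space_zero_extension [simp]: "space (zero_extension M A) = UNIV"
  by (simp add: zero_extension_def)

locale site_law = sigma_finite_measure M for M :: "real measure" +
  assumes sets_M [measurable_cong]: "sets M = sets borel"
begin

sublocale P: product_sigma_finite "\<lambda>_. M" ..

lemma measurable_extend: "(\<lambda>\<phi> x. if x \<in> A then \<phi> x else 0) \<in> measurable (PiM A (\<lambda>_. M)) config_space"
proof (rule measurable_config_spaceI)
  fix x
  have "x \<in> A \<Longrightarrow> (\<lambda>\<phi>. \<phi> x) \<in> borel_measurable (PiM A (\<lambda>_. M))"
    using measurable_component_singleton[of x A "\<lambda>_. M"] measurable_cong_sets[OF refl sets_M] by blast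
  then show "(\<lambda>\<phi>. if x \<in> A then \<phi> x else 0) \<in> borel_measurable (PiM A (\<lambda>_. M))"
    by (cases "x \<in> A") simp_all
qed

lemma nn_integral_zero_extension:
  assumes "F \<in> borel_measurable config_space"
  shows "(\<integral>\<^sup>+\<phi>. F \<phi> \<partial>zero_extension M A) = (\<integral>\<^sup>+\<phi>. F (\<lambda>x. if x \<in> A then \<phi> x else 0) \<partial>PiM A (\<lambda>_. M))"
  unfolding zero_extension_def by (intro nn_integral_distr measurable_extend) (simp add: assms)

lemma nn_integral_zero_extension_cong:
  assumes "F \<in> borel_measurable config_space" "G \<in> borel_measurable config_space"
    and "\<And>\<phi>. (\<And>x. x \<notin> A \<Longrightarrow> \<phi> x = 0) \<Longrightarrow> F \<phi> = G \<phi>"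
  shows "(\<integral>\<^sup>+\<phi>. F \<phi> \<partial>zero_extension M A) = (\<integral>\<^sup>+\<phi>. G \<phi> \<partial>zero_extension M A)"
  by (simp add: nn_integral_zero_extension assms)

lemma nn_integral_zero_extension_mono:
  assumes "F \<in> borel_measurable config_space" "G \<in> borel_measurable config_space"
    and "\<And>\<phi>. (\<And>x. x \<notin> A \<Longrightarrow> \<phi> x = 0) \<Longrightarrow> F \<phi> \<le> G \<phi>"
  shows "(\<integral>\<^sup>+\<phi>. F \<phi> \<partial>zero_extension M A) \<le> (\<integral>\<^sup>+\<phi>. G \<phi> \<partial>zero_extension M A)"
  by (simp add: nn_integral_zero_extension assms nn_integral_mono)

lemma nn_integral_zero_extension_empty:
  assumes "F \<in> borel_measurable config_space"
  shows "(\<integral>\<^sup>+\<phi>. F \<phi> \<partial>zero_extension M {}) = F (\<lambda>_. 0)"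
  unfolding nn_integral_zero_extension[OF assms] by (subst P.nn_integral_empty) simp_all

lemma nn_integral_zero_extension_insert:
  assumes "finite A" "x \<notin> A" and [measurable]: "F \<in> borel_measurable config_space"
  shows "(\<integral>\<^sup>+\<phi>. F \<phi> \<partial>zero_extension M (insert x A)) =
    (\<integral>\<^sup>+z. (\<integral>\<^sup>+\<phi>. F (\<phi>(x := z)) \<partial>zero_extension M A) \<partial>M)"
proof -
  have "(\<integral>\<^sup>+\<phi>. F \<phi> \<partial>zero_extension M (insert x A))
      = (\<integral>\<^sup>+z. (\<integral>\<^sup>+\<phi>. F (\<lambda>y. if y \<in> insert x A then (\<phi>(x := z)) y else 0) \<partial>PiM A (\<lambda>_. M)) \<partial>M)"
    unfolding nn_integral_zero_extension[OF assms(3)]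
    by (rule P.product_nn_integral_insert_rev[OF assms(1,2)])
      (rule measurable_compose[OF measurable_extend assms(3)])
  also have "\<dots> = (\<integral>\<^sup>+z. (\<integral>\<^sup>+\<phi>. F ((\<lambda>y. if y \<in> A then \<phi> y else 0)(x := z)) \<partial>PiM A (\<lambda>_. M)) \<partial>M)"
    by (intro nn_integral_cong arg_cong[where f = F]) auto
  also have "\<dots> = (\<integral>\<^sup>+z. (\<integral>\<^sup>+\<phi>. F (\<phi>(x := z)) \<partial>zero_extension M A) \<partial>M)"
    by (intro nn_integral_cong nn_integral_zero_extension[symmetric]) measurable
  finally show ?thesis .
qed

lemma measurable_nn_integral_zero_extension:
  assumes "finite A" "(\<lambda>(z, \<phi>). F z \<phi>) \<in> borel_measurable (N \<Otimes>\<^sub>M config_space)"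
  shows "(\<lambda>z. \<integral>\<^sup>+\<phi>. F z \<phi> \<partial>zero_extension M A) \<in> borel_measurable N"
proof -
  interpret S: sigma_finite_measure "PiM A (\<lambda>_. M)"
    by (rule P.sigma_finite[OF assms(1)])
  note measurable_extend[measurable]
  have "(\<lambda>z. \<integral>\<^sup>+\<phi>. F z (\<lambda>x. if x \<in> A then \<phi> x else 0) \<partial>PiM A (\<lambda>_. M)) \<in> borel_measurable N"
  proof (rule S.borel_measurable_nn_integral)
    have "(\<lambda>(z, \<phi>). (z, \<lambda>x. if x \<in> A then \<phi> x else 0)) \<in> measurable (N \<Otimes>\<^sub>M PiM A (\<lambda>_. M)) (N \<Otimes>\<^sub>M config_space)"
      by measurable
    from measurable_compose[OF this assms(2)]
    show "(\<lambda>(z, \<phi>). F z (\<lambda>x. if x \<in> A then \<phi> x else 0)) \<in> borel_measurable (N \<Otimes>\<^sub>M PiM A (\<lambda>_. M))"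
      by (simp add: case_prod_unfold)
  qed
  moreover have "(\<integral>\<^sup>+\<phi>. F z \<phi> \<partial>zero_extension M A) = (\<integral>\<^sup>+\<phi>. F z (\<lambda>x. if x \<in> A then \<phi> x else 0) \<partial>PiM A (\<lambda>_. M))"
    if "z \<in> space N" for z
    using measurable_Pair2[OF assms(2) that] by (intro nn_integral_zero_extension) simp
  ultimately show ?thesis
    by (subst measurable_cong)
qed

end

interpretation lborel_site: site_law "lborel :: real measure"
  by standard simp

text \<open>Translation invariance of Lebesgue measure, one coordinate at a time. In the induction
  \<open>h0\<close> is the part of the shift that lives on the remaining sites.\<close>

lemma nn_integral_zero_extension_translate:
  assumes "finite A" "\<And>x. x \<notin> A \<Longrightarrow> h x = 0" "F \<in> borel_measurable config_space"
  shows "(\<integral>\<^sup>+\<phi>. F (\<lambda>y. \<phi> y + h y) \<partial>zero_extension lborel A) = (\<integral>\<^sup>+\<phi>. F \<phi> \<partial>zero_extension lborel A)"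
  using assms
proof (induction A arbitrary: h F rule: finite_induct)
  case empty
  then have "h = (\<lambda>_. 0)" by auto
  then show ?case by simp
next
  case (insert x A)
  note insert.prems(2)[measurable]
  define h0 where "h0 = h(x := 0)"
  define G where "G z = (\<integral>\<^sup>+\<phi>. F (\<phi>(x := z)) \<partial>zero_extension lborel A)" for z
  have G: "G \<in> borel_measurable borel"
    unfolding G_def using insert.hyps(1) by (intro lborel_site.measurable_nn_integral_zero_extension) auto
  have "(\<integral>\<^sup>+\<phi>. F (\<lambda>y. \<phi> y + h y) \<partial>zero_extension lborel (insert x A))
      = (\<integral>\<^sup>+z. (\<integral>\<^sup>+\<phi>. F (\<lambda>y. (\<phi>(x := z)) y + h y) \<partial>zero_extension lborel A) \<partial>lborel)"
    using insert.hyps by (subst lborel_site.nn_integral_zero_extension_insert) auto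
  also have "\<dots> = (\<integral>\<^sup>+z. (\<integral>\<^sup>+\<phi>. F ((\<lambda>y. \<phi> y + h0 y)(x := z + h x)) \<partial>zero_extension lborel A) \<partial>lborel)"
    by (intro nn_integral_cong arg_cong[where f = F]) (auto simp: h0_def fun_eq_iff)
  also have "\<dots> = (\<integral>\<^sup>+z. G (h x + 1 * z) \<partial>lborel)"
  proof (intro nn_integral_cong)
    fix z
    have "h0 y = 0" if "y \<notin> A" for y
      using that insert.prems(1) by (auto simp: h0_def)
    then show "(\<integral>\<^sup>+\<phi>. F ((\<lambda>y. \<phi> y + h0 y)(x := z + h x)) \<partial>zero_extension lborel A) = G (h x + 1 * z)"
      using insert.IH[of h0 "\<lambda>\<phi>. F (\<phi>(x := z + h x))"] by (simp add: G_def add.commute)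
  qed
  also have "\<dots> = (\<integral>\<^sup>+z. G z \<partial>lborel)"
    using nn_integral_real_affine[OF G, of 1 "h x"] by simp
  also have "\<dots> = (\<integral>\<^sup>+\<phi>. F \<phi> \<partial>zero_extension lborel (insert x A))"
    using insert.hyps by (subst lborel_site.nn_integral_zero_extension_insert) (auto simp: G_def[abs_def])
  finally show ?case .
qed

lemma ennreal_inverse_cancel: "0 < a \<Longrightarrow> ennreal (1 / a) * (ennreal a * X) = X"
  by (simp flip: mult.assoc ennreal_mult)

lemma exp_square_eq_normal_density:
  assumes "0 < q"
  shows "exp (- (q / 2) * z\<^sup>2) = sqrt (2 * pi / q) * normal_density 0 (1 / sqrt q) z"
  using assms by (simp add: normal_density_def real_sqrt_divide real_sqrt_mult field_simps)

lemma nn_integral_normal_density: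
  assumes "0 < q"
  shows "(\<integral>\<^sup>+z. ennreal (normal_density 0 (1 / sqrt q) z) \<partial>lborel) = 1"
proof -
  have "0 < 1 / sqrt q" using assms by simp
  then show ?thesis
    by (subst nn_integral_eq_integral) (simp_all add: integrable_normal_density integral_normal_density)
qed

locale gaussian_field = lattice_walk p e for p :: "int ^ 'd \<Rightarrow> real" and e +
  fixes \<beta> :: real
  assumes beta_pos: "0 < \<beta>"
begin

definition weight :: "(int ^ 'd \<Rightarrow> real) \<Rightarrow> ennreal" where
  "weight \<phi> = ennreal (exp (- (\<beta> / 2) * energy p \<phi>))"

lemma measurable_weight [measurable]: "weight \<in> borel_measurable config_space"
  unfolding weight_def[abs_def] by measurable

text \<open>The Gaussian partition function with zero boundary condition outside \<open>A\<close>.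
  An infinite integral would be turned into 0 by \<open>enn2real\<close>;
  \<open>nn_integral_weight_Z\<close> excludes this.\<close>

definition Z :: "(int ^ 'd) set \<Rightarrow> real" where
  "Z A = enn2real (\<integral>\<^sup>+\<phi>. weight \<phi> \<partial>zero_extension lborel A)"

text \<open>Change of variables: with \<open>z\<close> the value at \<open>x\<close>, the field is
  written as a field on \<open>A\<close> plus \<open>z * h\<close>. For fixed \<open>z\<close> this
  is a translation, and the energy splits, so \<open>z\<close> decouples as a Gaussian with inverse
  variance \<open>q\<close>.\<close>

lemma nn_integral_weight_insert:
  assumes "finite A" "x \<notin> A" "harmonic_at A x h" and [measurable]: "F \<in> borel_measurable config_space"
  defines "q \<equiv> \<beta> * energy p h"
  shows "(\<integral>\<^sup>+\<phi>. weight \<phi> * F \<phi> \<partial>zero_extension lborel (insert x A)) =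
    ennreal (sqrt (2 * pi / q)) * (\<integral>\<^sup>+z. ennreal (normal_density 0 (1 / sqrt q) z) *
      (\<integral>\<^sup>+\<phi>. weight \<phi> * F (\<lambda>y. \<phi> y + z * h y) \<partial>zero_extension lborel A) \<partial>lborel)"
proof -
  have q: "0 < q"
    using harmonic_energy_pos[OF assms(1,3)] beta_pos by (simp add: q_def)
  note [measurable] = lborel_site.measurable_nn_integral_zero_extension[OF assms(1)]
  have *: "(\<integral>\<^sup>+\<phi>. weight (\<phi>(x := z)) * F (\<phi>(x := z)) \<partial>zero_extension lborel A)
      = ennreal (sqrt (2 * pi / q)) * (ennreal (normal_density 0 (1 / sqrt q) z) *
        (\<integral>\<^sup>+\<phi>. weight \<phi> * F (\<lambda>y. \<phi> y + z * h y) \<partial>zero_extension lborel A))" for z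
  proof -
    \<comment> \<open>The translation acts on \<open>A\<close> only. At \<open>x\<close> the update
      by \<open>z\<close> already has the right value, because \<open>h x = 1\<close>.\<close>
    define k where "k y = (if y = x then 0 else z * h y)" for y
    have k: "k y = 0" if "y \<notin> A" for y
      using that harmonic_atD(2)[OF assms(3)] by (auto simp: k_def)
    have "(\<integral>\<^sup>+\<phi>. weight (\<phi>(x := z)) * F (\<phi>(x := z)) \<partial>zero_extension lborel A)
        = (\<integral>\<^sup>+\<phi>. weight ((\<lambda>y. \<phi> y + k y)(x := z)) * F ((\<lambda>y. \<phi> y + k y)(x := z)) \<partial>zero_extension lborel A)"
      using assms(1) k by (intro nn_integral_zero_extension_translate[symmetric]) auto
    also have "\<dots> = (\<integral>\<^sup>+\<phi>. ennreal (exp (- (q / 2) * z\<^sup>2)) * (weight \<phi> * F (\<lambda>y. \<phi> y + z * h y)) \<partial>zero_extension lborel A)"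
    proof (rule lborel_site.nn_integral_zero_extension_cong)
      fix \<phi> :: "int ^ 'd \<Rightarrow> real" assume \<phi>: "\<And>y. y \<notin> A \<Longrightarrow> \<phi> y = 0"
      have "(\<lambda>y. \<phi> y + k y)(x := z) = (\<lambda>y. \<phi> y + z * h y)"
        using \<phi>[OF assms(2)] harmonic_atD(1)[OF assms(3)] by (auto simp: k_def fun_eq_iff)
      moreover have "weight (\<lambda>y. \<phi> y + z * h y) = ennreal (exp (- (q / 2) * z\<^sup>2)) * weight \<phi>"
        using harmonic_atD(3)[OF assms(3) \<phi>]
        by (simp add: weight_def q_def distrib_left mult_exp_exp mult.assoc add.commute flip: ennreal_mult)
      ultimately show "weight ((\<lambda>y. \<phi> y + k y)(x := z)) * F ((\<lambda>y. \<phi> y + k y)(x := z))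
          = ennreal (exp (- (q / 2) * z\<^sup>2)) * (weight \<phi> * F (\<lambda>y. \<phi> y + z * h y))"
        by (simp add: mult.assoc)
    qed measurable
    also have "\<dots> = ennreal (exp (- (q / 2) * z\<^sup>2)) * (\<integral>\<^sup>+\<phi>. weight \<phi> * F (\<lambda>y. \<phi> y + z * h y) \<partial>zero_extension lborel A)"
      by (rule nn_integral_cmult) measurable
    finally show ?thesis
      unfolding exp_square_eq_normal_density[OF q] using q
      by (simp add: ennreal_mult mult.assoc)
  qed
  show ?thesis
    using assms(1,2) by (subst lborel_site.nn_integral_zero_extension_insert)
      (auto simp: * intro!: nn_integral_cmult)
qed

lemma nn_integral_weight_Z:
  assumes "finite A"
  shows "(\<integral>\<^sup>+\<phi>. weight \<phi> \<partial>zero_extension lborel A) = ennreal (Z A) \<and> 0 < Z A"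
  using assms
proof (induction A rule: finite_induct)
  case empty
  have "energy p (\<lambda>_. 0) = 0"
    by (simp add: energy_def case_prod_unfold)
  then show ?case
    by (simp add: Z_def lborel_site.nn_integral_zero_extension_empty weight_def)
next
  case (insert x A)
  obtain h where h: "harmonic_at A x h"
    using ex_harmonic insert.hyps by blast
  define q where "q = \<beta> * energy p h"
  have q: "0 < q"
    using harmonic_energy_pos[OF insert.hyps(1) h] beta_pos by (simp add: q_def)
  have "(\<integral>\<^sup>+\<phi>. weight \<phi> \<partial>zero_extension lborel (insert x A)) = ennreal (sqrt (2 * pi / q)) * ennreal (Z A)"
    using nn_integral_weight_insert[OF insert.hyps h, of "\<lambda>_. 1"] insert.IH
    by (simp add: nn_integral_multc nn_integral_normal_density[OF q] flip: q_def)
  also have "\<dots> = ennreal (sqrt (2 * pi / q) * Z A)"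
    using insert.IH q by (simp add: ennreal_mult)
  finally show ?case
    using insert.IH q by (simp add: Z_def[of "insert x A"])
qed

lemma Z_pos: "finite A \<Longrightarrow> 0 < Z A"
  using nn_integral_weight_Z by blast

lemma Z_insert:
  assumes "finite A" "x \<notin> A" "harmonic_at A x h"
  shows "Z (insert x A) = sqrt (2 * pi / (\<beta> * energy p h)) * Z A"
proof -
  have q: "0 < \<beta> * energy p h"
    using harmonic_energy_pos[OF assms(1,3)] beta_pos by simp
  have "ennreal (Z (insert x A)) = ennreal (sqrt (2 * pi / (\<beta> * energy p h))) * ennreal (Z A)"
    using nn_integral_weight_insert[OF assms, of "\<lambda>_. 1"] assms(1) nn_integral_weight_Z
    by (simp add: nn_integral_multc nn_integral_normal_density[OF q])
  then show ?thesis
    using Z_pos assms(1) q by (simp add: less_imp_le flip: ennreal_mult)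
qed

text \<open>The law \<open>\<gamma>\<^sub>A\<close> of the overview.\<close>

definition pinned_gaussian :: "(int ^ 'd) set \<Rightarrow> (int ^ 'd \<Rightarrow> real) measure" where
  "pinned_gaussian A = density (zero_extension lborel A) (\<lambda>\<phi>. ennreal (1 / Z A) * weight \<phi>)"

lemma sets_pinned_gaussian [measurable_cong, simp]: "sets (pinned_gaussian A) = sets config_space"
  and space_pinned_gaussian [simp]: "space (pinned_gaussian A) = UNIV"
  by (simp_all add: pinned_gaussian_def)

lemma nn_integral_pinned_gaussian:
  assumes [measurable]: "F \<in> borel_measurable config_space"
  shows "(\<integral>\<^sup>+\<phi>. F \<phi> \<partial>pinned_gaussian A)
    = ennreal (1 / Z A) * (\<integral>\<^sup>+\<phi>. weight \<phi> * F \<phi> \<partial>zero_extension lborel A)"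
  unfolding pinned_gaussian_def
  by (subst nn_integral_density) (auto simp: mult.assoc intro!: nn_integral_cmult)

lemma nn_integral_weight_eq:
  assumes "finite A" "F \<in> borel_measurable config_space"
  shows "(\<integral>\<^sup>+\<phi>. weight \<phi> * F \<phi> \<partial>zero_extension lborel A) = ennreal (Z A) * (\<integral>\<^sup>+\<phi>. F \<phi> \<partial>pinned_gaussian A)"
  using Z_pos[OF assms(1)] assms(2)
  by (simp add: nn_integral_pinned_gaussian flip: mult.assoc ennreal_mult)

lemma prob_space_pinned_gaussian: "finite A \<Longrightarrow> prob_space (pinned_gaussian A)"
  using nn_integral_pinned_gaussian[of "\<lambda>_. 1" A] nn_integral_weight_Z[of A]
  by (intro prob_spaceI) (simp flip: ennreal_mult)

lemma measurable_nn_integral_pinned_gaussian: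
  assumes "finite A" and [measurable]: "(\<lambda>(z, \<phi>). F z \<phi>) \<in> borel_measurable (N \<Otimes>\<^sub>M config_space)"
  shows "(\<lambda>z. \<integral>\<^sup>+\<phi>. F z \<phi> \<partial>pinned_gaussian A) \<in> borel_measurable N"
proof -
  have "sigma_finite_measure (pinned_gaussian A)"
    using prob_space_pinned_gaussian[OF assms(1)] by (rule prob_space_imp_sigma_finite)
  then show ?thesis
    by (rule sigma_finite_measure.borel_measurable_nn_integral) measurable
qed

text \<open>The factor \<open>sqrt (2 * pi / q)\<close> of the change of variables is precisely the
  ratio of the partition functions, so after normalisation \<open>z\<close> is a genuine random
  variable, independent of the field on \<open>A\<close>.\<close>

lemma nn_integral_pinned_gaussian_insert:
  assumes "finite A" "x \<notin> A" "harmonic_at A x h" and [measurable]: "F \<in> borel_measurable config_space"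
  shows "(\<integral>\<^sup>+\<phi>. F \<phi> \<partial>pinned_gaussian (insert x A)) =
    (\<integral>\<^sup>+z. ennreal (normal_density 0 (1 / sqrt (\<beta> * energy p h)) z) *
      (\<integral>\<^sup>+\<phi>. F (\<lambda>y. \<phi> y + z * h y) \<partial>pinned_gaussian A) \<partial>lborel)"
proof -
  let ?s = "sqrt (2 * pi / (\<beta> * energy p h))"
  let ?n = "normal_density 0 (1 / sqrt (\<beta> * energy p h))"
  have s: "0 < ?s"
    using harmonic_energy_pos[OF assms(1,3)] beta_pos by simp
  note [measurable] = measurable_nn_integral_pinned_gaussian[OF assms(1)]
  have "(\<integral>\<^sup>+\<phi>. weight \<phi> * F \<phi> \<partial>zero_extension lborel (insert x A)) = ennreal ?s * (\<integral>\<^sup>+z. ennreal (Z A) *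
     (ennreal (?n z) * (\<integral>\<^sup>+\<phi>. F (\<lambda>y. \<phi> y + z * h y) \<partial>pinned_gaussian A)) \<partial>lborel)"
    unfolding nn_integral_weight_insert[OF assms]
    by (subst nn_integral_weight_eq) (auto simp: assms(1) mult.left_commute)
  also have "\<dots> = ennreal (?s * Z A) * (\<integral>\<^sup>+z. 
     ennreal (?n z) * (\<integral>\<^sup>+\<phi>. F (\<lambda>y. \<phi> y + z * h y) \<partial>pinned_gaussian A) \<partial>lborel)"
    using s Z_pos[OF assms(1)] by (subst nn_integral_cmult) (auto simp: ennreal_mult mult.assoc)
  finally show ?thesis
    unfolding nn_integral_pinned_gaussian[OF assms(4), of "insert x A"] Z_insert[OF assms(1-3)]
    using s Z_pos[OF assms(1)] by (simp only: ennreal_inverse_cancel mult_pos_pos)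
qed

end

section \<open>Green function and stability under insertion of a site\<close>

definition depends_on :: "'i set \<Rightarrow> (('i \<Rightarrow> 'a) \<Rightarrow> 'b) \<Rightarrow> bool" where
  "depends_on S F \<longleftrightarrow> (\<forall>\<phi> \<psi>. (\<forall>x\<in>S. \<phi> x = \<psi> x) \<longrightarrow> F \<phi> = F \<psi>)"

lemma depends_onD: "depends_on S F \<Longrightarrow> (\<And>x. x \<in> S \<Longrightarrow> \<phi> x = \<psi> x) \<Longrightarrow> F \<phi> = F \<psi>"
  unfolding depends_on_def by blast

lemma normal_density_second_moment:
  assumes "0 < q"
  shows "(\<integral>\<^sup>+z. ennreal (normal_density 0 (1 / sqrt q) z) * ennreal (z\<^sup>2) \<partial>lborel) = ennreal (1 / q)"
proof -
  have s: "0 < 1 / sqrt q" using assms by simp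
  have "(\<integral>\<^sup>+z. ennreal (normal_density 0 (1 / sqrt q) z * z\<^sup>2) \<partial>lborel)
      = ennreal (\<integral>z. normal_density 0 (1 / sqrt q) z * z\<^sup>2 \<partial>lborel)"
    using integrable_normal_moment[OF s, of 0 2] by (intro nn_integral_eq_integral) auto
  also have "(\<integral>z. normal_density 0 (1 / sqrt q) z * z\<^sup>2 \<partial>lborel) = 1 / q"
    using integral_normal_moment_even[OF s, of 0 1] assms by (simp add: power_divide fact_2)
  finally show ?thesis
    by (simp add: ennreal_mult)
qed

lemma exp_midpoint_convex: "exp (- ((a + b) / 2)) \<le> (exp (- a) + exp (- b)) / (2 :: real)"
proof -
  have "0 \<le> (exp (- a / 2) - exp (- b / 2))\<^sup>2"
    by simp
  also have "\<dots> = exp (- a) + exp (- b) - 2 * exp (- ((a + b) / 2))"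
    by (simp add: power2_diff mult_exp_exp add_divide_distrib diff_divide_distrib flip: exp_double)
  finally show ?thesis
    by simp
qed

text \<open>A multiplicative loss becomes an additive one, by \<open>exp (- t) \<ge> 1 - t\<close>
  and \<open>a \<le> 1\<close>.\<close>

lemma ennreal_le_add_of_exp_mult_le:
  assumes "a \<le> 1" "ennreal (exp (- t)) * a \<le> m" "0 \<le> t"
  shows "a \<le> m + ennreal t"
proof (cases m)
  case (real m')
  obtain a' where a': "a = ennreal a'" "0 \<le> a'" "a' \<le> 1"
    using assms(1) by (cases a) (auto simp: top_unique)
  have "exp (- t) * a' \<le> m'"
    using assms(2) real a' by (simp flip: ennreal_mult)
  moreover have "(1 - t) * a' \<le> exp (- t) * a'"
    using exp_ge_add_one_self[of "- t"] a' by (intro mult_right_mono) auto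
  moreover have "t * a' \<le> t"
    using a' assms(3) by (simp add: mult_left_le)
  ultimately have "a' \<le> m' + t"
    by (simp add: algebra_simps)
  then show ?thesis
    using a' real assms(3) by (simp flip: ennreal_plus)
qed simp

lemma ennreal_half_add:
  assumes "0 \<le> a" "0 \<le> b"
  shows "ennreal (1 / 2) * (ennreal a + ennreal b) = ennreal ((a + b) / 2)"
proof -
  have "ennreal (1 / 2 * (a + b)) = ennreal (1 / 2) * ennreal (a + b)"
    using assms by (intro ennreal_mult) auto
  also have "ennreal (a + b) = ennreal a + ennreal b"
    using assms by (rule ennreal_plus)
  finally show ?thesis
    by simp
qed

context gaussian_field
begin

lemma measurable_nn_integral_shifted:
  assumes "finite A" "F \<in> borel_measurable config_space" "c \<in> borel_measurable N"
  shows "(\<lambda>z. \<integral>\<^sup>+\<phi>. F (\<lambda>y. \<phi> y + c z * h y) \<partial>pinned_gaussian A) \<in> borel_measurable N"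
proof -
  note assms(2)[measurable]
  have "(\<lambda>z. \<integral>\<^sup>+\<phi>. F (\<lambda>y. \<phi> y + z * h y) \<partial>pinned_gaussian A) \<in> borel_measurable borel"
    using assms(1) by (rule measurable_nn_integral_pinned_gaussian) measurable
  from measurable_compose[OF assms(3) this] show ?thesis .
qed

text \<open>The normal density is even in \<open>z\<close>. Averaging over both signs cancels terms
  linear in \<open>z\<close>, so later errors are of order \<open>z\<^sup>2\<close> and integrate to
  a multiple of the variance.\<close>

lemma nn_integral_pinned_gaussian_symmetric:
  assumes "finite A" "x \<notin> A" "harmonic_at A x h" and [measurable]: "F \<in> borel_measurable config_space"
  shows "(\<integral>\<^sup>+\<phi>. F \<phi> \<partial>pinned_gaussian (insert x A)) =
    (\<integral>\<^sup>+z. ennreal (normal_density 0 (1 / sqrt (\<beta> * energy p h)) z) *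
      (ennreal (1 / 2) * ((\<integral>\<^sup>+\<phi>. F (\<lambda>y. \<phi> y + z * h y) \<partial>pinned_gaussian A)
        + (\<integral>\<^sup>+\<phi>. F (\<lambda>y. \<phi> y + (- z) * h y) \<partial>pinned_gaussian A))) \<partial>lborel)"
proof -
  define n where "n z = ennreal (normal_density 0 (1 / sqrt (\<beta> * energy p h)) z)" for z
  define g where "g z = (\<integral>\<^sup>+\<phi>. F (\<lambda>y. \<phi> y + z * h y) \<partial>pinned_gaussian A)" for z
  define I where "I = (\<integral>\<^sup>+\<phi>. F \<phi> \<partial>pinned_gaussian (insert x A))"
  have [measurable]: "n \<in> borel_measurable borel" "g \<in> borel_measurable borel"
    unfolding n_def[abs_def] g_def[abs_def] using assms(1)
    by (auto intro: measurable_nn_integral_shifted)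
  have 1: "I = (\<integral>\<^sup>+z. n z * g z \<partial>lborel)"
    unfolding I_def n_def g_def by (rule nn_integral_pinned_gaussian_insert[OF assms])
  also have "\<dots> = (\<integral>\<^sup>+z. n (0 + - 1 * z) * g (0 + - 1 * z) \<partial>lborel)"
    by (subst nn_integral_real_affine[of _ "- 1" 0]) auto
  finally have 2: "I = (\<integral>\<^sup>+z. n z * g (- z) \<partial>lborel)"
    by (simp add: normal_density_def n_def)
  have "I = ennreal (1 / 2) * (I + I)"
    using ennreal_inverse_cancel[of 2 I] by (simp add: mult_2)
  also have "\<dots> = ennreal (1 / 2) * ((\<integral>\<^sup>+z. n z * g z \<partial>lborel) + (\<integral>\<^sup>+z. n z * g (- z) \<partial>lborel))"
    by (simp flip: 1 2)
  also have "\<dots> = ennreal (1 / 2) * (\<integral>\<^sup>+z. n z * g z + n z * g (- z) \<partial>lborel)"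
    by (subst nn_integral_add) auto
  also have "\<dots> = (\<integral>\<^sup>+z. ennreal (1 / 2) * (n z * g z + n z * g (- z)) \<partial>lborel)"
    by (subst nn_integral_cmult) auto
  also have "\<dots> = (\<integral>\<^sup>+z. n z * (ennreal (1 / 2) * (g z + g (- z))) \<partial>lborel)"
    by (simp only: distrib_left mult.left_commute)
  finally show ?thesis
    unfolding I_def n_def g_def .
qed

text \<open>The variance of the field at \<open>y\<close>: the inverse covariance is
  \<open>\<beta> (1 - P)\<close> restricted to \<open>A\<close>, so this is
  \<open>1 / \<beta>\<close> times the Green function of the walk killed on leaving
  \<open>A\<close>. Finiteness is shown in \<open>nn_integral_green\<close>.\<close>

definition green :: "(int ^ 'd) set \<Rightarrow> int ^ 'd \<Rightarrow> real" where
  "green A y = enn2real (\<integral>\<^sup>+\<phi>. ennreal ((\<phi> y)\<^sup>2) \<partial>pinned_gaussian A)"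

lemma green_nonneg: "0 \<le> green A y"
  by (simp add: green_def)

text \<open>The variance of the independent summand \<open>z * h y\<close> is added. The identity is
  stated in \<open>ennreal\<close>, since finiteness of the variances is itself deduced from it by
  induction.\<close>

lemma nn_green_insert:
  assumes "finite A" "x \<notin> A" "harmonic_at A x h"
  shows "(\<integral>\<^sup>+\<phi>. ennreal ((\<phi> y)\<^sup>2) \<partial>pinned_gaussian (insert x A))
    = (\<integral>\<^sup>+\<phi>. ennreal ((\<phi> y)\<^sup>2) \<partial>pinned_gaussian A) + ennreal ((h y)\<^sup>2 / (\<beta> * energy p h))"
proof -
  let ?q = "\<beta> * energy p h"
  let ?n = "\<lambda>z. ennreal (normal_density 0 (1 / sqrt ?q) z)"
  let ?G = "\<integral>\<^sup>+\<phi>. ennreal ((\<phi> y)\<^sup>2) \<partial>pinned_gaussian A"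
  have q: "0 < ?q"
    using harmonic_energy_pos[OF assms(1,3)] beta_pos by simp
  interpret prob_space "pinned_gaussian A"
    by (rule prob_space_pinned_gaussian[OF assms(1)])
  have "ennreal (1 / 2) * ((\<integral>\<^sup>+\<phi>. ennreal ((\<phi> y + z * h y)\<^sup>2) \<partial>pinned_gaussian A)
      + (\<integral>\<^sup>+\<phi>. ennreal ((\<phi> y + (- z) * h y)\<^sup>2) \<partial>pinned_gaussian A))
      = ?G + ennreal ((h y)\<^sup>2) * ennreal (z\<^sup>2)" for z
  proof -
    have "ennreal (1 / 2) * ((\<integral>\<^sup>+\<phi>. ennreal ((\<phi> y + z * h y)\<^sup>2) \<partial>pinned_gaussian A)
        + (\<integral>\<^sup>+\<phi>. ennreal ((\<phi> y + (- z) * h y)\<^sup>2) \<partial>pinned_gaussian A))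
        = (\<integral>\<^sup>+\<phi>. ennreal (1 / 2) * (ennreal ((\<phi> y + z * h y)\<^sup>2) + ennreal ((\<phi> y + (- z) * h y)\<^sup>2)) \<partial>pinned_gaussian A)"
      by (subst nn_integral_cmult) (auto simp: nn_integral_add)
    also have "\<dots> = (\<integral>\<^sup>+\<phi>. ennreal ((\<phi> y)\<^sup>2) + ennreal ((h y)\<^sup>2 * z\<^sup>2) \<partial>pinned_gaussian A)"
    proof (intro nn_integral_cong)
      fix \<phi> :: "int ^ 'd \<Rightarrow> real"
      have "((\<phi> y + z * h y)\<^sup>2 + (\<phi> y + (- z) * h y)\<^sup>2) / 2 = (\<phi> y)\<^sup>2 + (h y)\<^sup>2 * z\<^sup>2"
        by (simp add: power2_eq_square algebra_simps)
      then show "ennreal (1 / 2) * (ennreal ((\<phi> y + z * h y)\<^sup>2) + ennreal ((\<phi> y + (- z) * h y)\<^sup>2))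
          = ennreal ((\<phi> y)\<^sup>2) + ennreal ((h y)\<^sup>2 * z\<^sup>2)"
        by (subst ennreal_half_add) (simp_all only: ennreal_plus zero_le_power2 mult_nonneg_nonneg)
    qed
    also have "\<dots> = ?G + ennreal ((h y)\<^sup>2) * ennreal (z\<^sup>2)"
      using emeasure_space_1 by (subst nn_integral_add) (auto simp: ennreal_mult)
    finally show ?thesis .
  qed
  then have "(\<integral>\<^sup>+\<phi>. ennreal ((\<phi> y)\<^sup>2) \<partial>pinned_gaussian (insert x A))
      = (\<integral>\<^sup>+z. ?n z * ?G + ennreal ((h y)\<^sup>2) * (?n z * ennreal (z\<^sup>2)) \<partial>lborel)"
    by (subst nn_integral_pinned_gaussian_symmetric[OF assms]) (auto simp: distrib_left mult.left_commute)
  also have "\<dots> = ?G + ennreal ((h y)\<^sup>2) * ennreal (1 / ?q)"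
    by (subst nn_integral_add)
      (auto simp: nn_integral_multc nn_integral_cmult nn_integral_normal_density[OF q] normal_density_second_moment[OF q])
  finally show ?thesis
    using q by (simp flip: ennreal_mult)
qed

lemma nn_integral_green:
  "finite A \<Longrightarrow> (\<integral>\<^sup>+\<phi>. ennreal ((\<phi> y)\<^sup>2) \<partial>pinned_gaussian A) = ennreal (green A y)"
proof (induction A rule: finite_induct)
  case empty
  have "(\<integral>\<^sup>+\<phi>. ennreal ((\<phi> y)\<^sup>2) \<partial>pinned_gaussian {}) = 0"
    by (subst nn_integral_pinned_gaussian) (simp_all add: lborel_site.nn_integral_zero_extension_empty)
  then show ?case
    by (simp add: green_def)
next
  case (insert x A)
  obtain h where h: "harmonic_at A x h"
    using ex_harmonic insert.hyps by blast
  have "0 \<le> (h y)\<^sup>2 / (\<beta> * energy p h)"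
    using energy_nonneg[of h] beta_pos by simp
  then have "(\<integral>\<^sup>+\<phi>. ennreal ((\<phi> y)\<^sup>2) \<partial>pinned_gaussian (insert x A)) = ennreal (green A y + (h y)\<^sup>2 / (\<beta> * energy p h))"
    unfolding nn_green_insert[OF insert.hyps h] insert.IH using green_nonneg[of A y] by (simp add: ennreal_plus)
  then show ?case
    using green_nonneg[of "insert x A" y] by (simp add: green_def[of "insert x A"])
qed

lemma green_insert:
  assumes "finite A" "x \<notin> A" "harmonic_at A x h"
  shows "green (insert x A) y = green A y + (h y)\<^sup>2 / (\<beta> * energy p h)"
proof -
  have "0 \<le> (h y)\<^sup>2 / (\<beta> * energy p h)"
    using energy_nonneg[of h] beta_pos by simp
  then show ?thesis
    using nn_green_insert[OF assms, of y] assms(1) green_nonneg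
    by (simp add: nn_integral_green flip: ennreal_plus)
qed

lemma green_eq_0:
  assumes "y \<notin> A"
  shows "green A y = 0"
proof -
  have "(\<integral>\<^sup>+\<phi>. weight \<phi> * ennreal ((\<phi> y)\<^sup>2) \<partial>zero_extension lborel A) = (\<integral>\<^sup>+\<phi>. 0 \<partial>zero_extension lborel A)"
    using assms by (intro lborel_site.nn_integral_zero_extension_cong) auto
  then show ?thesis
    by (simp add: green_def nn_integral_pinned_gaussian)
qed

text \<open>With \<open>y\<close> removed from \<open>A\<close> the variance at \<open>y\<close> is
  0, so reinserting \<open>y\<close> gives exactly \<open>1 / (\<beta> * energy p h)\<close> with
  \<open>h y = 1\<close>. The energy is bounded below along the half line to the pinned
  site.\<close>

lemma green_bound:
  assumes "finite A" "y + multiple k e \<notin> A"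
  shows "green A y \<le> 2 / (\<beta> * p e) * real k"
proof (cases "y \<in> A")
  case False
  then show ?thesis
    using beta_pos step_pos by (simp add: green_eq_0)
next
  case True
  define B where "B = A - {y}"
  have B: "A = insert y B" "finite B" "y \<notin> B"
    using True assms(1) by (auto simp: B_def)
  obtain h where h: "harmonic_at B y h"
    using ex_harmonic B by blast
  have k: "0 < k"
    using True assms(2) by (intro Nat.gr0I) auto
  have "p e / (2 * real k) \<le> energy p h"
    using harmonic_energy_lower_bound[OF B(2) h, of k] assms(2) B(1) by simp
  then have "\<beta> * (p e / (2 * real k)) \<le> \<beta> * energy p h"
    using beta_pos by (intro mult_left_mono) auto
  then have "1 / (\<beta> * energy p h) \<le> 1 / (\<beta> * (p e / (2 * real k)))"
    using beta_pos step_pos k harmonic_energy_pos[OF B(2) h] by (intro divide_left_mono) auto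
  then show ?thesis
    using green_insert[OF B(2,3) h, of y] harmonic_atD(1)[OF h] green_eq_0[OF B(3)] B(1)
    by (simp add: field_simps)
qed

text \<open>The shift by \<open>h\<close> restricted to \<open>S\<close> is absorbed by the Lebesgue measure; averaging over \<open>\<plusminus>z\<close> and
  convexity of the exponential then leave only an error quadratic in \<open>z\<close>.\<close>

lemma shift_stability:
  assumes "finite A" "finite S" "\<And>y. y \<in> S \<Longrightarrow> y \<notin> A \<Longrightarrow> h y = 0"
    and [measurable]: "F \<in> borel_measurable config_space"
    and "depends_on S F" "\<And>\<phi>. F \<phi> \<le> 1"
  shows "(\<integral>\<^sup>+\<phi>. F \<phi> \<partial>pinned_gaussian A) \<le>
    ennreal (1 / 2) * ((\<integral>\<^sup>+\<phi>. F (\<lambda>y. \<phi> y + z * h y) \<partial>pinned_gaussian A)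
        + (\<integral>\<^sup>+\<phi>. F (\<lambda>y. \<phi> y + (- z) * h y) \<partial>pinned_gaussian A)) + ennreal (z\<^sup>2 * (\<beta> * (\<Sum>y\<in>S. (h y)\<^sup>2)))"
proof -
  \<comment> \<open>\<open>F\<close> sees only \<open>S\<close>, so \<open>h\<close> may be cut off
    there. The cutoff vanishes outside \<open>A\<close> and is thus an admissible translation; in
    the application \<open>h\<close> itself is 1 at the inserted site, which lies outside
    \<open>A\<close>.\<close>
  define k where "k y = (if y \<in> S then h y else 0)" for y
  have k: "k y = 0" if "y \<notin> A" for y
    using that assms(3) by (auto simp: k_def)
  define t where "t = \<beta> / 2 * (z\<^sup>2 * energy p k)"
  have shift: "(\<integral>\<^sup>+\<phi>. F (\<lambda>y. \<phi> y + c * h y) \<partial>pinned_gaussian A)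
      = ennreal (1 / Z A) * (\<integral>\<^sup>+\<phi>. weight (\<lambda>y. \<phi> y + (- c) * k y) * F \<phi> \<partial>zero_extension lborel A)" for c
  proof -
    have "F (\<lambda>y. \<phi> y + c * h y) = F (\<lambda>y. \<phi> y + c * k y)" for \<phi>
      by (rule depends_onD[OF assms(5)]) (simp add: k_def)
    then have "(\<integral>\<^sup>+\<phi>. F (\<lambda>y. \<phi> y + c * h y) \<partial>pinned_gaussian A)
        = ennreal (1 / Z A) * (\<integral>\<^sup>+\<phi>. weight \<phi> * F (\<lambda>y. \<phi> y + c * k y) \<partial>zero_extension lborel A)"
      by (simp add: nn_integral_pinned_gaussian)
    also have "(\<integral>\<^sup>+\<phi>. weight \<phi> * F (\<lambda>y. \<phi> y + c * k y) \<partial>zero_extension lborel A)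
        = (\<integral>\<^sup>+\<phi>. weight (\<lambda>y. \<phi> y + (- c) * k y) * F \<phi> \<partial>zero_extension lborel A)"
    proof -
      have "(\<integral>\<^sup>+\<phi>. weight (\<lambda>y. (\<phi> y + c * k y) + (- c) * k y) * F (\<lambda>y. \<phi> y + c * k y) \<partial>zero_extension lborel A)
          = (\<integral>\<^sup>+\<phi>. weight (\<lambda>y. \<phi> y + (- c) * k y) * F \<phi> \<partial>zero_extension lborel A)"
        by (rule nn_integral_zero_extension_translate[OF assms(1)]) (simp add: k, measurable)
      then show ?thesis
        by simp
    qed
    finally show ?thesis .
  qed
  have conv: "ennreal (exp (- t)) * weight \<phi> \<le>
      ennreal (1 / 2) * (weight (\<lambda>y. \<phi> y + (- z) * k y) + weight (\<lambda>y. \<phi> y + (- (- z)) * k y))"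
    if \<phi>: "\<And>y. y \<notin> A \<Longrightarrow> \<phi> y = 0" for \<phi>
  proof -
    let ?a = "\<beta> / 2 * energy p (\<lambda>y. \<phi> y + z * k y)" and ?b = "\<beta> / 2 * energy p (\<lambda>y. \<phi> y + (- z) * k y)"
    have "energy p (\<lambda>y. \<phi> y + z * k y) + energy p (\<lambda>y. \<phi> y + (- z) * k y)
        = 2 * energy p \<phi> + 2 * z\<^sup>2 * energy p k"
      using assms(1) \<phi> k by (rule energy_parallelogram)
    then have "\<beta> * (energy p (\<lambda>y. \<phi> y + z * k y) + energy p (\<lambda>y. \<phi> y + (- z) * k y))
        = \<beta> * (2 * energy p \<phi> + 2 * z\<^sup>2 * energy p k)"
      by simp
    then have "(?a + ?b) / 2 = \<beta> / 2 * energy p \<phi> + t"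
      by (simp add: t_def algebra_simps)
    then have "exp (- t) * exp (- (\<beta> / 2) * energy p \<phi>) = exp (- ((?a + ?b) / 2))"
      by (simp only: mult_exp_exp) simp
    also have "\<dots> \<le> (exp (- ?a) + exp (- ?b)) / 2"
      by (rule exp_midpoint_convex)
    finally have "exp (- t) * exp (- (\<beta> / 2) * energy p \<phi>) \<le> 1 / 2 * (exp (- ?b) + exp (- ?a))"
      by simp
    then show ?thesis
      unfolding weight_def by (subst ennreal_half_add) (simp_all flip: ennreal_mult)
  qed
  have "ennreal (exp (- t)) * (\<integral>\<^sup>+\<phi>. weight \<phi> * F \<phi> \<partial>zero_extension lborel A)
      = (\<integral>\<^sup>+\<phi>. ennreal (exp (- t)) * weight \<phi> * F \<phi> \<partial>zero_extension lborel A)"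
    by (simp add: nn_integral_cmult mult.assoc)
  also have "\<dots> \<le> (\<integral>\<^sup>+\<phi>. ennreal (1 / 2) * (weight (\<lambda>y. \<phi> y + (- z) * k y) + weight (\<lambda>y. \<phi> y + (- (- z)) * k y)) * F \<phi>
      \<partial>zero_extension lborel A)"
  proof (rule lborel_site.nn_integral_zero_extension_mono, measurable)
    fix \<phi> :: "int ^ 'd \<Rightarrow> real" assume "\<And>y. y \<notin> A \<Longrightarrow> \<phi> y = 0"
    then show "ennreal (exp (- t)) * weight \<phi> * F \<phi> \<le>
      ennreal (1 / 2) * (weight (\<lambda>y. \<phi> y + (- z) * k y) + weight (\<lambda>y. \<phi> y + (- (- z)) * k y)) * F \<phi>"
      by (intro mult_right_mono conv) auto
  qed
  also have "\<dots> = (\<integral>\<^sup>+\<phi>. ennreal (1 / 2) * (weight (\<lambda>y. \<phi> y + (- z) * k y) * F \<phi> + weight (\<lambda>y. \<phi> y + (- (- z)) * k y) * F \<phi>)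
      \<partial>zero_extension lborel A)"
    by (simp add: distrib_right mult.assoc)
  also have "\<dots> = ennreal (1 / 2) * ((\<integral>\<^sup>+\<phi>. weight (\<lambda>y. \<phi> y + (- z) * k y) * F \<phi> \<partial>zero_extension lborel A)
      + (\<integral>\<^sup>+\<phi>. weight (\<lambda>y. \<phi> y + (- (- z)) * k y) * F \<phi> \<partial>zero_extension lborel A))"
    by (subst nn_integral_cmult, measurable, subst nn_integral_add, measurable)
  finally have "ennreal (1 / Z A) * (ennreal (exp (- t)) * (\<integral>\<^sup>+\<phi>. weight \<phi> * F \<phi> \<partial>zero_extension lborel A))
      \<le> ennreal (1 / Z A) * (ennreal (1 / 2) * ((\<integral>\<^sup>+\<phi>. weight (\<lambda>y. \<phi> y + (- z) * k y) * F \<phi> \<partial>zero_extension lborel A)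
      + (\<integral>\<^sup>+\<phi>. weight (\<lambda>y. \<phi> y + (- (- z)) * k y) * F \<phi> \<partial>zero_extension lborel A)))"
    by (rule mult_left_mono) simp
  then have *: "ennreal (exp (- t)) * (\<integral>\<^sup>+\<phi>. F \<phi> \<partial>pinned_gaussian A) \<le>
    ennreal (1 / 2) * ((\<integral>\<^sup>+\<phi>. F (\<lambda>y. \<phi> y + z * h y) \<partial>pinned_gaussian A)
        + (\<integral>\<^sup>+\<phi>. F (\<lambda>y. \<phi> y + (- z) * h y) \<partial>pinned_gaussian A))"
    unfolding shift nn_integral_pinned_gaussian[OF assms(4)]
    by (simp add: distrib_left mult.left_commute)
  interpret prob_space "pinned_gaussian A"
    by (rule prob_space_pinned_gaussian[OF assms(1)])
  have "(\<integral>\<^sup>+\<phi>. F \<phi> \<partial>pinned_gaussian A) \<le> (\<integral>\<^sup>+\<phi>. 1 \<partial>pinned_gaussian A)"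
    by (intro nn_integral_mono assms(6))
  then have "(\<integral>\<^sup>+\<phi>. F \<phi> \<partial>pinned_gaussian A) \<le> 1"
    using emeasure_space_1 by simp
  then have "(\<integral>\<^sup>+\<phi>. F \<phi> \<partial>pinned_gaussian A) \<le>
    ennreal (1 / 2) * ((\<integral>\<^sup>+\<phi>. F (\<lambda>y. \<phi> y + z * h y) \<partial>pinned_gaussian A)
        + (\<integral>\<^sup>+\<phi>. F (\<lambda>y. \<phi> y + (- z) * h y) \<partial>pinned_gaussian A)) + ennreal t"
    using * by (rule ennreal_le_add_of_exp_mult_le)
      (use beta_pos energy_nonneg in \<open>simp add: t_def\<close>)
  \<comment> \<open>The cutoff has lost harmonicity, but the crude bound by the squares on
    \<open>S\<close> suffices: those squares are what the Green function gains on
    \<open>S\<close>.\<close>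
  moreover have "t \<le> z\<^sup>2 * (\<beta> * (\<Sum>y\<in>S. (h y)\<^sup>2))"
  proof -
    have "energy p k \<le> 2 * (\<Sum>y\<in>S. (k y)\<^sup>2)"
      using assms(2) by (intro energy_le_sum_squares) (auto simp: k_def)
    also have "(\<Sum>y\<in>S. (k y)\<^sup>2) = (\<Sum>y\<in>S. (h y)\<^sup>2)"
      by (simp add: k_def)
    finally have "\<beta> / 2 * z\<^sup>2 * energy p k \<le> \<beta> / 2 * z\<^sup>2 * (2 * (\<Sum>y\<in>S. (h y)\<^sup>2))"
      using beta_pos by (intro mult_left_mono) auto
    then show ?thesis
      by (simp add: t_def mult.left_commute mult.commute)
  qed
  ultimately show ?thesis
    by (meson add_left_mono ennreal_leI order_trans)
qed

text \<open>Integrate \<open>shift_stability\<close> over the Gaussian \<open>z\<close>. Its second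
  moment \<open>1 / q\<close> turns the error into \<open>\<beta>\<close> times the sum of
  \<open>(h y)\<^sup>2 / q\<close>, the exact increment of the Green sum. As \<open>x\<close> is not
  in \<open>S\<close>, \<open>h\<close> vanishes on the part of \<open>S\<close> outside
  \<open>A\<close>.\<close>

lemma insertion_stability:
  assumes "finite A" "x \<notin> A" "finite S" "x \<notin> S"
    and [measurable]: "F \<in> borel_measurable config_space"
    and "depends_on S F" "\<And>\<phi>. F \<phi> \<le> 1"
  shows "(\<integral>\<^sup>+\<phi>. F \<phi> \<partial>pinned_gaussian A) + ennreal (\<beta> * (\<Sum>y\<in>S. green A y))
    \<le> (\<integral>\<^sup>+\<phi>. F \<phi> \<partial>pinned_gaussian (insert x A)) + ennreal (\<beta> * (\<Sum>y\<in>S. green (insert x A) y))"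
proof -
  obtain h where h: "harmonic_at A x h"
    using ex_harmonic assms by blast
  let ?q = "\<beta> * energy p h"
  let ?n = "\<lambda>z. ennreal (normal_density 0 (1 / sqrt ?q) z)"
  let ?c = "\<beta> * (\<Sum>y\<in>S. (h y)\<^sup>2)"
  define s where "s z = ennreal (1 / 2) * ((\<integral>\<^sup>+\<phi>. F (\<lambda>y. \<phi> y + z * h y) \<partial>pinned_gaussian A)
        + (\<integral>\<^sup>+\<phi>. F (\<lambda>y. \<phi> y + (- z) * h y) \<partial>pinned_gaussian A))" for z
  have q: "0 < ?q"
    using harmonic_energy_pos[OF assms(1) h] beta_pos by simp
  have c: "0 \<le> ?c"
    using beta_pos by (simp add: sum_nonneg)
  have h0: "h y = 0" if "y \<in> S" "y \<notin> A" for y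
    using that assms(4) harmonic_atD(2)[OF h] by (metis insertE)
  have [measurable]: "s \<in> borel_measurable borel"
    unfolding s_def[abs_def] using assms(1,5)
    by (intro borel_measurable_times_ennreal borel_measurable_add measurable_nn_integral_shifted) auto
  have "(\<integral>\<^sup>+\<phi>. F \<phi> \<partial>pinned_gaussian A) = (\<integral>\<^sup>+z. ?n z * (\<integral>\<^sup>+\<phi>. F \<phi> \<partial>pinned_gaussian A) \<partial>lborel)"
    by (simp add: nn_integral_multc nn_integral_normal_density[OF q])
  also have "\<dots> \<le> (\<integral>\<^sup>+z. ?n z * (s z + ennreal (z\<^sup>2 * ?c)) \<partial>lborel)"
    unfolding s_def using h0 assms by (intro nn_integral_mono mult_left_mono shift_stability) auto
  also have "\<dots> = (\<integral>\<^sup>+z. ?n z * s z + (?n z * ennreal (z\<^sup>2)) * ennreal ?c \<partial>lborel)"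
    using c by (intro nn_integral_cong) (simp add: distrib_left ennreal_mult mult.assoc)
  also have "\<dots> = (\<integral>\<^sup>+z. ?n z * s z \<partial>lborel) + (\<integral>\<^sup>+z. (?n z * ennreal (z\<^sup>2)) * ennreal ?c \<partial>lborel)"
    by (rule nn_integral_add) auto
  also have "(\<integral>\<^sup>+z. ?n z * s z \<partial>lborel) = (\<integral>\<^sup>+\<phi>. F \<phi> \<partial>pinned_gaussian (insert x A))"
    unfolding s_def by (rule nn_integral_pinned_gaussian_symmetric[OF assms(1,2) h assms(5), symmetric])
  also have "(\<integral>\<^sup>+z. (?n z * ennreal (z\<^sup>2)) * ennreal ?c \<partial>lborel) = ennreal (?c / ?q)"
  proof -
    have "(\<integral>\<^sup>+z. (?n z * ennreal (z\<^sup>2)) * ennreal ?c \<partial>lborel) = ennreal (1 / ?q) * ennreal ?c"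
      by (subst nn_integral_multc) (simp_all only: normal_density_second_moment[OF q], simp)
    also have "\<dots> = ennreal (1 / ?q * ?c)"
      using q c by (intro ennreal_mult[symmetric]) auto
    finally show ?thesis
      by simp
  qed
  finally have "(\<integral>\<^sup>+\<phi>. F \<phi> \<partial>pinned_gaussian A) + ennreal (\<beta> * (\<Sum>y\<in>S. green A y))
      \<le> (\<integral>\<^sup>+\<phi>. F \<phi> \<partial>pinned_gaussian (insert x A)) + (ennreal (?c / ?q) + ennreal (\<beta> * (\<Sum>y\<in>S. green A y)))"
    by (simp add: add_right_mono flip: add.assoc)
  also have "ennreal (?c / ?q) + ennreal (\<beta> * (\<Sum>y\<in>S. green A y)) = ennreal (?c / ?q + \<beta> * (\<Sum>y\<in>S. green A y))"
    using q c beta_pos green_nonneg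
    by (intro ennreal_plus[symmetric] divide_nonneg_pos mult_nonneg_nonneg sum_nonneg) auto
  also have "?c / ?q + \<beta> * (\<Sum>y\<in>S. green A y) = \<beta> * (\<Sum>y\<in>S. green (insert x A) y)"
    by (simp add: green_insert[OF assms(1,2) h] sum.distrib distrib_left flip: sum_divide_distrib)
  finally show ?thesis .
qed

end

section \<open>Tightness and monotonicity\<close>

lemma mono_on_Pow_insertI:
  assumes "finite U" "\<And>A x. A \<subseteq> U \<Longrightarrow> x \<in> U \<Longrightarrow> x \<notin> A \<Longrightarrow> f A \<le> (f (insert x A) :: real)"
  shows "mono_on (Pow U) f"
proof (rule mono_onI)
  fix A B assume AB: "A \<in> Pow U" "B \<in> Pow U" "A \<subseteq> B"
  have "finite D \<Longrightarrow> D \<subseteq> U \<Longrightarrow> f A \<le> f (A \<union> D)" for D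
  proof (induction D rule: finite_induct)
    case (insert x D)
    show ?case
    proof (cases "x \<in> A")
      case False
      then have "f (A \<union> D) \<le> f (insert x (A \<union> D))"
        using insert AB by (intro assms(2)) auto
      then show ?thesis
        using insert by simp
    qed (use insert in \<open>simp add: insert_absorb\<close>)
  qed simp
  from this[of B] show "f A \<le> f B"
    using AB finite_subset[OF _ assms(1), of B] by (simp add: Un_absorb1)
qed

text \<open>The denominator grows like \<open>exp (a * sqrt k)\<close>, faster than any power of
  \<open>k\<close>.\<close>

lemma summable_tail_bound:
  fixes a :: real
  assumes "0 < a"
  shows "summable (\<lambda>k. real k / (1 + a / sqrt (real k)) ^ k)"
proof (rule summable_comparison_test_bigo)
  show "summable (\<lambda>k. norm (real k powr - 2))"
    by (simp add: summable_real_powr_iff)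
  have "(\<lambda>k. real k / (1 + a / sqrt (real k)) powr real k) \<in> O(\<lambda>k. real k powr - 2)"
    using assms by real_asymp
  moreover have "(1 + a / sqrt (real k)) powr real k = (1 + a / sqrt (real k)) ^ k" for k
    using assms by (intro powr_realpow) (simp add: add_pos_nonneg)
  ultimately show "(\<lambda>k. real k / (1 + a / sqrt (real k)) ^ k) \<in> O(\<lambda>k. real k powr - 2)"
    by simp
qed

locale pinning_model = gaussian_field p e \<beta> for p :: "int ^ 'd \<Rightarrow> real" and e \<beta> +
  fixes \<epsilon> :: real
  assumes eps_pos: "0 < \<epsilon>"
begin

text \<open>In volume \<open>\<Lambda>\<close> the unpinned set \<open>A\<close> has weight
  \<open>\<epsilon> ^ card (\<Lambda> - A) * Z A\<close>. Dividing by
  \<open>\<epsilon> ^ card \<Lambda>\<close> leaves a weight that is the same for all volumes, so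
  enlarging the volume only enlarges the family of sets averaged over.\<close>

definition pinning_weight :: "(int ^ 'd) set \<Rightarrow> real" where
  "pinning_weight A = Z A / \<epsilon> ^ card A"

lemma pinning_weight_pos: "finite A \<Longrightarrow> 0 < pinning_weight A"
  using Z_pos eps_pos by (simp add: pinning_weight_def)

lemma pinning_weight_insert:
  assumes "finite A" "x \<notin> A" "harmonic_at A x h"
  shows "pinning_weight (insert x A) = sqrt (2 * pi / (\<beta> * energy p h)) / \<epsilon> * pinning_weight A"
  using assms by (simp add: pinning_weight_def Z_insert)

lemma increasing_ratios_pinning_weight:
  assumes "finite U"
  shows "increasing_ratios U pinning_weight"
  unfolding increasing_ratios_def
proof (intro conjI allI impI)
  fix A assume "A \<subseteq> U"
  then show "0 < pinning_weight A"
    using assms by (intro pinning_weight_pos finite_subset[OF _ assms])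
next
  fix x A B assume *: "A \<subseteq> B" "insert x B \<subseteq> U" "x \<notin> B"
  have fin: "finite A" "finite B"
    using * by (auto intro: finite_subset[OF _ assms])
  obtain h h' where h: "harmonic_at A x h" "harmonic_at B x h'"
    using ex_harmonic fin * by (meson in_mono)
  have "energy p h' \<le> energy p h"
    using harmonic_energy_antimono * h by blast
  then have "2 * pi / (\<beta> * energy p h) \<le> 2 * pi / (\<beta> * energy p h')"
    using harmonic_energy_pos[OF fin(1) h(1)] harmonic_energy_pos[OF fin(2) h(2)] beta_pos
    by (intro divide_left_mono mult_left_mono) auto
  then have "sqrt (2 * pi / (\<beta> * energy p h)) / \<epsilon> * (pinning_weight A * pinning_weight B) \<le> sqrt (2 * pi / (\<beta> * energy p h')) / \<epsilon> * (pinning_weight A * pinning_weight B)"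
    using pinning_weight_pos fin eps_pos by (intro mult_right_mono divide_right_mono real_sqrt_le_mono) (auto simp: less_imp_le)
  then show "pinning_weight (insert x A) * pinning_weight B \<le> pinning_weight (insert x B) * pinning_weight A"
    using * fin h by (subst (1 2) pinning_weight_insert) (auto simp: mult_ac)
qed

text \<open>Sites are pinned one at a time. A site of the run is at most \<open>k\<close> steps from
  the pinned site \<open>y + multiple k e\<close>, so its inverse variance \<open>q\<close> is at
  least \<open>\<beta> * p e / (2 * k)\<close>, and pinning it multiplies the weight by
  \<open>\<epsilon> * sqrt (q / (2 * pi))\<close>.\<close>

lemma pinning_weight_removal:
  assumes "finite A" "y + multiple k e \<notin> A"
    and "C \<subseteq> (\<lambda>j. y + multiple j e) ` {..<k}" "C \<subseteq> A"
  shows "(\<epsilon> * sqrt (\<beta> * p e / (4 * pi)) / sqrt (real k)) ^ card C * pinning_weight A \<le> pinning_weight (A - C)"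
proof -
  let ?r = "\<epsilon> * sqrt (\<beta> * p e / (4 * pi)) / sqrt (real k)"
  have r: "0 \<le> ?r"
    using eps_pos beta_pos step_pos by simp
  have "finite C"
    using assms(1,4) by (rule rev_finite_subset)
  then show ?thesis
    using assms(3,4)
  proof (induction C rule: finite_induct)
    case (insert x C)
    define B where "B = A - insert x C"
    have B: "finite B" "x \<notin> B" and eq: "A - C = insert x B"
      using assms(1) insert.hyps insert.prems by (auto simp: B_def)
    obtain j where j: "x = y + multiple j e" "j < k"
      using insert.prems by auto
    \<comment> \<open>The same pinned site serves for every removed site, at distance
      \<open>k - j \<le> k\<close>.\<close>
    have k: "x + multiple (k - j) e = y + multiple k e"
      using multiple_add[of j "k - j" e] j by (simp add: add.assoc)
    obtain h where h: "harmonic_at B x h"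
      using ex_harmonic B by blast
    have "p e / (2 * real k) \<le> p e / (2 * real (k - j))"
      using j step_pos by (intro divide_left_mono) auto
    also have "\<dots> \<le> energy p h"
    proof (rule harmonic_energy_lower_bound[OF B(1) h])
      show "x + multiple (k - j) e \<notin> insert x B"
        using k assms(2) insert.prems by (auto simp: B_def)
    qed
    finally have "\<beta> * (p e / (2 * real k)) / (2 * pi) \<le> \<beta> * energy p h / (2 * pi)"
      using beta_pos by (intro divide_right_mono mult_left_mono) auto
    then have "\<epsilon> * sqrt (\<beta> * (p e / (2 * real k)) / (2 * pi)) \<le> \<epsilon> * sqrt (\<beta> * energy p h / (2 * pi))"
      using eps_pos by (intro mult_left_mono real_sqrt_le_mono) auto
    also have "\<epsilon> * sqrt (\<beta> * (p e / (2 * real k)) / (2 * pi)) = ?r"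
      by (simp add: real_sqrt_divide real_sqrt_mult)
    finally have le: "?r \<le> \<epsilon> * sqrt (\<beta> * energy p h / (2 * pi))" .
    have q: "0 < energy p h"
      by (rule harmonic_energy_pos[OF B(1) h])
    have "?r * pinning_weight (insert x B) \<le> \<epsilon> * sqrt (\<beta> * energy p h / (2 * pi)) * pinning_weight (insert x B)"
      using le pinning_weight_pos B(1) by (intro mult_right_mono) (auto simp: less_imp_le)
    also have "\<dots> = pinning_weight B"
      using q beta_pos eps_pos by (simp add: pinning_weight_insert[OF B h] real_sqrt_divide real_sqrt_mult)
    finally have step: "?r * pinning_weight (A - C) \<le> pinning_weight (A - insert x C)"
      by (simp add: eq B_def)
    have "?r ^ card (insert x C) * pinning_weight A = ?r * (?r ^ card C * pinning_weight A)"
      using insert.hyps by simp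
    also have "\<dots> \<le> ?r * pinning_weight (A - C)"
      using insert r by (intro mult_left_mono) auto
    finally show ?case
      using step by linarith
  qed simp
qed

text \<open>The term of index \<open>k\<close> is the value of \<open>green_bound\<close> times the
  probability bound from \<open>removal_bound\<close> for a run of \<open>k\<close> unpinned sites.
  The term of index 0 is 0.\<close>

definition green_constant :: real where
  "green_constant = (\<Sum>k. 2 / (\<beta> * p e) *
    (real k / (1 + \<epsilon> * sqrt (\<beta> * p e / (4 * pi)) / sqrt (real k)) ^ k))"

text \<open>Decompose according to the first pinned site on the half line from \<open>y\<close> in direction \<open>e\<close>.\<close>

lemma average_green_bounded:
  assumes "finite U"
  shows "weighted_average pinning_weight (\<lambda>A. green A y) U \<le> green_constant"
proof -
  let ?a = "\<epsilon> * sqrt (\<beta> * p e / (4 * pi))"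
  let ?c = "2 / (\<beta> * p e)"
  let ?W = "\<Sum>A\<in>Pow U. pinning_weight A"
  \<comment> \<open>The number of unpinned sites before the first pinned one; the minimum exists
    because \<open>A\<close> is finite.\<close>
  define D where "D A = (LEAST k. y + multiple k e \<notin> A)" for A
  define b where "b k = ?c * (real k / (1 + ?a / sqrt (real k)) ^ k)" for k
  have a: "0 < ?a"
    using eps_pos beta_pos step_pos by simp
  have c: "0 < ?c"
    using beta_pos step_pos by simp
  have fin: "finite A" if "A \<subseteq> U" for A
    using that assms by (rule finite_subset)
  have D: "y + multiple (D A) e \<notin> A" "\<And>j. j < D A \<Longrightarrow> y + multiple j e \<in> A" if "A \<subseteq> U" for A
    using LeastI_ex[OF ex_multiple_notin[OF fin[OF that], of y]] not_less_Least[of _ "\<lambda>k. y + multiple k e \<notin> A"]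
    by (auto simp: D_def)
  have W: "0 < ?W"
    using assms fin by (intro sum_pos pinning_weight_pos) auto
  have b: "0 \<le> b k" for k
    using a c by (simp add: b_def)
  have level: "(\<Sum>A\<in>{A \<in> Pow U. D A = k}. pinning_weight A * green A y) \<le> b k * ?W" for k
  proof -
    let ?T = "{A \<in> Pow U. D A = k}" and ?L = "(\<lambda>j. y + multiple j e) ` {..<k}"
    have "(\<Sum>A\<in>?T. pinning_weight A) * (1 + ?a / sqrt (real k)) ^ card ?L \<le> ?W"
    proof (rule removal_bound)
      show "?L \<subseteq> A \<and> A \<subseteq> U" if "A \<in> ?T" for A
        using that D(2)[of A] by auto
      show "(?a / sqrt (real k)) ^ card C * pinning_weight A \<le> pinning_weight (A - C)" if "A \<in> ?T" "C \<subseteq> ?L" for A C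
        using that D[of A] fin[of A] by (intro pinning_weight_removal[where y = y]) auto
    qed (use assms fin pinning_weight_pos in \<open>auto simp: less_imp_le\<close>)
    moreover have "card ?L = k"
      by (subst card_image) (auto simp: inj_on_def multiple_eq_iff step_nonzero)
    moreover have pos: "0 < (1 + ?a / sqrt (real k)) ^ k"
      using a by (intro zero_less_power add_pos_nonneg) auto
    ultimately have *: "(\<Sum>A\<in>?T. pinning_weight A) \<le> ?W / (1 + ?a / sqrt (real k)) ^ k"
      by (simp add: pos_le_divide_eq)
    have "(\<Sum>A\<in>?T. pinning_weight A * green A y) \<le> (\<Sum>A\<in>?T. pinning_weight A * (?c * real k))"
    proof (intro sum_mono mult_left_mono)
      fix A assume "A \<in> ?T"
      then show "green A y \<le> ?c * real k" "0 \<le> pinning_weight A"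
        using D(1)[of A] fin[of A] pinning_weight_pos[of A] green_bound[of A y "D A"] by auto
    qed
    also have "\<dots> = ?c * real k * (\<Sum>A\<in>?T. pinning_weight A)"
      by (simp add: sum_distrib_left mult.commute)
    also have "\<dots> \<le> ?c * real k * (?W / (1 + ?a / sqrt (real k)) ^ k)"
      using c * by (intro mult_left_mono) auto
    also have "\<dots> = b k * ?W"
      by (simp add: b_def)
    finally show ?thesis .
  qed
  have "(\<Sum>A\<in>Pow U. pinning_weight A * green A y) = (\<Sum>k\<in>D ` Pow U. \<Sum>A\<in>{A \<in> Pow U. D A = k}. pinning_weight A * green A y)"
    using assms by (intro sum.image_gen) simp
  also have "\<dots> \<le> (\<Sum>k\<in>D ` Pow U. b k * ?W)"
    by (intro sum_mono level)
  also have "\<dots> = (\<Sum>k\<in>D ` Pow U. b k) * ?W"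
    by (simp add: sum_distrib_right)
  also have "\<dots> \<le> (\<Sum>k. b k) * ?W"
  proof (intro mult_right_mono sum_le_suminf)
    show "summable b"
      unfolding b_def[abs_def] using a by (intro summable_mult summable_tail_bound)
  qed (use W b assms in auto)
  finally show ?thesis
    using W by (simp add: weighted_average_def green_constant_def b_def pos_divide_le_eq)
qed

definition mean :: "((int ^ 'd \<Rightarrow> real) \<Rightarrow> ennreal) \<Rightarrow> (int ^ 'd) set \<Rightarrow> real" where
  "mean F A = enn2real (\<integral>\<^sup>+\<phi>. F \<phi> \<partial>pinned_gaussian A)"

text \<open>The Green sum pays for insertions outside \<open>S\<close>, by
  \<open>insertion_stability\<close>. Inserting a site of \<open>S\<close> can lower a mean with
  values in \<open>[0,1]\<close> by at most 1, which the count makes up for.\<close>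

definition corrector :: "(int ^ 'd) set \<Rightarrow> (int ^ 'd) set \<Rightarrow> real" where
  "corrector S A = \<beta> * (\<Sum>y\<in>S. green A y) + real (card (A \<inter> S))"

lemma mean_le_1:
  assumes "finite A" "\<And>\<phi>. F \<phi> \<le> 1"
  shows "(\<integral>\<^sup>+\<phi>. F \<phi> \<partial>pinned_gaussian A) = ennreal (mean F A)" "mean F A \<le> 1" "0 \<le> mean F A"
proof -
  interpret prob_space "pinned_gaussian A"
    by (rule prob_space_pinned_gaussian[OF assms(1)])
  have "(\<integral>\<^sup>+\<phi>. F \<phi> \<partial>pinned_gaussian A) \<le> (\<integral>\<^sup>+\<phi>. 1 \<partial>pinned_gaussian A)"
    by (intro nn_integral_mono assms(2))
  then have *: "(\<integral>\<^sup>+\<phi>. F \<phi> \<partial>pinned_gaussian A) \<le> 1"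
    using emeasure_space_1 by simp
  show 1: "(\<integral>\<^sup>+\<phi>. F \<phi> \<partial>pinned_gaussian A) = ennreal (mean F A)"
    unfolding mean_def using * by (subst ennreal_enn2real) (auto simp: le_less_trans)
  then show "mean F A \<le> 1"
    using * by simp
  show "0 \<le> mean F A"
    by (simp add: mean_def)
qed

lemma green_mono_insert:
  assumes "finite A" "x \<notin> A"
  shows "green A y \<le> green (insert x A) y"
proof -
  obtain h where "harmonic_at A x h"
    using ex_harmonic assms by blast
  then show ?thesis
    using green_insert[OF assms] energy_nonneg beta_pos by simp
qed

lemma corrected_mean_mono:
  assumes "finite U" "finite S" "F \<in> borel_measurable config_space" "depends_on S F" "\<And>\<phi>. F \<phi> \<le> 1"
  shows "mono_on (Pow U) (\<lambda>A. mean F A + corrector S A)"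
proof (rule mono_on_Pow_insertI[OF assms(1)])
  fix A x assume A: "A \<subseteq> U" "x \<in> U" "x \<notin> A"
  have fin: "finite A"
    using A(1) assms(1) by (rule finite_subset)
  have nn: "0 \<le> \<beta> * (\<Sum>y\<in>S. green A y)" for A
    using beta_pos green_nonneg by (simp add: sum_nonneg)
  note m = mean_le_1[of _ F, OF _ assms(5)]
  show "mean F A + corrector S A \<le> mean F (insert x A) + corrector S (insert x A)"
  proof (cases "x \<in> S")
    case True
    have "\<beta> * (\<Sum>y\<in>S. green A y) \<le> \<beta> * (\<Sum>y\<in>S. green (insert x A) y)"
      using beta_pos green_mono_insert[OF fin A(3)] by (intro mult_left_mono sum_mono) auto
    moreover have "card (insert x A \<inter> S) = Suc (card (A \<inter> S))"
      using True A(3) fin by simp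
    ultimately show ?thesis
      using m(2,3)[OF fin] m(2,3)[of "insert x A"] fin by (simp add: corrector_def)
  next
    case False
    have "ennreal (mean F A + \<beta> * (\<Sum>y\<in>S. green A y)) \<le> ennreal (mean F (insert x A) + \<beta> * (\<Sum>y\<in>S. green (insert x A) y))"
      using insertion_stability[OF fin A(3) assms(2) False assms(3-5)] m[OF fin] m[of "insert x A"] fin nn
      by (simp flip: ennreal_plus)
    then have "mean F A + \<beta> * (\<Sum>y\<in>S. green A y) \<le> mean F (insert x A) + \<beta> * (\<Sum>y\<in>S. green (insert x A) y)"
      using m(3)[of "insert x A"] fin nn by (subst (asm) ennreal_le_iff) auto
    then show ?thesis
      using False by (simp add: corrector_def)
  qed
qed

end

section \<open>Finite volume pinning measures\<close>

lemma borel_measurable_site_measure: "borel_measurable (site_measure \<epsilon>) = borel_measurable borel"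
  by (rule measurable_cong_sets) simp_all

lemma nn_integral_site_measure:
  assumes "f \<in> borel_measurable borel"
  shows "(\<integral>\<^sup>+z. f z \<partial>site_measure \<epsilon>) = (\<integral>\<^sup>+z. f z \<partial>lborel) + ennreal \<epsilon> * f 0"
  using assms
proof (induction rule: borel_measurable_induct)
  case (cong f g)
  then show ?case
    by (metis UNIV_I space_borel ext)
next
  case (set A)
  then show ?case
    by (simp add: emeasure_site_measure)
next
  case (mult u c)
  then show ?case
    by (simp add: borel_measurable_site_measure nn_integral_cmult distrib_left mult.left_commute)
next
  case (add u v)
  then show ?case
    by (simp add: borel_measurable_site_measure nn_integral_add distrib_left add_ac)
next
  case (seq U)
  note seq(1)[measurable]
  have "(\<integral>\<^sup>+z. (SUP i. U i) z \<partial>site_measure \<epsilon>) = (SUP i. (\<integral>\<^sup>+z. U i z \<partial>site_measure \<epsilon>))"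
    using seq by (simp add: borel_measurable_site_measure nn_integral_monotone_convergence_SUP SUP_apply image_comp)
  also have "\<dots> = (SUP i. (\<integral>\<^sup>+z. U i z \<partial>lborel) + ennreal \<epsilon> * U i 0)"
    by (simp add: seq.IH)
  also have "\<dots> = (SUP i. \<integral>\<^sup>+z. U i z \<partial>lborel) + (SUP i. ennreal \<epsilon> * U i 0)"
    using seq(3) by (intro ennreal_SUP_add)
      (auto simp: incseq_def le_fun_def intro!: nn_integral_mono mult_left_mono)
  also have "(SUP i. \<integral>\<^sup>+z. U i z \<partial>lborel) = (\<integral>\<^sup>+z. (SUP i. U i) z \<partial>lborel)"
    using seq by (simp add: nn_integral_monotone_convergence_SUP SUP_apply image_comp)
  also have "(SUP i. ennreal \<epsilon> * U i 0) = ennreal \<epsilon> * (SUP i. U i) 0"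
    by (simp add: SUP_mult_left_ennreal SUP_apply image_comp)
  finally show ?case .
qed

interpretation site: site_law "site_measure \<epsilon>" for \<epsilon>
proof
  show "\<exists>A. countable A \<and> A \<subseteq> sets (site_measure \<epsilon>) \<and> \<Union> A = space (site_measure \<epsilon>) \<and>
      (\<forall>a\<in>A. emeasure (site_measure \<epsilon>) a \<noteq> \<infinity>)"
  proof (intro exI[of _ "range (\<lambda>n::nat. {- real n .. real n})"] conjI)
    have "\<exists>n. x \<in> {- real n .. real n}" for x
      using real_arch_simple[of "\<bar>x\<bar>"] by (metis abs_le_D1 abs_le_D2 atLeastAtMost_iff minus_le_iff)
    then show "\<Union> (range (\<lambda>n::nat. {- real n .. real n})) = space (site_measure \<epsilon>)"
      by auto
  qed (auto simp: emeasure_site_measure ennreal_mult_eq_top_iff indicator_def)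
qed simp

lemma reference_measure_eq_zero_extension: "reference_measure \<epsilon> \<Lambda> = zero_extension (site_measure \<epsilon>) \<Lambda>"
  by (simp add: reference_measure_def zero_extension_def)

lemma nn_integral_reference_measure:
  assumes "finite \<Lambda>" "0 \<le> \<epsilon>" "F \<in> borel_measurable config_space"
  shows "(\<integral>\<^sup>+\<phi>. F \<phi> \<partial>reference_measure \<epsilon> \<Lambda>)
    = (\<Sum>A\<in>Pow \<Lambda>. ennreal (\<epsilon> ^ card (\<Lambda> - A)) * (\<integral>\<^sup>+\<phi>. F \<phi> \<partial>zero_extension lborel A))"
  using assms(1,3)
proof (induction \<Lambda> arbitrary: F rule: finite_induct)
  case empty
  then show ?case
    by (simp add: reference_measure_eq_zero_extension site.nn_integral_zero_extension_empty
        lborel_site.nn_integral_zero_extension_empty)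
next
  case (insert x U)
  note insert.prems[measurable]
  note [measurable] = lborel_site.measurable_nn_integral_zero_extension
  have fin: "finite A" if "A \<in> Pow U" for A
    using that insert.hyps(1) finite_subset by auto
  have card: "card (insert x U - A) = Suc (card (U - A))" "insert x U - insert x A = U - A" if "A \<in> Pow U" for A
    using that insert.hyps by (auto simp: insert_Diff_if)
  have meas: "(\<lambda>z. \<integral>\<^sup>+\<phi>. F (\<phi>(x := z)) \<partial>zero_extension lborel A) \<in> borel_measurable borel" if "A \<in> Pow U" for A
    using fin[OF that] by (rule lborel_site.measurable_nn_integral_zero_extension) measurable
  \<comment> \<open>The atom at 0 sets \<open>\<phi> x\<close> to the value that it has anyway under
    the zero extension of \<open>A\<close>, because \<open>x\<close> is not in
    \<open>A\<close>.\<close>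
  have zero: "(\<integral>\<^sup>+\<phi>. F (\<phi>(x := 0)) \<partial>zero_extension lborel A) = (\<integral>\<^sup>+\<phi>. F \<phi> \<partial>zero_extension lborel A)"
    if "A \<in> Pow U" for A
  proof (rule lborel_site.nn_integral_zero_extension_cong)
    fix \<phi> :: "int ^ 'a \<Rightarrow> real" assume "\<And>y. y \<notin> A \<Longrightarrow> \<phi> y = 0"
    then have "\<phi>(x := 0) = \<phi>"
      using that insert.hyps by (auto simp: fun_eq_iff)
    then show "F (\<phi>(x := 0)) = F \<phi>"
      by simp
  qed measurable
  let ?c = "\<lambda>A. ennreal (\<epsilon> ^ card (U - A))"
  have "(\<integral>\<^sup>+\<phi>. F \<phi> \<partial>reference_measure \<epsilon> (insert x U))
      = (\<integral>\<^sup>+z. (\<integral>\<^sup>+\<phi>. F (\<phi>(x := z)) \<partial>reference_measure \<epsilon> U) \<partial>site_measure \<epsilon>)"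
    unfolding reference_measure_eq_zero_extension
    using insert.hyps by (intro site.nn_integral_zero_extension_insert) auto
  also have "\<dots> = (\<integral>\<^sup>+z. (\<Sum>A\<in>Pow U. ?c A * (\<integral>\<^sup>+\<phi>. F (\<phi>(x := z)) \<partial>zero_extension lborel A)) \<partial>site_measure \<epsilon>)"
    by (intro nn_integral_cong insert.IH) measurable
  also have "\<dots> = (\<integral>\<^sup>+z. (\<Sum>A\<in>Pow U. ?c A * (\<integral>\<^sup>+\<phi>. F (\<phi>(x := z)) \<partial>zero_extension lborel A)) \<partial>lborel)
      + ennreal \<epsilon> * (\<Sum>A\<in>Pow U. ?c A * (\<integral>\<^sup>+\<phi>. F \<phi> \<partial>zero_extension lborel A))"
    using meas by (subst nn_integral_site_measure) (auto simp: zero)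
  also have "(\<integral>\<^sup>+z. (\<Sum>A\<in>Pow U. ?c A * (\<integral>\<^sup>+\<phi>. F (\<phi>(x := z)) \<partial>zero_extension lborel A)) \<partial>lborel)
      = (\<Sum>A\<in>Pow U. ?c A * (\<integral>\<^sup>+z. \<integral>\<^sup>+\<phi>. F (\<phi>(x := z)) \<partial>zero_extension lborel A \<partial>lborel))"
    using meas by (subst nn_integral_sum) (auto simp: nn_integral_cmult)
  also have "\<dots> = (\<Sum>A\<in>Pow U. ?c A * (\<integral>\<^sup>+\<phi>. F \<phi> \<partial>zero_extension lborel (insert x A)))"
    using insert.hyps fin by (intro sum.cong refl) (subst lborel_site.nn_integral_zero_extension_insert, auto)
  also have "ennreal \<epsilon> * (\<Sum>A\<in>Pow U. ?c A * (\<integral>\<^sup>+\<phi>. F \<phi> \<partial>zero_extension lborel A))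
      = (\<Sum>A\<in>Pow U. ennreal (\<epsilon> ^ card (insert x U - A)) * (\<integral>\<^sup>+\<phi>. F \<phi> \<partial>zero_extension lborel A))"
    using assms(2) by (simp add: sum_distrib_left card ennreal_mult mult.assoc)
  also have "(\<Sum>A\<in>Pow U. ?c A * (\<integral>\<^sup>+\<phi>. F \<phi> \<partial>zero_extension lborel (insert x A))) + \<dots>
      = (\<Sum>A\<in>Pow (insert x U). ennreal (\<epsilon> ^ card (insert x U - A)) * (\<integral>\<^sup>+\<phi>. F \<phi> \<partial>zero_extension lborel A))"
    using insert.hyps by (simp add: sum_Pow_insert card add.commute)
  finally show ?case .
qed

lemma nn_integral_zero_extension_shift:
  fixes a :: "int ^ 'd"
  assumes "site_law M" "finite \<Lambda>" "F \<in> borel_measurable config_space"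
  shows "(\<integral>\<^sup>+\<phi>. F (\<lambda>x. \<phi> (x + a)) \<partial>zero_extension M \<Lambda>) = (\<integral>\<^sup>+\<phi>. F \<phi> \<partial>zero_extension M ((\<lambda>x. x - a) ` \<Lambda>))"
proof -
  interpret site_law M by fact
  have shift [measurable]: "(\<lambda>\<phi> x. \<phi> (x + a)) \<in> measurable config_space (config_space :: (int ^ 'd \<Rightarrow> real) measure)"
    by (rule measurable_config_spaceI) simp
  show ?thesis
    using assms(2,3)
  proof (induction \<Lambda> arbitrary: F rule: finite_induct)
    case empty
    then show ?case
      by (simp add: nn_integral_zero_extension_empty measurable_compose[OF shift])
  next
    case (insert x U)
    note insert.prems[measurable]
    have eq: "(\<lambda>y. (\<phi>(x := z)) (y + a)) = (\<lambda>y. \<phi> (y + a))(x - a := z)" for \<phi> :: "int ^ 'd \<Rightarrow> real" and z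
      by (auto simp: fun_eq_iff)
    have "(\<integral>\<^sup>+\<phi>. F (\<lambda>x. \<phi> (x + a)) \<partial>zero_extension M (insert x U))
        = (\<integral>\<^sup>+z. (\<integral>\<^sup>+\<phi>. F ((\<lambda>y. \<phi> (y + a))(x - a := z)) \<partial>zero_extension M U) \<partial>M)"
      using insert.hyps by (subst nn_integral_zero_extension_insert) (auto simp only: eq, measurable)
    also have "\<dots> = (\<integral>\<^sup>+z. (\<integral>\<^sup>+\<phi>. F (\<phi>(x - a := z)) \<partial>zero_extension M ((\<lambda>x. x - a) ` U)) \<partial>M)"
      by (intro nn_integral_cong insert.IH) measurable
    also have "\<dots> = (\<integral>\<^sup>+\<phi>. F \<phi> \<partial>zero_extension M (insert (x - a) ((\<lambda>x. x - a) ` U)))"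
      using insert.hyps by (subst nn_integral_zero_extension_insert) auto
    finally show ?case
      by simp
  qed
qed

lemma weighted_average_add:
  "weighted_average w (\<lambda>A. f A + g A) U = weighted_average w f U + weighted_average w g U"
  by (simp add: weighted_average_def distrib_left sum.distrib add_divide_distrib)

lemma weighted_average_const_mult:
  "weighted_average w (\<lambda>A. c * f A) U = c * weighted_average w f U"
  by (simp add: weighted_average_def sum_distrib_left mult.left_commute)

lemma weighted_average_sum:
  "weighted_average w (\<lambda>A. \<Sum>i\<in>I. f i A) U = (\<Sum>i\<in>I. weighted_average w (f i) U)"
  unfolding weighted_average_def sum_distrib_left
  by (subst sum.swap) (simp add: sum_divide_distrib)

lemma weighted_average_le:
  assumes "finite U" "\<And>A. A \<subseteq> U \<Longrightarrow> 0 < w A" "\<And>A. A \<subseteq> U \<Longrightarrow> f A \<le> c"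
  shows "weighted_average w f U \<le> c"
proof -
  have "(\<Sum>A\<in>Pow U. w A * f A) \<le> (\<Sum>A\<in>Pow U. w A * c)"
    using assms by (intro sum_mono mult_left_mono) (auto simp: less_imp_le)
  moreover have "0 < (\<Sum>A\<in>Pow U. w A)"
    using assms by (intro sum_pos) auto
  ultimately show ?thesis
    by (simp add: weighted_average_def pos_divide_le_eq mult.commute flip: sum_distrib_left)
qed

lemma indicator_le_1_ennreal: "indicator B x \<le> (1 :: ennreal)"
  by (simp add: indicator_def)

context pinning_model
begin

lemma nn_integral_boltzmann_measure:
  assumes "finite \<Lambda>" "F \<in> borel_measurable config_space" "\<And>\<phi>. F \<phi> \<le> 1"
  shows "(\<integral>\<^sup>+\<phi>. F \<phi> \<partial>boltzmann_measure p \<beta> \<epsilon> \<Lambda>) = ennreal (\<epsilon> ^ card \<Lambda> * (\<Sum>A\<in>Pow \<Lambda>. pinning_weight A * mean F A))"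
proof -
  note assms(2)[measurable]
  have fin: "finite A" if "A \<in> Pow \<Lambda>" for A
    using that assms(1) finite_subset by auto
  have "(\<integral>\<^sup>+\<phi>. F \<phi> \<partial>boltzmann_measure p \<beta> \<epsilon> \<Lambda>) = (\<integral>\<^sup>+\<phi>. weight \<phi> * F \<phi> \<partial>reference_measure \<epsilon> \<Lambda>)"
    unfolding boltzmann_measure_def weight_def reference_measure_eq_zero_extension
    by (subst nn_integral_density) auto
  also have "\<dots> = (\<Sum>A\<in>Pow \<Lambda>. ennreal (\<epsilon> ^ card (\<Lambda> - A)) * (ennreal (Z A) * (\<integral>\<^sup>+\<phi>. F \<phi> \<partial>pinned_gaussian A)))"
    using assms(1) eps_pos fin by (subst nn_integral_reference_measure) (auto simp: nn_integral_weight_eq)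
  also have "\<dots> = (\<Sum>A\<in>Pow \<Lambda>. ennreal (\<epsilon> ^ card \<Lambda> * (pinning_weight A * mean F A)))"
  proof (intro sum.cong refl)
    fix A assume A: "A \<in> Pow \<Lambda>"
    have "card \<Lambda> = card (\<Lambda> - A) + card A"
      using A assms(1) fin[OF A] by (simp add: card_Diff_subset card_mono)
    then have "\<epsilon> ^ card \<Lambda> * pinning_weight A = \<epsilon> ^ card (\<Lambda> - A) * Z A"
      using eps_pos by (simp add: pinning_weight_def power_add)
    then have *: "\<epsilon> ^ card \<Lambda> * (pinning_weight A * mean F A) = \<epsilon> ^ card (\<Lambda> - A) * (Z A * mean F A)"
      by (simp flip: mult.assoc)
    show "ennreal (\<epsilon> ^ card (\<Lambda> - A)) * (ennreal (Z A) * (\<integral>\<^sup>+\<phi>. F \<phi> \<partial>pinned_gaussian A))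
        = ennreal (\<epsilon> ^ card \<Lambda> * (pinning_weight A * mean F A))"
      unfolding * mean_le_1(1)[OF fin[OF A] assms(3)]
      using eps_pos Z_pos[OF fin[OF A]] mean_le_1(3)[OF fin[OF A] assms(3)]
      by (simp add: ennreal_mult less_imp_le)
  qed
  also have "\<dots> = ennreal (\<epsilon> ^ card \<Lambda> * (\<Sum>A\<in>Pow \<Lambda>. pinning_weight A * mean F A))"
    using eps_pos pinning_weight_pos[OF fin] mean_le_1(3)[OF fin assms(3)]
    by (subst sum_ennreal) (auto simp: sum_distrib_left less_imp_le)
  finally show ?thesis .
qed

lemma sets_pinning_measure [measurable_cong, simp]: "sets (pinning_measure p \<beta> \<epsilon> \<Lambda>) = sets config_space"
  by (simp add: pinning_measure_def boltzmann_measure_def reference_measure_eq_zero_extension)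

lemma space_pinning_measure [simp]: "space (pinning_measure p \<beta> \<epsilon> \<Lambda>) = UNIV"
  using sets_eq_imp_space_eq[OF sets_pinning_measure] by simp

lemma nn_integral_pinning_measure:
  assumes "finite \<Lambda>" "F \<in> borel_measurable config_space" "\<And>\<phi>. F \<phi> \<le> 1"
  shows "(\<integral>\<^sup>+\<phi>. F \<phi> \<partial>pinning_measure p \<beta> \<epsilon> \<Lambda>) = ennreal (weighted_average pinning_weight (mean F) \<Lambda>)"
proof -
  have fin: "finite A" if "A \<in> Pow \<Lambda>" for A
    using that assms(1) finite_subset by auto
  have mean1: "mean (\<lambda>_. 1) A = 1" if "A \<in> Pow \<Lambda>" for A
    using prob_space.emeasure_space_1[OF prob_space_pinned_gaussian[OF fin[OF that]]] by (simp add: mean_def)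
  have W: "0 < (\<Sum>A\<in>Pow \<Lambda>. pinning_weight A)"
    using assms(1) pinning_weight_pos fin by (intro sum_pos) auto
  have "partition_function p \<beta> \<epsilon> \<Lambda> = (\<integral>\<^sup>+\<phi>. 1 \<partial>boltzmann_measure p \<beta> \<epsilon> \<Lambda>)"
    by (simp add: partition_function_def boltzmann_measure_def reference_measure_eq_zero_extension)
  also have "\<dots> = ennreal (\<epsilon> ^ card \<Lambda> * (\<Sum>A\<in>Pow \<Lambda>. pinning_weight A))"
    by (subst nn_integral_boltzmann_measure[OF assms(1)]) (auto simp: mean1)
  finally have Z: "partition_function p \<beta> \<epsilon> \<Lambda> = ennreal (\<epsilon> ^ card \<Lambda> * (\<Sum>A\<in>Pow \<Lambda>. pinning_weight A))" .
  have "(\<integral>\<^sup>+\<phi>. F \<phi> \<partial>pinning_measure p \<beta> \<epsilon> \<Lambda>)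
      = 1 / partition_function p \<beta> \<epsilon> \<Lambda> * (\<integral>\<^sup>+\<phi>. F \<phi> \<partial>boltzmann_measure p \<beta> \<epsilon> \<Lambda>)"
    unfolding pinning_measure_def
    by (rule nn_integral_scale_measure)
      (use assms(2) in \<open>simp add: boltzmann_measure_def reference_measure_eq_zero_extension cong: measurable_cong_sets\<close>)
  also have "\<dots> = ennreal (1 / (\<epsilon> ^ card \<Lambda> * (\<Sum>A\<in>Pow \<Lambda>. pinning_weight A))) * ennreal (\<epsilon> ^ card \<Lambda> * (\<Sum>A\<in>Pow \<Lambda>. pinning_weight A * mean F A))"
    unfolding Z nn_integral_boltzmann_measure[OF assms]
    using W eps_pos by (simp add: divide_ennreal flip: ennreal_1)
  also have "\<dots> = ennreal (1 / (\<epsilon> ^ card \<Lambda> * (\<Sum>A\<in>Pow \<Lambda>. pinning_weight A)) * (\<epsilon> ^ card \<Lambda> * (\<Sum>A\<in>Pow \<Lambda>. pinning_weight A * mean F A)))"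
    using W eps_pos pinning_weight_pos[OF fin] mean_le_1(3)[OF fin assms(3)]
    by (intro ennreal_mult[symmetric] mult_nonneg_nonneg divide_nonneg_nonneg sum_nonneg) (auto simp: less_imp_le)
  finally show ?thesis
    using eps_pos by (simp add: weighted_average_def)
qed

lemma prob_space_pinning_measure:
  assumes "finite \<Lambda>"
  shows "prob_space (pinning_measure p \<beta> \<epsilon> \<Lambda>)"
proof
  have fin: "finite A" if "A \<in> Pow \<Lambda>" for A
    using that assms finite_subset by auto
  have "mean (\<lambda>_. 1) A = 1" if "A \<in> Pow \<Lambda>" for A
    using prob_space.emeasure_space_1[OF prob_space_pinned_gaussian[OF fin[OF that]]] by (simp add: mean_def)
  moreover have "0 < (\<Sum>A\<in>Pow \<Lambda>. pinning_weight A)"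
    using assms pinning_weight_pos fin by (intro sum_pos) auto
  ultimately have "weighted_average pinning_weight (mean (\<lambda>_. 1)) \<Lambda> = 1"
    by (simp add: weighted_average_def)
  then show "emeasure (pinning_measure p \<beta> \<epsilon> \<Lambda>) (space (pinning_measure p \<beta> \<epsilon> \<Lambda>)) = 1"
    using nn_integral_pinning_measure[OF assms, of "\<lambda>_. 1"] by simp
qed

lemma measure_pinning_measure:
  assumes "finite \<Lambda>" "B \<in> sets config_space"
  shows "measure (pinning_measure p \<beta> \<epsilon> \<Lambda>) B = weighted_average pinning_weight (mean (indicator B)) \<Lambda>"
proof -
  have fin: "finite A" if "A \<in> Pow \<Lambda>" for A
    using that assms finite_subset by auto
  have "emeasure (pinning_measure p \<beta> \<epsilon> \<Lambda>) B = ennreal (weighted_average pinning_weight (mean (indicator B)) \<Lambda>)"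
    using nn_integral_pinning_measure[OF assms(1), of "indicator B"] assms(2) by (simp add: indicator_le_1_ennreal)
  moreover have "0 \<le> weighted_average pinning_weight (mean (indicator B)) \<Lambda>"
    using pinning_weight_pos[OF fin] unfolding weighted_average_def
    by (intro divide_nonneg_nonneg sum_nonneg mult_nonneg_nonneg) (auto simp: mean_def less_imp_le)
  ultimately show ?thesis
    by (simp add: measure_def)
qed

definition mean_corrector :: "(int ^ 'd) set \<Rightarrow> (int ^ 'd) set \<Rightarrow> real" where
  "mean_corrector S \<Lambda> = weighted_average pinning_weight (corrector S) \<Lambda>"

text \<open>The mean plus the corrector is increasing in the unpinned set, so by FKG its average
  grows with the volume; the claim is a rearrangement of this.\<close>

lemma pinning_measure_upper_variation:
  assumes "finite \<Lambda>'" "\<Lambda> \<subseteq> \<Lambda>'" "finite S" "B \<in> sets config_space" "depends_on S (\<lambda>\<phi>. \<phi> \<in> B)"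
  shows "measure (pinning_measure p \<beta> \<epsilon> \<Lambda>) B - measure (pinning_measure p \<beta> \<epsilon> \<Lambda>') B
    \<le> mean_corrector S \<Lambda>' - mean_corrector S \<Lambda>"
proof -
  have "depends_on S (indicator B :: _ \<Rightarrow> ennreal)"
    using assms(5) by (auto simp: depends_on_def indicator_def)
  then have "mono_on (Pow \<Lambda>') (\<lambda>A. mean (indicator B) A + corrector S A)"
    using assms by (intro corrected_mean_mono) (auto simp: indicator_le_1_ennreal)
  then have "weighted_average pinning_weight (\<lambda>A. mean (indicator B) A + corrector S A) \<Lambda>
      \<le> weighted_average pinning_weight (\<lambda>A. mean (indicator B) A + corrector S A) \<Lambda>'"
    using assms increasing_ratios_pinning_weight by (intro weighted_average_mono) auto
  moreover have "finite \<Lambda>"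
    using assms(2,1) by (rule finite_subset)
  ultimately show ?thesis
    using assms(1,4) by (simp add: weighted_average_add mean_corrector_def measure_pinning_measure)
qed

text \<open>The complement of \<open>B\<close> depends on the same sites and has the same corrector;
  applying the one-sided bound to it gives the opposite sign.\<close>

lemma pinning_measure_variation:
  assumes "finite \<Lambda>'" "\<Lambda> \<subseteq> \<Lambda>'" "finite S" "B \<in> sets config_space" "depends_on S (\<lambda>\<phi>. \<phi> \<in> B)"
  shows "\<bar>measure (pinning_measure p \<beta> \<epsilon> \<Lambda>) B - measure (pinning_measure p \<beta> \<epsilon> \<Lambda>') B\<bar>
    \<le> mean_corrector S \<Lambda>' - mean_corrector S \<Lambda>"
proof -
  have "finite \<Lambda>"
    using assms(2,1) by (rule finite_subset)
  then interpret P: prob_space "pinning_measure p \<beta> \<epsilon> \<Lambda>"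
    by (rule prob_space_pinning_measure)
  interpret P': prob_space "pinning_measure p \<beta> \<epsilon> \<Lambda>'"
    using assms(1) by (rule prob_space_pinning_measure)
  have "UNIV - B \<in> sets config_space"
    using sets.compl_sets[OF assms(4)] by simp
  moreover have "depends_on S (\<lambda>\<phi>. \<phi> \<in> UNIV - B)"
    using assms(5) by (simp add: depends_on_def)
  ultimately have "measure (pinning_measure p \<beta> \<epsilon> \<Lambda>) (UNIV - B) - measure (pinning_measure p \<beta> \<epsilon> \<Lambda>') (UNIV - B)
      \<le> mean_corrector S \<Lambda>' - mean_corrector S \<Lambda>"
    using assms by (intro pinning_measure_upper_variation)
  then show ?thesis
    using pinning_measure_upper_variation[OF assms] P.prob_compl[of B] P'.prob_compl[of B] assms(4) by simp
qed

lemma mean_corrector_bounded: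
  assumes "finite \<Lambda>" "finite S"
  shows "mean_corrector S \<Lambda> \<le> \<beta> * (real (card S) * green_constant) + real (card S)"
proof -
  have fin: "finite A" if "A \<subseteq> \<Lambda>" for A
    using that assms(1) finite_subset by auto
  have "mean_corrector S \<Lambda> = \<beta> * (\<Sum>y\<in>S. weighted_average pinning_weight (\<lambda>A. green A y) \<Lambda>)
      + weighted_average pinning_weight (\<lambda>A. real (card (A \<inter> S))) \<Lambda>"
    unfolding mean_corrector_def corrector_def[abs_def]
    by (simp add: weighted_average_add weighted_average_const_mult weighted_average_sum)
  also have "\<dots> \<le> \<beta> * (\<Sum>y\<in>S. green_constant) + real (card S)"
    using assms beta_pos pinning_weight_pos[OF fin]
    by (intro add_mono mult_left_mono sum_mono average_green_bounded weighted_average_le)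
      (auto intro: card_mono)
  finally show ?thesis
    by simp
qed

lemma nn_integral_pinning_measure_shift:
  assumes "finite \<Lambda>" and [measurable]: "F \<in> borel_measurable config_space"
  shows "(\<integral>\<^sup>+\<phi>. F (\<lambda>x. \<phi> (x + a)) \<partial>pinning_measure p \<beta> \<epsilon> \<Lambda>) = (\<integral>\<^sup>+\<phi>. F \<phi> \<partial>pinning_measure p \<beta> \<epsilon> ((\<lambda>x. x - a) ` \<Lambda>))"
proof -
  have shift [measurable]: "(\<lambda>\<phi> x. \<phi> (x + a)) \<in> measurable config_space (config_space :: (int ^ 'd \<Rightarrow> real) measure)"
    by (rule measurable_config_spaceI) simp
  have boltz: "(\<integral>\<^sup>+\<phi>. G (\<lambda>x. \<phi> (x + a)) \<partial>boltzmann_measure p \<beta> \<epsilon> \<Lambda>)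
      = (\<integral>\<^sup>+\<phi>. G \<phi> \<partial>boltzmann_measure p \<beta> \<epsilon> ((\<lambda>x. x - a) ` \<Lambda>))"
    if [measurable]: "G \<in> borel_measurable config_space" for G
  proof -
    have dens: "(\<integral>\<^sup>+\<phi>. H \<phi> \<partial>boltzmann_measure p \<beta> \<epsilon> U) = (\<integral>\<^sup>+\<phi>. weight \<phi> * H \<phi> \<partial>zero_extension (site_measure \<epsilon>) U)"
      if "H \<in> borel_measurable config_space" for H U
      unfolding boltzmann_measure_def weight_def reference_measure_eq_zero_extension
      using that by (subst nn_integral_density) auto
    have "weight (\<lambda>x. \<phi> (x + a)) = weight \<phi>" for \<phi>
      by (simp add: weight_def energy_shift)
    then have "(\<integral>\<^sup>+\<phi>. G (\<lambda>x. \<phi> (x + a)) \<partial>boltzmann_measure p \<beta> \<epsilon> \<Lambda>)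
        = (\<integral>\<^sup>+\<phi>. weight (\<lambda>x. \<phi> (x + a)) * G (\<lambda>x. \<phi> (x + a)) \<partial>zero_extension (site_measure \<epsilon>) \<Lambda>)"
      by (simp add: dens)
    also have "\<dots> = (\<integral>\<^sup>+\<phi>. weight \<phi> * G \<phi> \<partial>zero_extension (site_measure \<epsilon>) ((\<lambda>x. x - a) ` \<Lambda>))"
      by (rule nn_integral_zero_extension_shift[OF site.site_law_axioms assms(1)]) simp
    finally show ?thesis
      by (simp add: dens)
  qed
  have "partition_function p \<beta> \<epsilon> \<Lambda> = partition_function p \<beta> \<epsilon> ((\<lambda>x. x - a) ` \<Lambda>)"
    using boltz[of "\<lambda>_. 1"]
    by (simp add: partition_function_def boltzmann_measure_def reference_measure_eq_zero_extension)
  then show ?thesis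
    unfolding pinning_measure_def using boltz[of F]
    by (subst (1 2) nn_integral_scale_measure)
      (auto simp: boltzmann_measure_def reference_measure_eq_zero_extension)
qed

lemma distr_pinning_measure_shift:
  assumes "finite \<Lambda>"
  shows "distr (pinning_measure p \<beta> \<epsilon> \<Lambda>) config_space (\<lambda>\<phi> x. \<phi> (x + a))
    = pinning_measure p \<beta> \<epsilon> ((\<lambda>x. x - a) ` \<Lambda>)"
proof (rule measure_eqI)
  have shift: "(\<lambda>\<phi> x. \<phi> (x + a)) \<in> measurable (pinning_measure p \<beta> \<epsilon> \<Lambda>) (config_space :: (int ^ 'd \<Rightarrow> real) measure)"
    by (rule measurable_config_spaceI) measurable
  fix B assume "B \<in> sets (distr (pinning_measure p \<beta> \<epsilon> \<Lambda>) config_space (\<lambda>\<phi> x. \<phi> (x + a)))"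
  then have B: "B \<in> sets config_space"
    by simp
  have "emeasure (distr (pinning_measure p \<beta> \<epsilon> \<Lambda>) config_space (\<lambda>\<phi> x. \<phi> (x + a))) B
      = (\<integral>\<^sup>+\<phi>. indicator B \<phi> \<partial>distr (pinning_measure p \<beta> \<epsilon> \<Lambda>) config_space (\<lambda>\<phi> x. \<phi> (x + a)))"
    using B by simp
  also have "\<dots> = (\<integral>\<^sup>+\<phi>. indicator B (\<lambda>x. \<phi> (x + a)) \<partial>pinning_measure p \<beta> \<epsilon> \<Lambda>)"
    using B by (intro nn_integral_distr[OF shift]) simp
  also have "\<dots> = (\<integral>\<^sup>+\<phi>. indicator B \<phi> \<partial>pinning_measure p \<beta> \<epsilon> ((\<lambda>x. x - a) ` \<Lambda>))"
    using B by (intro nn_integral_pinning_measure_shift[OF assms]) simp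
  also have "\<dots> = emeasure (pinning_measure p \<beta> \<epsilon> ((\<lambda>x. x - a) ` \<Lambda>)) B"
    using B by simp
  finally show "emeasure (distr (pinning_measure p \<beta> \<epsilon> \<Lambda>) config_space (\<lambda>\<phi> x. \<phi> (x + a))) B
    = emeasure (pinning_measure p \<beta> \<epsilon> ((\<lambda>x. x - a) ` \<Lambda>)) B" .
qed simp

end

section \<open>Infinite volume limits\<close>

lemma mono_bounded_tendsto_finite_subsets:
  fixes g :: "'a set \<Rightarrow> real"
  assumes "\<And>A B. finite B \<Longrightarrow> A \<subseteq> B \<Longrightarrow> g A \<le> g B" "\<And>A. finite A \<Longrightarrow> g A \<le> c"
  shows "\<exists>l. (g \<longlongrightarrow> l) (finite_subsets_at_top UNIV) \<and> (\<forall>A. finite A \<longrightarrow> g A \<le> l)"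
proof (intro exI conjI allI impI)
  let ?l = "SUP A\<in>{A. finite A}. g A"
  have bdd: "bdd_above (g ` {A. finite A})"
    using assms(2) by (intro bdd_aboveI2[of _ _ c]) auto
  show upper: "g A \<le> ?l" if "finite A" for A
    using that bdd by (intro cSUP_upper) auto
  show "(g \<longlongrightarrow> ?l) (finite_subsets_at_top UNIV)"
  proof (rule order_tendstoI)
    fix a assume "a < ?l"
    then obtain A where A: "finite A" "a < g A"
      using less_cSUP_iff[OF _ bdd, of a] by auto
    show "eventually (\<lambda>B. a < g B) (finite_subsets_at_top UNIV)"
      unfolding eventually_finite_subsets_at_top
      using A assms(1) by (meson less_le_trans subset_UNIV)
  next
    fix a assume "?l < a"
    then show "eventually (\<lambda>B. g B < a) (finite_subsets_at_top UNIV)"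
      unfolding eventually_finite_subsets_at_top
      using upper by (meson finite.emptyI le_less_trans subset_UNIV)
  qed
qed

text \<open>The approximating step function is \<open>\<lfloor>n f\<rfloor> / n\<close>, written as an average of level-set indicators.\<close>

lemma step_function_bounds:
  fixes t :: real
  assumes "0 \<le> t" "t \<le> 1" "0 < n"
  shows "(\<Sum>k=1..n. (1 / real n) * (if real k / real n \<le> t then 1 else 0)) \<le> t"
    and "t \<le> (\<Sum>k=1..n. (1 / real n) * (if real k / real n \<le> t then 1 else 0)) + 1 / real n"
proof -
  define m where "m = nat \<lfloor>real n * t\<rfloor>"
  have m: "real m \<le> real n * t" "real n * t < real m + 1"
    using assms by (auto simp: m_def)
  have "real m \<le> real n"
    using m(1) mult_left_le[of t "real n"] assms by linarith
  then have mn: "m \<le> n" by simp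
  have "{k \<in> {1..n}. real k / real n \<le> t} = {1..m}"
  proof (intro set_eqI iffI)
    fix k assume "k \<in> {k \<in> {1..n}. real k / real n \<le> t}"
    then have "1 \<le> k" "real k \<le> real n * t"
      using assms by (auto simp: field_simps)
    then have "real k < real m + 1"
      using m(2) by linarith
    then show "k \<in> {1..m}"
      using \<open>1 \<le> k\<close> by simp
  next
    fix k assume k: "k \<in> {1..m}"
    then have "real k \<le> real n * t"
      using m(1) by (meson atLeastAtMost_iff le_trans of_nat_le_iff order_trans)
    then show "k \<in> {k \<in> {1..n}. real k / real n \<le> t}"
      using k mn assms by (auto simp: field_simps)
  qed
  then have "(\<Sum>k\<in>{1..n}. if real k / real n \<le> t then 1 else 0) = real m"
    using sum.inter_filter[of "{1..n}" "\<lambda>_. 1 :: real" "\<lambda>k. real k / real n \<le> t"] by simp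
  then have "(\<Sum>k=1..n. (1 / real n) * (if real k / real n \<le> t then 1 else 0)) = real m / real n"
    unfolding sum_distrib_left[symmetric] by simp
  moreover have "real m / real n \<le> t" "t \<le> real m / real n + 1 / real n"
    using m assms by (auto simp: field_simps)
  ultimately show "(\<Sum>k=1..n. (1 / real n) * (if real k / real n \<le> t then 1 else 0)) \<le> t"
    and "t \<le> (\<Sum>k=1..n. (1 / real n) * (if real k / real n \<le> t then 1 else 0)) + 1 / real n"
    by simp_all
qed

lemma step_function_integral:
  fixes f :: "'a \<Rightarrow> real"
  assumes "prob_space M" and [measurable]: "f \<in> borel_measurable M"
    and "\<And>x. 0 \<le> f x" "\<And>x. f x \<le> 1" "0 < n"
  shows "\<bar>(\<integral>x. f x \<partial>M) - (\<Sum>k=1..n. (1 / real n) * measure M {x \<in> space M. real k / real n \<le> f x})\<bar> \<le> 1 / real n"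
proof -
  interpret prob_space M by fact
  let ?s = "\<lambda>x. \<Sum>k=1..n. (1 / real n) * indicator {x \<in> space M. real k / real n \<le> f x} x"
  have f: "integrable M f"
    using assms by (intro integrable_const_bound[where B = 1]) auto
  have s: "integrable M ?s"
    by (intro Bochner_Integration.integrable_sum integrable_mult_right integrable_real_indicator)
      (auto simp: emeasure_eq_measure)
  have s_eq: "?s x = (\<Sum>k=1..n. (1 / real n) * (if real k / real n \<le> f x then 1 else 0))" if "x \<in> space M" for x
    using that by (intro sum.cong) (auto simp: indicator_def)
  have eq: "(\<integral>x. ?s x \<partial>M) = (\<Sum>k=1..n. (1 / real n) * measure M {x \<in> space M. real k / real n \<le> f x})"
    by (subst Bochner_Integration.integral_sum) (auto intro!: integrable_mult_right integrable_real_indicator simp: emeasure_eq_measure)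
  have "(\<integral>x. ?s x \<partial>M) \<le> (\<integral>x. f x \<partial>M)"
  proof (rule integral_mono[OF s f])
    fix x assume "x \<in> space M"
    show "?s x \<le> f x"
      unfolding s_eq[OF \<open>x \<in> space M\<close>] by (rule step_function_bounds(1)[OF assms(3-5)])
  qed
  moreover have "(\<integral>x. f x \<partial>M) \<le> (\<integral>x. ?s x + 1 / real n \<partial>M)"
  proof (rule integral_mono[OF f Bochner_Integration.integrable_add[OF s integrable_const]])
    fix x assume "x \<in> space M"
    show "f x \<le> ?s x + 1 / real n"
      unfolding s_eq[OF \<open>x \<in> space M\<close>] by (rule step_function_bounds(2)[OF assms(3-5)])
  qed
  moreover have "(\<integral>x. ?s x + 1 / real n \<partial>M) = (\<integral>x. ?s x \<partial>M) + 1 / real n"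
    using prob_space by (subst Bochner_Integration.integral_add[OF s]) auto
  ultimately show ?thesis
    unfolding eq[symmetric] by simp
qed

text \<open>The step functions approximate \<open>f\<close> within \<open>1 / n\<close> under every
  probability measure, so only finitely many level sets have to converge for a given
  accuracy.\<close>

lemma tendsto_integral_of_level_sets:
  fixes f :: "'a \<Rightarrow> real"
  assumes "prob_space \<nu>" "eventually (\<lambda>i. prob_space (\<mu> i)) F" "\<And>i. sets (\<mu> i) = sets \<nu>"
    and f: "f \<in> borel_measurable \<nu>" "\<And>x. 0 \<le> f x" "\<And>x. f x \<le> 1"
    and conv: "\<And>t. ((\<lambda>i. measure (\<mu> i) {x \<in> space \<nu>. t \<le> f x}) \<longlongrightarrow> measure \<nu> {x \<in> space \<nu>. t \<le> f x}) F"
  shows "((\<lambda>i. \<integral>x. f x \<partial>\<mu> i) \<longlongrightarrow> (\<integral>x. f x \<partial>\<nu>)) F"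
proof (rule tendstoI)
  fix r :: real assume r: "0 < r"
  obtain n :: nat where n: "3 / r < real n"
    using reals_Archimedean2 by blast
  moreover have "0 < 3 / r"
    using r by simp
  ultimately have n0: "0 < n"
    by linarith
  then have nr: "1 / real n < r / 3"
    using n r by (simp add: field_simps)
  let ?s = "\<lambda>M. \<Sum>k=1..n. (1 / real n) * measure M {x \<in> space \<nu>. real k / real n \<le> f x}"
  have "((\<lambda>i. ?s (\<mu> i)) \<longlongrightarrow> ?s \<nu>) F"
    by (intro tendsto_sum tendsto_mult tendsto_const conv)
  then have "eventually (\<lambda>i. dist (?s (\<mu> i)) (?s \<nu>) < r / 3) F"
    using r by (intro tendstoD) auto
  then show "eventually (\<lambda>i. dist (\<integral>x. f x \<partial>\<mu> i) (\<integral>x. f x \<partial>\<nu>) < r) F"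
    using assms(2)
  proof eventually_elim
    case (elim i)
    have "f \<in> borel_measurable (\<mu> i)"
      using f(1) assms(3) measurable_cong_sets by blast
    then have "\<bar>(\<integral>x. f x \<partial>\<mu> i) - ?s (\<mu> i)\<bar> \<le> 1 / real n"
      using step_function_integral[OF elim(2) _ f(2,3) n0] sets_eq_imp_space_eq[OF assms(3)[of i]] by simp
    moreover have "\<bar>(\<integral>x. f x \<partial>\<nu>) - ?s \<nu>\<bar> \<le> 1 / real n"
      by (rule step_function_integral[OF assms(1) f n0])
    ultimately show ?case
      using elim(1) nr unfolding dist_real_def by linarith
  qed
qed

text \<open>The increments of \<open>V S\<close> dominate the change of all events on
  \<open>S\<close> simultaneously. Boundedness of \<open>V S\<close> gives convergence, and
  uniformity over events gives countable additivity of the limit.\<close>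

locale convergent_local_laws =
  fixes \<mu> :: "(int ^ 'd) set \<Rightarrow> (int ^ 'd \<Rightarrow> real) measure"
    and V :: "(int ^ 'd) set \<Rightarrow> (int ^ 'd) set \<Rightarrow> real"
    and c :: "(int ^ 'd) set \<Rightarrow> real"
  assumes prob: "finite \<Lambda> \<Longrightarrow> prob_space (\<mu> \<Lambda>)"
    and sets_law [measurable_cong, simp]: "sets (\<mu> \<Lambda>) = sets config_space"
    and variation: "finite \<Lambda>' \<Longrightarrow> \<Lambda> \<subseteq> \<Lambda>' \<Longrightarrow> finite S \<Longrightarrow> B \<in> sets config_space \<Longrightarrow> depends_on S (\<lambda>\<phi>. \<phi> \<in> B) \<Longrightarrow>
      \<bar>measure (\<mu> \<Lambda>) B - measure (\<mu> \<Lambda>') B\<bar> \<le> V S \<Lambda>' - V S \<Lambda>"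
    and bounded: "finite \<Lambda> \<Longrightarrow> finite S \<Longrightarrow> V S \<Lambda> \<le> c S"
begin

lemma space_law [simp]: "space (\<mu> \<Lambda>) = UNIV"
  using sets_eq_imp_space_eq[OF sets_law] by simp

lemma V_mono:
  assumes "finite \<Lambda>'" "\<Lambda> \<subseteq> \<Lambda>'" "finite S"
  shows "V S \<Lambda> \<le> V S \<Lambda>'"
  \<comment> \<open>For the empty event the left side of the variation bound is 0.\<close>
  using variation[OF assms, of "{}"] by (simp add: depends_on_def)

definition sup_V :: "(int ^ 'd) set \<Rightarrow> real" where
  "sup_V S = (SOME v. (V S \<longlongrightarrow> v) (finite_subsets_at_top UNIV))"

lemma V_tendsto:
  assumes "finite S"
  shows "(V S \<longlongrightarrow> sup_V S) (finite_subsets_at_top UNIV)"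
proof -
  have "\<exists>v. (V S \<longlongrightarrow> v) (finite_subsets_at_top UNIV) \<and> (\<forall>A. finite A \<longrightarrow> V S A \<le> v)"
    using V_mono[OF _ _ assms] bounded[OF _ assms] by (rule mono_bounded_tendsto_finite_subsets)
  then show ?thesis
    unfolding sup_V_def by (metis (no_types, lifting) someI_ex)
qed

text \<open>\<open>Lim\<close> is meaningful only on local events, where
  \<open>limit_law_tendsto\<close> supplies the convergence.\<close>

definition limit_law :: "(int ^ 'd \<Rightarrow> real) set \<Rightarrow> real" where
  "limit_law B = Lim (finite_subsets_at_top UNIV) (\<lambda>\<Lambda>. measure (\<mu> \<Lambda>) B)"

text \<open>The probability of \<open>B\<close> plus \<open>V S\<close> is increasing in the volume
  and bounded, and \<open>V S\<close> alone converges too; subtract the limits.\<close>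

lemma limit_law_tendsto:
  assumes "finite S" "B \<in> sets config_space" "depends_on S (\<lambda>\<phi>. \<phi> \<in> B)"
  shows "((\<lambda>\<Lambda>. measure (\<mu> \<Lambda>) B) \<longlongrightarrow> limit_law B) (finite_subsets_at_top UNIV)"
proof -
  have "\<exists>l. ((\<lambda>\<Lambda>. measure (\<mu> \<Lambda>) B + V S \<Lambda>) \<longlongrightarrow> l) (finite_subsets_at_top UNIV) \<and>
      (\<forall>A. finite A \<longrightarrow> measure (\<mu> A) B + V S A \<le> l)"
  proof (rule mono_bounded_tendsto_finite_subsets)
    fix A A' :: "(int ^ 'd) set" assume "finite A'" "A \<subseteq> A'"
    then show "measure (\<mu> A) B + V S A \<le> measure (\<mu> A') B + V S A'"
      using variation[of A' A S B] assms by simp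
  next
    fix A :: "(int ^ 'd) set" assume "finite A"
    then show "measure (\<mu> A) B + V S A \<le> 1 + c S"
      using prob_space.prob_le_1[OF prob] bounded assms(1) by (intro add_mono) auto
  qed
  then obtain l where "((\<lambda>\<Lambda>. measure (\<mu> \<Lambda>) B + V S \<Lambda>) \<longlongrightarrow> l) (finite_subsets_at_top UNIV)"
    by blast
  from tendsto_diff[OF this V_tendsto[OF assms(1)]]
  have "((\<lambda>\<Lambda>. measure (\<mu> \<Lambda>) B) \<longlongrightarrow> l - sup_V S) (finite_subsets_at_top UNIV)"
    by simp
  then show ?thesis
    unfolding limit_law_def using tendsto_Lim[OF finite_subsets_at_top_neq_bot] by metis
qed

lemma eventually_finite: "eventually finite (finite_subsets_at_top UNIV)"
  by (rule eventually_finite_subsets_at_top_weakI)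

lemma limit_law_variation:
  assumes "finite \<Lambda>" "finite S" "B \<in> sets config_space" "depends_on S (\<lambda>\<phi>. \<phi> \<in> B)"
  shows "\<bar>measure (\<mu> \<Lambda>) B - limit_law B\<bar> \<le> sup_V S - V S \<Lambda>"
proof (rule tendsto_le[OF finite_subsets_at_top_neq_bot])
  show "((\<lambda>\<Lambda>'. V S \<Lambda>' - V S \<Lambda>) \<longlongrightarrow> sup_V S - V S \<Lambda>) (finite_subsets_at_top UNIV)"
    by (intro tendsto_intros V_tendsto assms)
  show "((\<lambda>\<Lambda>'. \<bar>measure (\<mu> \<Lambda>) B - measure (\<mu> \<Lambda>') B\<bar>) \<longlongrightarrow> \<bar>measure (\<mu> \<Lambda>) B - limit_law B\<bar>) (finite_subsets_at_top UNIV)"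
    by (intro tendsto_intros limit_law_tendsto[OF assms(2-4)])
  show "eventually (\<lambda>\<Lambda>'. \<bar>measure (\<mu> \<Lambda>) B - measure (\<mu> \<Lambda>') B\<bar> \<le> V S \<Lambda>' - V S \<Lambda>) (finite_subsets_at_top UNIV)"
    unfolding eventually_finite_subsets_at_top
    using variation assms by (intro exI[of _ \<Lambda>]) auto
qed

abbreviation cylinder :: "(int ^ 'd) set \<Rightarrow> (int ^ 'd \<Rightarrow> real) set \<Rightarrow> (int ^ 'd \<Rightarrow> real) set" where
  "cylinder J B \<equiv> prod_emb UNIV (\<lambda>_. borel) J B"

lemma cylinder_eq: "cylinder J B = {\<phi>. restrict \<phi> J \<in> B}"
  by (auto simp: prod_emb_def)

lemma cylinder_sets: "B \<in> sets (PiM J (\<lambda>_. borel)) \<Longrightarrow> cylinder J B \<in> sets config_space"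
  unfolding config_space_def by (rule measurable_prod_emb) auto

lemma cylinder_depends: "depends_on J (\<lambda>\<phi>. \<phi> \<in> cylinder J B)"
proof -
  have "restrict \<phi> J = restrict \<psi> J" if "\<forall>x\<in>J. \<phi> x = \<psi> x" for \<phi> \<psi> :: "int ^ 'd \<Rightarrow> real"
    using that by (intro restrict_ext) auto
  then show ?thesis
    unfolding depends_on_def cylinder_eq by (metis mem_Collect_eq)
qed

lemma cylinder_tendsto:
  "finite J \<Longrightarrow> B \<in> sets (PiM J (\<lambda>_. borel)) \<Longrightarrow>
    ((\<lambda>\<Lambda>. measure (\<mu> \<Lambda>) (cylinder J B)) \<longlongrightarrow> limit_law (cylinder J B)) (finite_subsets_at_top UNIV)"
  by (rule limit_law_tendsto[OF _ cylinder_sets cylinder_depends])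

lemma limit_law_nonneg:
  assumes "finite J" "B \<in> sets (PiM J (\<lambda>_. borel))"
  shows "0 \<le> limit_law (cylinder J B)"
  by (rule tendsto_lowerbound[OF cylinder_tendsto[OF assms]]) auto

lemma limit_law_union:
  assumes "finite J" "A \<in> sets (PiM J (\<lambda>_. borel))" "B \<in> sets (PiM J (\<lambda>_. borel))" "A \<inter> B = {}"
  shows "limit_law (cylinder J (A \<union> B)) = limit_law (cylinder J A) + limit_law (cylinder J B)"
proof (rule tendsto_unique[OF finite_subsets_at_top_neq_bot])
  show "((\<lambda>\<Lambda>. measure (\<mu> \<Lambda>) (cylinder J (A \<union> B))) \<longlongrightarrow> limit_law (cylinder J (A \<union> B))) (finite_subsets_at_top UNIV)"
    using assms by (intro cylinder_tendsto) auto
  have "((\<lambda>\<Lambda>. measure (\<mu> \<Lambda>) (cylinder J A) + measure (\<mu> \<Lambda>) (cylinder J B)) \<longlongrightarrow>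
      limit_law (cylinder J A) + limit_law (cylinder J B)) (finite_subsets_at_top UNIV)"
    using assms by (intro tendsto_add cylinder_tendsto)
  moreover have "eventually (\<lambda>\<Lambda>. measure (\<mu> \<Lambda>) (cylinder J A) + measure (\<mu> \<Lambda>) (cylinder J B) =
      measure (\<mu> \<Lambda>) (cylinder J (A \<union> B))) (finite_subsets_at_top UNIV)"
    using eventually_finite
  proof eventually_elim
    case (elim \<Lambda>)
    interpret prob_space "\<mu> \<Lambda>"
      by (rule prob[OF elim])
    have "cylinder J (A \<union> B) = cylinder J A \<union> cylinder J B" "cylinder J A \<inter> cylinder J B = {}"
      using assms(4) by (auto simp: cylinder_eq)
    then show ?case
      using cylinder_sets[OF assms(2)] cylinder_sets[OF assms(3)] finite_measure_Union by simp
  qed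
  ultimately show "((\<lambda>\<Lambda>. measure (\<mu> \<Lambda>) (cylinder J (A \<union> B))) \<longlongrightarrow>
      limit_law (cylinder J A) + limit_law (cylinder J B)) (finite_subsets_at_top UNIV)"
    by (rule Lim_transform_eventually)
qed

lemma limit_law_space: "finite J \<Longrightarrow> limit_law (cylinder J (space (PiM J (\<lambda>_. borel)))) = 1"
proof (rule tendsto_unique[OF finite_subsets_at_top_neq_bot])
  assume J: "finite J"
  show "((\<lambda>\<Lambda>. measure (\<mu> \<Lambda>) (cylinder J (space (PiM J (\<lambda>_. borel))))) \<longlongrightarrow>
      limit_law (cylinder J (space (PiM J (\<lambda>_. borel))))) (finite_subsets_at_top UNIV)"
    using J by (intro cylinder_tendsto) auto
  have univ: "cylinder J (space (PiM J (\<lambda>_. borel))) = UNIV"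
    by (auto simp: cylinder_eq space_PiM)
  have "eventually (\<lambda>\<Lambda>. 1 = measure (\<mu> \<Lambda>) (cylinder J (space (PiM J (\<lambda>_. borel))))) (finite_subsets_at_top UNIV)"
    using eventually_finite
  proof eventually_elim
    case (elim \<Lambda>)
    then show ?case
      using prob_space.prob_space[OF prob[OF elim]] by (simp add: univ)
  qed
  then show "((\<lambda>\<Lambda>. measure (\<mu> \<Lambda>) (cylinder J (space (PiM J (\<lambda>_. borel))))) \<longlongrightarrow> 1) (finite_subsets_at_top UNIV)"
    by (rule Lim_transform_eventually[OF tendsto_const])
qed

text \<open>The convergence on cylinders over \<open>J\<close> is uniform, so continuity at the empty set is inherited from
  the finite volume laws.\<close>

lemma limit_law_empty_continuous:
  assumes "finite J" "range A \<subseteq> sets (PiM J (\<lambda>_. borel))" "decseq A" "(\<Inter>i. A i) = {}"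
  shows "(\<lambda>i. limit_law (cylinder J (A i))) \<longlonglongrightarrow> 0"
proof (rule LIMSEQ_I)
  fix r :: real assume "0 < r"
  then have "eventually (\<lambda>\<Lambda>. dist (V J \<Lambda>) (sup_V J) < r / 2) (finite_subsets_at_top UNIV)"
    using V_tendsto[OF assms(1)] by (intro tendstoD) auto
  then obtain \<Lambda> where \<Lambda>: "finite \<Lambda>" "\<bar>V J \<Lambda> - sup_V J\<bar> < r / 2"
    unfolding eventually_finite_subsets_at_top dist_real_def by blast
  interpret prob_space "\<mu> \<Lambda>"
    by (rule prob[OF \<Lambda>(1)])
  have A: "A i \<in> sets (PiM J (\<lambda>_. borel))" for i
    using assms(2) by auto
  have "(\<lambda>i. measure (\<mu> \<Lambda>) (cylinder J (A i))) \<longlonglongrightarrow> measure (\<mu> \<Lambda>) (\<Inter>i. cylinder J (A i))"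
  proof (rule finite_Lim_measure_decseq)
    show "range (\<lambda>i. cylinder J (A i)) \<subseteq> sets (\<mu> \<Lambda>)"
      using cylinder_sets[OF A] by auto
    show "decseq (\<lambda>i. cylinder J (A i))"
      using assms(3) by (auto simp: decseq_def cylinder_eq)
  qed
  also have "(\<Inter>i. cylinder J (A i)) = {}"
    using assms(4) by (auto simp: cylinder_eq)
  finally have "(\<lambda>i. measure (\<mu> \<Lambda>) (cylinder J (A i))) \<longlonglongrightarrow> 0"
    by simp
  then obtain N where N: "\<And>i. N \<le> i \<Longrightarrow> \<bar>measure (\<mu> \<Lambda>) (cylinder J (A i))\<bar> < r / 2"
    using LIMSEQ_D[of _ 0 "r / 2"] \<open>0 < r\<close> by fastforce
  have "norm (limit_law (cylinder J (A i)) - 0) < r" if "N \<le> i" for i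
    using N[OF that] limit_law_variation[OF \<Lambda>(1) assms(1) cylinder_sets[OF A] cylinder_depends, of i] \<Lambda>(2)
    unfolding real_norm_def by linarith
  then show "\<exists>N. \<forall>i\<ge>N. norm (limit_law (cylinder J (A i)) - 0) < r"
    by blast
qed

definition marginal :: "(int ^ 'd) set \<Rightarrow> (int ^ 'd \<Rightarrow> real) measure" where
  "marginal J = measure_of (space (PiM J (\<lambda>_. borel))) (sets (PiM J (\<lambda>_. borel)))
     (\<lambda>B. ennreal (limit_law (cylinder J B)))"

lemma sets_marginal [simp]: "sets (marginal J) = sets (PiM J (\<lambda>_. borel))"
  by (simp add: marginal_def)

lemma space_marginal [simp]: "space (marginal J) = space (PiM J (\<lambda>_. borel))"
  by (simp add: marginal_def)

lemma emeasure_marginal: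
  assumes "finite J" "B \<in> sets (PiM J (\<lambda>_. borel))"
  shows "emeasure (marginal J) B = ennreal (limit_law (cylinder J B))"
  unfolding marginal_def
proof (rule emeasure_measure_of_sigma)
  let ?l = "\<lambda>B. ennreal (limit_law (cylinder J B))"
  let ?M = "sets (PiM J (\<lambda>_. borel :: real measure))"
  show "sigma_algebra (space (PiM J (\<lambda>_. borel :: real measure))) ?M"
    by (rule sets.sigma_algebra_axioms)
  \<comment> \<open>Additivity for two empty sets gives \<open>l = l + l\<close>.\<close>
  have empty: "limit_law (cylinder J {}) = 0"
    using limit_law_union[OF assms(1), of "{}" "{}"] by simp
  then show pos: "positive ?M ?l"
    by (simp add: positive_def)
  show "countably_additive ?M ?l"
  proof (rule sets.empty_continuous_imp_countably_additive[OF pos])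
    show "additive ?M ?l"
      unfolding additive_def using limit_law_union[OF assms(1)] limit_law_nonneg[OF assms(1)]
      by (simp add: ennreal_plus)
    fix A :: "nat \<Rightarrow> (int ^ 'd \<Rightarrow> real) set"
    assume "range A \<subseteq> ?M" "decseq A" "(\<Inter>i. A i) = {}"
    from tendsto_ennrealI[OF limit_law_empty_continuous[OF assms(1) this]]
    show "(\<lambda>i. ?l (A i)) \<longlonglongrightarrow> 0"
      by simp
  qed auto
qed (rule assms(2))

text \<open>Consistency is immediate: pulling an event on \<open>J\<close> back to \<open>H\<close>
  does not change the cylinder in the full space, and \<open>limit_law\<close> is a function of that
  cylinder alone.\<close>

lemma polish_projective_marginal: "polish_projective UNIV marginal"
  unfolding polish_projective_def
proof (rule projective_family.intro)
  fix J H :: "(int ^ 'd) set" assume JH: "J \<subseteq> H" "finite H"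
  have J: "finite J"
    using JH by (rule finite_subset)
  have restr: "(\<lambda>\<phi>. restrict \<phi> J) \<in> measurable (marginal H) (PiM J (\<lambda>_. borel))"
    using measurable_restrict_subset[OF JH(1), of "\<lambda>_. borel"] by (simp cong: measurable_cong_sets)
  show "marginal J = distr (marginal H) (PiM J (\<lambda>_. borel)) (\<lambda>\<phi>. restrict \<phi> J)"
  proof (rule measure_eqI)
    fix B assume "B \<in> sets (marginal J)"
    then have B: "B \<in> sets (PiM J (\<lambda>_. borel))"
      by simp
    let ?B = "(\<lambda>\<phi>. restrict \<phi> J) -` B \<inter> space (marginal H)"
    have "?B \<in> sets (PiM H (\<lambda>_. borel))"
      using measurable_sets[OF restr B] by simp
    moreover have "cylinder H ?B = cylinder J B"
      using JH(1) by (auto simp: cylinder_eq space_PiM Int_absorb1)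
    ultimately show "emeasure (marginal J) B = emeasure (distr (marginal H) (PiM J (\<lambda>_. borel)) (\<lambda>\<phi>. restrict \<phi> J)) B"
      using B J JH(2) by (simp add: emeasure_distr[OF restr] emeasure_marginal)
  qed simp
next
  fix J :: "(int ^ 'd) set" assume J: "finite J"
  show "prob_space (marginal J)"
    using J by (intro prob_spaceI) (simp add: emeasure_marginal limit_law_space)
qed

lemma ex_infinite_volume_measure:
  "\<exists>\<nu>. prob_space \<nu> \<and> sets \<nu> = sets config_space \<and>
    (\<forall>J B. finite J \<longrightarrow> B \<in> sets (PiM J (\<lambda>_. borel)) \<longrightarrow> measure \<nu> (cylinder J B) = limit_law (cylinder J B))"
proof -
  interpret polish_projective UNIV marginal
    by (rule polish_projective_marginal)
  have "measure lim (cylinder J B) = limit_law (cylinder J B)"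
    if "finite J" "B \<in> sets (PiM J (\<lambda>_. borel))" for J B
    using that measure_lim_emb[of J B] emeasure_marginal[of J B] limit_law_nonneg[of J B]
    by (simp add: measure_def)
  then show ?thesis
    using P.prob_space_axioms by (intro exI[of _ lim]) (auto simp: config_space_def)
qed

text \<open>The base is the preimage of \<open>C\<close> under extension by 0. Restricting a
  configuration to \<open>S\<close> and extending it by 0 does not affect membership in
  \<open>C\<close>.\<close>

lemma local_event_is_cylinder:
  assumes "C \<in> sets config_space" "depends_on S (\<lambda>\<phi>. \<phi> \<in> C)"
  shows "\<exists>B\<in>sets (PiM S (\<lambda>_. borel)). C = cylinder S B"
proof -
  let ?ext = "\<lambda>\<phi> x. if x \<in> S then \<phi> x else (0 :: real)"
  have ext: "?ext \<in> measurable (PiM S (\<lambda>_. borel)) config_space"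
  proof (rule measurable_config_spaceI)
    fix x show "(\<lambda>\<phi>. ?ext \<phi> x) \<in> borel_measurable (PiM S (\<lambda>_. borel))"
      by (cases "x \<in> S") simp_all
  qed
  have "?ext (restrict \<phi> S) \<in> C \<longleftrightarrow> \<phi> \<in> C" for \<phi>
    by (rule depends_onD[OF assms(2)]) simp
  moreover have "restrict \<phi> S \<in> space (PiM S (\<lambda>_. borel))" for \<phi> :: "int ^ 'd \<Rightarrow> real"
    by (simp add: space_PiM)
  ultimately have "C = cylinder S (?ext -` C \<inter> space (PiM S (\<lambda>_. borel)))"
    unfolding cylinder_eq by (simp only: vimage_eq Int_iff) simp
  then show ?thesis
    using measurable_sets[OF ext assms(1)] by blast
qed

lemma ex_thermodynamic_limit: "\<exists>\<nu>. thermodynamic_limit \<mu> \<nu>"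
proof -
  obtain \<nu> where \<nu>: "prob_space \<nu>" "sets \<nu> = sets config_space"
    "\<And>J B. finite J \<Longrightarrow> B \<in> sets (PiM J (\<lambda>_. borel)) \<Longrightarrow> measure \<nu> (cylinder J B) = limit_law (cylinder J B)"
    using ex_infinite_volume_measure by blast
  have space: "space \<nu> = UNIV"
    using sets_eq_imp_space_eq[OF \<nu>(2)] by simp
  have event: "((\<lambda>\<Lambda>. measure (\<mu> \<Lambda>) C) \<longlongrightarrow> measure \<nu> C) (finite_subsets_at_top UNIV)"
    if "C \<in> sets config_space" "depends_on S (\<lambda>\<phi>. \<phi> \<in> C)" "finite S" for C S
    using local_event_is_cylinder[OF that(1,2)] cylinder_tendsto[OF that(3)] \<nu>(3)[OF that(3)] by fastforce
  have "((\<lambda>\<Lambda>. \<integral>\<phi>. f \<phi> \<partial>\<mu> \<Lambda>) \<longlongrightarrow> (\<integral>\<phi>. f \<phi> \<partial>\<nu>)) (finite_subsets_at_top UNIV)"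
    if f: "f \<in> borel_measurable config_space" "local_function f" "bounded (range f)" for f
  proof -
    note f(1)[measurable]
    obtain S where S: "finite S" "\<And>\<phi> \<psi>. (\<forall>x\<in>S. \<phi> x = \<psi> x) \<Longrightarrow> f \<phi> = f \<psi>"
      using f(2) unfolding local_function_def by blast
    obtain b where b: "0 < b" "\<And>\<phi>. \<bar>f \<phi>\<bar> \<le> b"
      using f(3) unfolding bounded_pos by auto
    \<comment> \<open>Affine rescaling to values in \<open>[0,1]\<close>, the range in which the
      step functions are available.\<close>
    define g where "g \<phi> = (f \<phi> + b) / (2 * b)" for \<phi>
    have fg: "f \<phi> = 2 * b * g \<phi> - b" for \<phi>
      using b(1) by (simp add: g_def)
    have "0 \<le> f \<phi> + b" "f \<phi> + b \<le> 2 * b" for \<phi>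
      using b(2)[of \<phi>] by linarith+
    then have g: "g \<in> borel_measurable config_space" "\<And>\<phi>. 0 \<le> g \<phi>" "\<And>\<phi>. g \<phi> \<le> 1"
      using b(1) by (auto simp: g_def[abs_def])
    have g_int: "(\<integral>\<phi>. f \<phi> \<partial>M) = 2 * b * (\<integral>\<phi>. g \<phi> \<partial>M) - b"
      if "prob_space M" "sets M = sets config_space" for M
    proof -
      interpret prob_space M by fact
      have "g \<in> borel_measurable M"
        using g(1) that(2) measurable_cong_sets by blast
      then have "integrable M g"
        using g by (intro integrable_const_bound[where B = 1]) auto
      then show ?thesis
        by (simp add: fg prob_space)
    qed
    have "((\<lambda>\<Lambda>. \<integral>\<phi>. g \<phi> \<partial>\<mu> \<Lambda>) \<longlongrightarrow> (\<integral>\<phi>. g \<phi> \<partial>\<nu>)) (finite_subsets_at_top UNIV)"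
    proof (rule tendsto_integral_of_level_sets[OF \<nu>(1)])
      show "eventually (\<lambda>\<Lambda>. prob_space (\<mu> \<Lambda>)) (finite_subsets_at_top UNIV)"
        using eventually_finite by eventually_elim (rule prob)
      show "g \<in> borel_measurable \<nu>"
        using g(1) \<nu>(2) measurable_cong_sets by blast
      fix t
      have "{\<phi>. t \<le> g \<phi>} \<in> sets config_space"
        using g(1) by (simp add: borel_measurable_iff_ge)
      moreover have "depends_on S (\<lambda>\<phi>. \<phi> \<in> {\<phi>. t \<le> g \<phi>})"
        unfolding depends_on_def g_def using S(2) by (metis mem_Collect_eq)
      ultimately show "((\<lambda>\<Lambda>. measure (\<mu> \<Lambda>) {\<phi> \<in> space \<nu>. t \<le> g \<phi>}) \<longlongrightarrow> measure \<nu> {\<phi> \<in> space \<nu>. t \<le> g \<phi>}) (finite_subsets_at_top UNIV)"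
        using event[OF _ _ S(1)] by (simp add: space)
    qed (use \<nu>(2) g in auto)
    then have "((\<lambda>\<Lambda>. 2 * b * (\<integral>\<phi>. g \<phi> \<partial>\<mu> \<Lambda>) - b) \<longlongrightarrow> 2 * b * (\<integral>\<phi>. g \<phi> \<partial>\<nu>) - b) (finite_subsets_at_top UNIV)"
      by (intro tendsto_intros)
    moreover have "eventually (\<lambda>\<Lambda>. 2 * b * (\<integral>\<phi>. g \<phi> \<partial>\<mu> \<Lambda>) - b = (\<integral>\<phi>. f \<phi> \<partial>\<mu> \<Lambda>)) (finite_subsets_at_top UNIV)"
      using eventually_finite by eventually_elim (simp add: g_int prob)
    ultimately show ?thesis
      unfolding g_int[OF \<nu>(1,2)] by (rule Lim_transform_eventually)
  qed
  then have "thermodynamic_limit \<mu> \<nu>"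
    unfolding thermodynamic_limit_def using \<nu>(1,2) by blast
  then show ?thesis
    by blast
qed

end

section \<open>Translation invariance of the limit\<close>

lemma filterlim_image_finite_subsets_at_top:
  fixes f :: "'a \<Rightarrow> 'b"
  assumes "bij f"
  shows "filterlim ((`) f) (finite_subsets_at_top UNIV) (finite_subsets_at_top UNIV)"
  unfolding filterlim_iff eventually_finite_subsets_at_top
proof (intro allI impI)
  fix P :: "'b set \<Rightarrow> bool"
  assume "\<exists>X. finite X \<and> X \<subseteq> UNIV \<and> (\<forall>Y. finite Y \<and> X \<subseteq> Y \<and> Y \<subseteq> UNIV \<longrightarrow> P Y)"
  then obtain X where X: "finite X" "\<And>Y. finite Y \<Longrightarrow> X \<subseteq> Y \<Longrightarrow> P Y"
    by auto
  have "X \<subseteq> f ` Y" if "inv f ` X \<subseteq> Y" for Y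
  proof
    fix x assume "x \<in> X"
    then have "f (inv f x) \<in> f ` Y"
      using that by blast
    then show "x \<in> f ` Y"
      by (simp add: surj_f_inv_f[OF bij_is_surj[OF assms]])
  qed
  then show "\<exists>X. finite X \<and> X \<subseteq> UNIV \<and> (\<forall>Y. finite Y \<and> X \<subseteq> Y \<and> Y \<subseteq> UNIV \<longrightarrow> P (f ` Y))"
    using X by (intro exI[of _ "inv f ` X"]) auto
qed

text \<open>A translation permutes the finite sets and respects inclusion, so the laws in the
  translated volumes have the same limit. It suffices to compare cylinder events with a product
  base, which determine a probability measure on the product space.\<close>

lemma thermodynamic_limit_translation_invariant:
  fixes \<nu> :: "(int ^ 'd \<Rightarrow> real) measure"
  assumes lim: "thermodynamic_limit \<mu> \<nu>"
    and sets_\<mu>: "\<And>\<Lambda>. sets (\<mu> \<Lambda>) = sets config_space"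
    and shift: "\<And>\<Lambda> a. finite \<Lambda> \<Longrightarrow> distr (\<mu> \<Lambda>) config_space (\<lambda>\<phi> x. \<phi> (x + a)) = \<mu> ((\<lambda>x. x - a) ` \<Lambda>)"
  shows "translation_invariant \<nu>"
  unfolding translation_invariant_def
proof
  fix a :: "int ^ 'd"
  let ?T = "\<lambda>(\<phi> :: int ^ 'd \<Rightarrow> real) x. \<phi> (x + a)"
  have \<nu>: "prob_space \<nu>" "sets \<nu> = sets config_space"
    using lim by (auto simp: thermodynamic_limit_def)
  interpret prob_space \<nu> by fact
  have T: "?T \<in> measurable config_space config_space"
    by (rule measurable_config_spaceI) simp
  have T\<nu>: "?T \<in> measurable \<nu> config_space"
    using T \<nu>(2) measurable_cong_sets by blast
  show "distr \<nu> config_space ?T = \<nu>"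
  proof (rule measure_eqI_PiM_infinite[where I = UNIV and M = "\<lambda>_. borel"])
    show "sets (distr \<nu> config_space ?T) = sets (PiM UNIV (\<lambda>_. borel))" "sets \<nu> = sets (PiM UNIV (\<lambda>_. borel))"
      using \<nu>(2) by (simp_all add: config_space_def)
    show "finite_measure (distr \<nu> config_space ?T)"
      using prob_space_distr[OF T\<nu>] by (rule prob_space.finite_measure)
    fix A :: "int ^ 'd \<Rightarrow> real set" and J :: "(int ^ 'd) set"
    assume J: "finite J" "\<And>j. j \<in> J \<Longrightarrow> A j \<in> sets borel"
    define C where "C = prod_emb UNIV (\<lambda>_. borel) J (Pi\<^sub>E J A)"
    have C_eq: "C = {\<phi>. \<forall>j\<in>J. \<phi> j \<in> A j}"
      by (auto simp: C_def prod_emb_def PiE_iff)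
    have C: "C \<in> sets config_space"
      unfolding C_def config_space_def using J by (intro measurable_prod_emb sets_PiM_I_finite) auto
    let ?f = "indicator C :: (int ^ 'd \<Rightarrow> real) \<Rightarrow> real"
    have loc: "local_function ?f"
      unfolding local_function_def C_eq using J(1) by (intro exI[of _ J]) (auto simp: indicator_def)
    have loc_T: "local_function (\<lambda>\<phi>. ?f (?T \<phi>))"
      unfolding local_function_def C_eq using J(1)
      by (intro exI[of _ "(\<lambda>x. x + a) ` J"]) (auto simp: indicator_def)
    have bdd: "bounded (range ?f)" "bounded (range (\<lambda>\<phi>. ?f (?T \<phi>)))"
      by (auto intro!: boundedI[of _ 1] simp: indicator_def)
    have meas: "?f \<in> borel_measurable config_space" "(\<lambda>\<phi>. ?f (?T \<phi>)) \<in> borel_measurable config_space"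
      using C T by (auto intro: measurable_compose)
    have lim_C: "((\<lambda>\<Lambda>. \<integral>\<phi>. ?f \<phi> \<partial>\<mu> \<Lambda>) \<longlongrightarrow> (\<integral>\<phi>. ?f \<phi> \<partial>\<nu>)) (finite_subsets_at_top UNIV)"
      and lim_T: "((\<lambda>\<Lambda>. \<integral>\<phi>. ?f (?T \<phi>) \<partial>\<mu> \<Lambda>) \<longlongrightarrow> (\<integral>\<phi>. ?f (?T \<phi>) \<partial>\<nu>)) (finite_subsets_at_top UNIV)"
      using lim loc loc_T bdd meas unfolding thermodynamic_limit_def by blast+
    have "bij (\<lambda>x :: int ^ 'd. x - a)"
      by (rule bij_betwI[where g = "\<lambda>x. x + a"]) auto
    from filterlim_compose[OF lim_C filterlim_image_finite_subsets_at_top[OF this]]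
    have "((\<lambda>\<Lambda>. \<integral>\<phi>. ?f \<phi> \<partial>\<mu> ((\<lambda>x. x - a) ` \<Lambda>)) \<longlongrightarrow> (\<integral>\<phi>. ?f \<phi> \<partial>\<nu>)) (finite_subsets_at_top UNIV)" .
    moreover have "eventually (\<lambda>\<Lambda>. (\<integral>\<phi>. ?f \<phi> \<partial>\<mu> ((\<lambda>x. x - a) ` \<Lambda>)) = (\<integral>\<phi>. ?f (?T \<phi>) \<partial>\<mu> \<Lambda>)) (finite_subsets_at_top UNIV)"
    proof (rule eventually_finite_subsets_at_top_weakI)
      fix \<Lambda> :: "(int ^ 'd) set" assume "finite \<Lambda>"
      moreover have "?T \<in> measurable (\<mu> \<Lambda>) config_space"
        using T sets_\<mu> measurable_cong_sets by blast
      ultimately show "(\<integral>\<phi>. ?f \<phi> \<partial>\<mu> ((\<lambda>x. x - a) ` \<Lambda>)) = (\<integral>\<phi>. ?f (?T \<phi>) \<partial>\<mu> \<Lambda>)"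
        unfolding shift[OF \<open>finite \<Lambda>\<close>, symmetric] using meas(1) by (intro integral_distr)
    qed
    ultimately have "((\<lambda>\<Lambda>. \<integral>\<phi>. ?f (?T \<phi>) \<partial>\<mu> \<Lambda>) \<longlongrightarrow> (\<integral>\<phi>. ?f \<phi> \<partial>\<nu>)) (finite_subsets_at_top UNIV)"
      by (rule Lim_transform_eventually)
    then have "(\<integral>\<phi>. ?f (?T \<phi>) \<partial>\<nu>) = (\<integral>\<phi>. ?f \<phi> \<partial>\<nu>)"
      using lim_T tendsto_unique[OF finite_subsets_at_top_neq_bot] by blast
    moreover have "(\<integral>\<phi>. ?f (?T \<phi>) \<partial>\<nu>) = measure (distr \<nu> config_space ?T) C"
      using integral_distr[OF T\<nu> meas(1)] C by simp
    moreover have "(\<integral>\<phi>. ?f \<phi> \<partial>\<nu>) = measure \<nu> C"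
      using C \<nu>(2) by simp
    ultimately have "measure (distr \<nu> config_space ?T) C = measure \<nu> C"
      by simp
    then show "emeasure (distr \<nu> config_space ?T) C = emeasure \<nu> C"
      using emeasure_eq_measure prob_space_distr[OF T\<nu>]
      by (simp add: finite_measure.emeasure_eq_measure prob_space.finite_measure)
  qed
qed

theorem proposition2p1:
  fixes p :: "int ^ 'd \<Rightarrow> real" and \<beta> \<epsilon> \<delta> :: real
  assumes "\<And>x. 0 \<le> p x \<and> p x \<le> 1"
    and "\<And>x. p (- x) = p x"
    and "(p has_sum 1) UNIV"
    and "irreducible_kernel p"
    and "\<delta> > 0"
    and "(\<lambda>x. p x * lattice_norm x powr (2 + \<delta>)) summable_on UNIV"
    and "\<beta> > 0"
    and "\<epsilon> > 0"
  shows "\<exists>\<mu>. thermodynamic_limit (pinning_measure p \<beta> \<epsilon>) \<mu> \<and> translation_invariant \<mu>"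
proof -
  obtain e where "e \<noteq> 0" "0 < p e"
    using irreducible_kernel_step[OF assms(4)] by blast
  then interpret pinning_model p e \<beta> \<epsilon>
    using assms by unfold_locales auto
  \<comment> \<open>The potential \<open>V\<close> is the averaged corrector; its bound does not
    depend on the volume because \<open>green_constant\<close> does not.\<close>
  interpret convergent_local_laws "pinning_measure p \<beta> \<epsilon>" mean_corrector
    "\<lambda>S. \<beta> * (real (card S) * green_constant) + real (card S)"
    by (rule convergent_local_laws.intro)
      (simp_all add: prob_space_pinning_measure pinning_measure_variation mean_corrector_bounded)
  obtain \<mu> where \<mu>: "thermodynamic_limit (pinning_measure p \<beta> \<epsilon>) \<mu>"
    using ex_thermodynamic_limit by blast
  have "translation_invariant \<mu>"
  proof (rule thermodynamic_limit_translation_invariant[OF \<mu>])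
    fix \<Lambda> :: "(int ^ 'd) set" and a
    assume "finite \<Lambda>"
    then show "distr (pinning_measure p \<beta> \<epsilon> \<Lambda>) config_space (\<lambda>\<phi> x. \<phi> (x + a))
        = pinning_measure p \<beta> \<epsilon> ((\<lambda>x. x - a) ` \<Lambda>)"
      by (rule distr_pinning_measure_shift)
  qed simp
  with \<mu> show ?thesis
    by blast
qed

end
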